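(* Let $n\ge2$ and $g>0$. For $p\in\mathbb{C}[\mathbf{x}']^{S_{n-1}}$, $\mathbf{x}'=(x_1,\dots,x_{n-1})$, and reals $0<y_1<y_2<\dots<y_n$, define $$[\mathbb{Q}\,p](\mathbf{y})=\frac{\Gamma(ng)}{\Gamma(g)^n}\int_{\Omega'_{\mathbf{x}}}d\mathbf{x}'\,\frac{\Delta_{n-1}(\mathbf{x}')}{\Delta_n(\mathbf{y})}\Big[\prod_{i=1}^n\hat\xi_i^{\,g-1}\Big]\,p(\mathbf{x}'),$$ where $\Omega'_{\mathbf{x}}=\{\mathbf{x}'\in\mathbb{R}^{n-1}:0<y_1<x_1<y_2<\dots<x_{n-1}<y_n<\infty\}$ and $$\hat\xi_i=\frac{\prod_{k=1}^{n-1}(x_k-y_i)}{\prod_{k\ne i}(y_k-y_i)},\qquad i=1,\dots,n.$$ Then the integral operator $\mathbb{Q}$ sends $\mathbb{C}[\mathbf{x}']^{S_{n-1}}$ into $\mathbb{C}[\mathbf{y}]^{S_n}$ and coincides with the operator $Q_0'$, where $Q_0':\mathbb{C}[\mathbf{x}']^{S_{n-1}}\to\mathbb{C}[\mathbf{y}]^{S_n}$ is the unique operator such that $Q_0=Q_0'\mathcal{P}$.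
   Context: Notation: $\Delta_m(\mathbf{x})=\prod_{1\le i<j\le m}(x_j-x_i)$; $\mathbb{C}[\mathbf{x}]^{S_n}$ is the ring of symmetric polynomials in $\mathbf{x}=(x_1,\dots,x_n)$. $\mathcal{P}:\mathbb{C}[\mathbf{x}]^{S_n}\to\mathbb{C}[\mathbf{x}']^{S_{n-1}}$ is the map $p(x_1,\dots,x_n)\mapsto p(x_1,\dots,x_{n-1},0)$. $Q_0$ is the operator $Q_z$ below at $z=0$. It is a fact that there is a unique linear operator $Q_0'$ with $Q_0=Q_0'\mathcal{P}$. The operator $Q_z$. For $g>0$, real $z>1$, and reals $0<y_1<\dots<y_n$, and $p\in\mathbb{C}[\mathbf{x}]^{S_n}$ put $$[Q_zp](\mathbf{y})=\frac{\Gamma(ng)}{\Gamma(g)^n}\,\frac{(z-1)^{1-ng}}{\Delta_n(\mathbf{y})\prod_{i=1}^n y_i^{g-1}}\int_{\Omega_{\mathbf{x}}}d\mathbf{x}\;\delta(x_1\cdots x_n-z\,y_1\cdots y_n)\,\Delta_n(\mathbf{x})\Big[\prod_{i=1}^n\xi_i^{g-1}\Big]p(\mathbf{x}),$$ where $\Omega_{\mathbf{x}}=\{\mathbf{x}\in\mathbb{R}^n: 0<y_1<x_1<y_2<\dots<x_{n-1}<y_n<x_n<\infty\}$, $\xi_i=\prod_{k=1}^n(x_k-y_i)\big/\prod_{k\ne i}(y_k-y_i)>0$, and $\delta$ is the Dirac delta function (so $\int\delta(h(\mathbf x))F(\mathbf x)d\mathbf x=\int_{\{h=0\}}F\,dS/|\nabla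 h|$). The function $[Q_zp](\mathbf{y})$ is a polynomial in $z$ and a symmetric polynomial in $\mathbf{y}$; accordingly $Q_z$ is extended to all $z\in\mathbb{C}$ as a linear operator $\mathbb{C}[\mathbf{x}]^{S_n}\to\mathbb{C}[\mathbf{y}]^{S_n}$. *)

theory Defs
  imports
    "HOL-Analysis.Analysis"
    "HOL-Library.Poly_Mapping"
    "HOL-Combinatorics.Permutations"
begin

subsection \<open>Symmetric polynomials\<close>

text \<open>A monomial is a finitely supported exponent vector, the variables being indexed by
  natural numbers; a polynomial is a finitely supported family of coefficients. Multiplication
  is the convolution product of \<^theory>\<open>HOL-Library.Poly_Mapping\<close>.\<close>

type_synonym cpoly = "(nat \<Rightarrow>\<^sub>0 nat) \<Rightarrow>\<^sub>0 complex"

definition Const :: "complex \<Rightarrow> cpoly" where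
  "Const c = Poly_Mapping.single 0 c"

definition Var :: "nat \<Rightarrow> cpoly" where
  "Var i = Poly_Mapping.single (Poly_Mapping.single i 1) 1"

text \<open>Substitution of \<open>\<sigma> i\<close> for the \<open>i\<close>-th variable, where \<open>\<iota>\<close> embeds the coefficients into the
  target ring.\<close>

definition insertion :: "(complex \<Rightarrow> 'a) \<Rightarrow> (nat \<Rightarrow> 'a) \<Rightarrow> cpoly \<Rightarrow> 'a::comm_semiring_1" where
  "insertion \<iota> \<sigma> p =
     (\<Sum>m\<in>Poly_Mapping.keys p. \<iota> (Poly_Mapping.lookup p m) *
        (\<Prod>i\<in>Poly_Mapping.keys m. \<sigma> i ^ Poly_Mapping.lookup m i))"

definition psubst :: "(nat \<Rightarrow> cpoly) \<Rightarrow> cpoly \<Rightarrow> cpoly" where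
  "psubst \<sigma> = insertion Const \<sigma>"

definition peval :: "cpoly \<Rightarrow> (nat \<Rightarrow> real) \<Rightarrow> complex" where
  "peval p x = insertion (\<lambda>c. c) (\<lambda>i. of_real (x i)) p"

definition sym_polys :: "nat \<Rightarrow> cpoly set" where
  "sym_polys n =
     {p. (\<forall>m\<in>Poly_Mapping.keys p. Poly_Mapping.keys m \<subseteq> {1..n}) \<and>
         (\<forall>\<pi>. \<pi> permutes {1..n} \<longrightarrow> psubst (\<lambda>i. Var (\<pi> i)) p = p)}"

text \<open>The map \<open>p(x\<^sub>1, \<dots>, x\<^sub>n) \<mapsto> p(x\<^sub>1, \<dots>, x\<^sub>n\<^sub>-\<^sub>1, 0)\<close>.\<close>

definition set_last_zero :: "nat \<Rightarrow> cpoly \<Rightarrow> cpoly" where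
  "set_last_zero n = psubst (Var(n := 0))"

text \<open>Linear operators \<open>A \<rightarrow> B\<close> are taken to be extensional, so that two of them are equal as
  HOL functions iff they agree on \<open>A\<close>.\<close>

definition linear_operators :: "cpoly set \<Rightarrow> cpoly set \<Rightarrow> (cpoly \<Rightarrow> cpoly) set" where
  "linear_operators A B =
     {T \<in> A \<rightarrow>\<^sub>E B. (\<forall>p\<in>A. \<forall>q\<in>A. T (p + q) = T p + T q) \<and>
                  (\<forall>c. \<forall>p\<in>A. T (Const c * p) = Const c * T p)}"

subsection \<open>The Dirac delta of a function\<close>

text \<open>Points of \<open>\<real>\<^sup>n\<close> are functions on \<open>{1..n}\<close>; \<open>leb n\<close> is the \<open>n\<close>-dimensional Lebesgue
  measure on (the extensional ones among) them.\<close>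

abbreviation leb :: "nat \<Rightarrow> (nat \<Rightarrow> real) measure" where
  "leb n \<equiv> PiM {1..n} (\<lambda>_. lborel)"

definition grad_norm :: "nat \<Rightarrow> ((nat \<Rightarrow> real) \<Rightarrow> real) \<Rightarrow> (nat \<Rightarrow> real) \<Rightarrow> real" where
  "grad_norm n h x = sqrt (\<Sum>k=1..n. (deriv (\<lambda>t. h (x(k := t))) (x k))\<^sup>2)"

text \<open>The surface integral \<open>\<integral>\<^sub>S F dS\<close> over a hypersurface \<open>S \<subseteq> \<real>\<^sup>n\<close> that is a graph
  \<open>x\<^sub>n = \<phi>(x')\<close>, \<open>x' \<in> D \<subseteq> \<real>\<^sup>n\<^sup>-\<^sup>1\<close>. The area element of such a graph is
  \<open>dS = sqrt (1 + |\<nabla>\<phi>|\<^sup>2) dx'\<close>.\<close>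

definition surface_integral ::
    "nat \<Rightarrow> (nat \<Rightarrow> real) set \<Rightarrow> ((nat \<Rightarrow> real) \<Rightarrow> complex) \<Rightarrow> complex" where
  "surface_integral n S F =
     (let D = {x'. \<exists>t. x'(n := t) \<in> S};
          \<phi> = (\<lambda>x'. THE t. x'(n := t) \<in> S)
      in LINT x':D|leb (n - 1).
           of_real (sqrt (1 + (grad_norm (n - 1) \<phi> x')\<^sup>2)) * F (x'(n := \<phi> x')))"

text \<open>\<open>\<integral>\<^sub>\<Omega> \<delta>(h(x)) F(x) dx\<close>, i.e. the integral of \<open>F / |\<nabla>h|\<close> over \<open>\<Omega> \<inter> {h = 0}\<close> with respect to
  surface measure. It is applied below only to \<open>h = x\<^sub>1 \<cdots> x\<^sub>n - const\<close> and positive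
  coordinates, where the surface is a graph over the first \<open>n - 1\<close> coordinates.\<close>

definition delta_integral ::
    "nat \<Rightarrow> (nat \<Rightarrow> real) set \<Rightarrow> ((nat \<Rightarrow> real) \<Rightarrow> real) \<Rightarrow> ((nat \<Rightarrow> real) \<Rightarrow> complex) \<Rightarrow> complex"
  where
  "delta_integral n \<Omega> h F =
     surface_integral n {x \<in> \<Omega>. h x = 0} (\<lambda>x. F x / of_real (grad_norm n h x))"

subsection \<open>The operator \<open>Q\<^sub>z\<close>\<close>

definition Vandermonde :: "nat \<Rightarrow> (nat \<Rightarrow> real) \<Rightarrow> real" where
  "Vandermonde m x = (\<Prod>(i,j)\<in>{(i,j). 1 \<le> i \<and> i < j \<and> j \<le> m}. x j - x i)"

definition pos_increasing :: "nat \<Rightarrow> (nat \<Rightarrow> real) \<Rightarrow> bool" where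
  "pos_increasing n y \<longleftrightarrow> (\<forall>i\<in>{1..n}. 0 < y i) \<and> strict_mono_on {1..n} y"

text \<open>\<open>y\<^sub>1 < x\<^sub>1 < y\<^sub>2 < \<dots> < x\<^sub>n\<^sub>-\<^sub>1 < y\<^sub>n < x\<^sub>n\<close>, and the same without \<open>x\<^sub>n\<close>.\<close>

definition Omega :: "nat \<Rightarrow> (nat \<Rightarrow> real) \<Rightarrow> (nat \<Rightarrow> real) set" where
  "Omega n y = {x. (\<forall>i\<in>{1..n}. y i < x i) \<and> (\<forall>i\<in>{1..n - 1}. x i < y (i + 1))}"

definition Omega' :: "nat \<Rightarrow> (nat \<Rightarrow> real) \<Rightarrow> (nat \<Rightarrow> real) set" where
  "Omega' n y = {x. \<forall>i\<in>{1..n - 1}. y i < x i \<and> x i < y (i + 1)}"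

definition xi :: "nat \<Rightarrow> (nat \<Rightarrow> real) \<Rightarrow> (nat \<Rightarrow> real) \<Rightarrow> nat \<Rightarrow> real" where
  "xi n y x i = (\<Prod>k=1..n. x k - y i) / (\<Prod>k\<in>{1..n} - {i}. y k - y i)"

definition Q_integral :: "nat \<Rightarrow> real \<Rightarrow> real \<Rightarrow> cpoly \<Rightarrow> (nat \<Rightarrow> real) \<Rightarrow> complex" where
  "Q_integral n g z p y =
     of_real (Gamma (n * g) / Gamma g ^ n *
              ((z - 1) powr (1 - n * g) / (Vandermonde n y * (\<Prod>i=1..n. y i powr (g - 1))))) *
     delta_integral n (Omega n y) (\<lambda>x. (\<Prod>i=1..n. x i) - z * (\<Prod>i=1..n. y i))
       (\<lambda>x. of_real (Vandermonde n x * (\<Prod>i=1..n. xi n y x i powr (g - 1))) * peval p x)"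

text \<open>The integral above defines \<open>Q\<^sub>z\<close> for real \<open>z > 1\<close>. The family \<open>Q_op n g\<close> is its extension
  to all complex \<open>z\<close> by polynomiality in \<open>z\<close>.\<close>

definition is_Q_family :: "nat \<Rightarrow> real \<Rightarrow> (complex \<Rightarrow> cpoly \<Rightarrow> cpoly) \<Rightarrow> bool" where
  "is_Q_family n g Q \<longleftrightarrow>
     (\<forall>z. Q z \<in> linear_operators (sym_polys n) (sym_polys n)) \<and>
     (\<forall>p\<in>sym_polys n. \<exists>N c. \<forall>z. Q z p = (\<Sum>k\<le>N. Const (z ^ k) * c k)) \<and>
     (\<forall>p\<in>sym_polys n. \<forall>z>1. \<forall>y. pos_increasing n y \<longrightarrow>
        peval (Q (of_real z) p) y = Q_integral n g z p y)"

definition Q_op :: "nat \<Rightarrow> real \<Rightarrow> complex \<Rightarrow> cpoly \<Rightarrow> cpoly" where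
  "Q_op n g = (THE Q. is_Q_family n g Q)"

text \<open>The operator \<open>Q\<^sub>0'\<close> through which \<open>Q\<^sub>0\<close> factors.\<close>

definition Q0' :: "nat \<Rightarrow> real \<Rightarrow> cpoly \<Rightarrow> cpoly" where
  "Q0' n g = (THE T. T \<in> linear_operators (sym_polys (n - 1)) (sym_polys n) \<and>
                     (\<forall>p\<in>sym_polys n. Q_op n g 0 p = T (set_last_zero n p)))"

subsection \<open>The integral operator\<close>

definition xi_hat :: "nat \<Rightarrow> (nat \<Rightarrow> real) \<Rightarrow> (nat \<Rightarrow> real) \<Rightarrow> nat \<Rightarrow> real" where
  "xi_hat n y x i = (\<Prod>k=1..n - 1. x k - y i) / (\<Prod>k\<in>{1..n} - {i}. y k - y i)"

definition QQ_integrand ::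
    "nat \<Rightarrow> real \<Rightarrow> cpoly \<Rightarrow> (nat \<Rightarrow> real) \<Rightarrow> (nat \<Rightarrow> real) \<Rightarrow> complex" where
  "QQ_integrand n g p y x =
     of_real (Vandermonde (n - 1) x / Vandermonde n y *
              (\<Prod>i=1..n. xi_hat n y x i powr (g - 1))) * peval p x"

definition QQ :: "nat \<Rightarrow> real \<Rightarrow> cpoly \<Rightarrow> (nat \<Rightarrow> real) \<Rightarrow> complex" where
  "QQ n g p y =
     of_real (Gamma (n * g) / Gamma g ^ n) *
     (LINT x:Omega' n y|leb (n - 1). QQ_integrand n g p y x)"

end

theory Submission
  imports Defs "HOL-Computational_Algebra.Polynomial_FPS"
begin

text \<open>
  Write \<open>x\<^sub>n = z y\<^sub>1 \<cdots> y\<^sub>n / (x\<^sub>1 \<cdots> x\<^sub>n\<^sub>-\<^sub>1)\<close> for the coordinate eliminated by the delta function. By Lagrange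
  interpolation at the \<open>y\<^sub>i\<close>, the numbers \<open>\<eta>\<^sub>i = \<xi>\<^sub>i / ((z - 1) y\<^sub>i)\<close> sum to \<open>1\<close> and
  \<open>\<Prod>\<^sub>k (t - x\<^sub>k) = \<Sum>\<^sub>i \<eta>\<^sub>i (t - z y\<^sub>i) \<Prod>\<^sub>k\<^sub>\<noteq>\<^sub>i (t - y\<^sub>k)\<close>.
  The interlacing region corresponds to the open simplex \<open>\<eta>\<^sub>i > 0\<close>, and the measure in \<open>Q\<^sub>z\<close>
  becomes a multiple of the Dirichlet density with all parameters equal to \<open>g\<close>, which does not depend on
  \<open>y\<close> and \<open>z\<close>. Hence \<open>[Q\<^sub>z p](y)\<close> is the Dirichlet average of \<open>p(x)\<close>, where the elementary symmetric
  functions of \<open>x\<close>, and so by Newton's identities \<open>p(x)\<close> itself, are polynomials in \<open>\<eta>, z, y\<close>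
  invariant under simultaneous permutations of \<open>\<eta>\<close> and \<open>y\<close>. Everything up to here also makes sense for
  \<open>z = 0\<close>: then \<open>x\<^sub>n = 0\<close>, \<open>\<eta>\<^sub>i\<close> is the \<open>\<xi>\<^sub>i\<close> with a hat, and the Dirichlet average is the second integral operator
  applied to \<open>p(x\<^sub>1, \<dots>, x\<^sub>n\<^sub>-\<^sub>1, 0)\<close>.
\<close>

subsection \<open>One-dimensional substitution and scaling\<close>

text \<open>The obstacle is the change of variables in \<open>n - 1\<close> dimensions. In place of
  a global diffeomorphism and its Jacobian determinant, an induction freezes one coordinate
  \<open>x m = u\<close> at a time: the slice is an integral of the same shape with \<open>z\<close>
  replaced by \<open>z * y m / u\<close>, and the only genuine substitution is the one-dimensional
  \<open>v = (b - u) * B u\<close> with \<open>B\<close> decreasing. This is why \<open>z\<close>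
  varies in the induction, and why \<open>z = 0\<close> is treated together with
  \<open>z > 1\<close>: slicing reproduces the value \<open>0\<close>, and a value above
  \<open>1\<close> either stays above \<open>1\<close> or yields an empty slice. No limit
  \<open>z -> 0\<close> is taken. For each \<open>p\<close> the moments of the simplex give one
  polynomial in \<open>z\<close> with coefficients in \<open>y\<close>; its values for
  \<open>z > 1\<close> are the delta integrals, its value at \<open>0\<close> is the second
  integral, and the former determine it. The value at \<open>0\<close> sees \<open>p\<close> only
  with its last variable set to zero, which yields the factorisation; power sums generate the
  symmetric polynomials, so every symmetric polynomial in \<open>n - 1\<close> variables lifts to
  \<open>n\<close> variables, which yields uniqueness.\<close>

abbreviation leb_on :: "nat set \<Rightarrow> (nat \<Rightarrow> real) measure" where
  "leb_on I \<equiv> PiM I (\<lambda>_. lborel)"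

interpretation lebesgue_product: product_sigma_finite "\<lambda>_::nat. lborel :: real measure"
  by standard

text \<open>Fubini reduces the diagonal scaling to the affine substitution in one variable at a
  time. It serves to pass from inner to outer simplex coordinates when a slice is frozen.\<close>

lemma nn_integral_PiM_scale:
  fixes l :: "nat \<Rightarrow> real"
  assumes "finite I" "\<And>i. i \<in> I \<Longrightarrow> l i > 0"
    and "f \<in> borel_measurable (leb_on I)"
  shows "(\<integral>\<^sup>+x. f x \<partial>leb_on I) =
    ennreal (\<Prod>i\<in>I. l i) * (\<integral>\<^sup>+x. f (\<lambda>i\<in>I. l i * x i) \<partial>leb_on I)"
  using assms
proof (induction I arbitrary: f rule: finite_induct)
  case empty
  then show ?case
    by (subst (1 2) lebesgue_product.nn_integral_empty) (auto simp: restrict_def)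
next
  case (insert j I)
  note [measurable] = insert.prems(2)
  let ?M = leb_on
  have j: "l j > 0" using insert by auto
  have fj: "(\<lambda>y. f (x(j := y))) \<in> borel_measurable borel" if "x \<in> space (?M I)" for x
    using measurable_compose[OF measurable_component_update[OF that \<open>j \<notin> I\<close>] insert.prems(2)] by (simp add: fun_upd_def)
  have upd: "(\<lambda>(x, y). f (x(j := l j * y))) \<in> borel_measurable (?M I \<Otimes>\<^sub>M lborel)"
  proof -
    have "(\<lambda>p. (fst p)(j := l j * snd p)) \<in> measurable (?M I \<Otimes>\<^sub>M lborel) (?M (insert j I))"
      by (rule measurable_fun_upd[where J=I]) auto
    from measurable_compose[OF this insert.prems(2)] show ?thesis by (simp add: case_prod_beta)
  qed
  \<comment> \<open>The induction hypothesis is applied to this inner integral as a function of the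
    remaining coordinates.\<close>
  have meas: "(\<lambda>x. \<integral>\<^sup>+y. f (x(j := l j * y)) \<partial>lborel) \<in> borel_measurable (?M I)"
    using lborel.borel_measurable_nn_integral[OF upd] .
  have "(\<integral>\<^sup>+x. f x \<partial>?M (insert j I)) = (\<integral>\<^sup>+x. \<integral>\<^sup>+y. f (x(j := y)) \<partial>lborel \<partial>?M I)"
    using insert by (simp add: lebesgue_product.product_nn_integral_insert)
  also have "\<dots> = (\<integral>\<^sup>+x. ennreal (l j) * (\<integral>\<^sup>+y. f (x(j := l j * y)) \<partial>lborel) \<partial>?M I)"
    using j by (intro nn_integral_cong, subst nn_integral_real_affine[OF fj, of _ "l j" 0]) auto
  also have "\<dots> = ennreal (l j) * (\<integral>\<^sup>+x. \<integral>\<^sup>+y. f (x(j := l j * y)) \<partial>lborel \<partial>?M I)"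
    by (rule nn_integral_cmult[OF meas])
  also have "(\<integral>\<^sup>+x. \<integral>\<^sup>+y. f (x(j := l j * y)) \<partial>lborel \<partial>?M I) =
     ennreal (prod l I) * (\<integral>\<^sup>+x. \<integral>\<^sup>+y. f ((\<lambda>i\<in>I. l i * x i)(j := l j * y)) \<partial>lborel \<partial>?M I)"
    by (rule insert.IH[OF _ meas]) (use insert.prems in auto)
  also have "(\<integral>\<^sup>+x. \<integral>\<^sup>+y. f ((\<lambda>i\<in>I. l i * x i)(j := l j * y)) \<partial>lborel \<partial>?M I) =
     (\<integral>\<^sup>+x. \<integral>\<^sup>+y. f (\<lambda>i\<in>insert j I. l i * (x(j := y)) i) \<partial>lborel \<partial>?M I)"
    using insert.hyps
    by (intro nn_integral_cong arg_cong[of _ _ f]) (auto simp: fun_eq_iff restrict_def)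
  also have "\<dots> = (\<integral>\<^sup>+x. f (\<lambda>i\<in>insert j I. l i * x i) \<partial>?M (insert j I))"
    using insert.hyps by (subst lebesgue_product.product_nn_integral_insert) auto
  also have "ennreal (l j) * (ennreal (prod l I) * c) = ennreal (prod l (insert j I)) * c" for c
    using insert.hyps j by (simp add: ennreal_mult' mult.assoc less_imp_le)
  finally show ?case .
qed

text \<open>The reflection \<open>u = - x\<close> turns \<open>G\<close> into an increasing function
  with derivative \<open>w (- x)\<close>, to which the substitution rule for increasing functions
  applies; a second reflection restores the interval.\<close>

lemma nn_integral_substitution_decreasing:
  fixes f :: "real \<Rightarrow> ennreal" and G :: "real \<Rightarrow> real"
  assumes [measurable]: "f \<in> borel_measurable borel" and "a < b"
    and deriv: "\<And>u. u \<in> {a..b} \<Longrightarrow> (G has_real_derivative - w u) (at u)"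
    and cont: "continuous_on {a..b} w"
    and nonneg: "\<And>u. u \<in> {a..b} \<Longrightarrow> 0 \<le> w u"
  shows "(\<integral>\<^sup>+v. f v * indicator {G b..G a} v \<partial>lborel) =
    (\<integral>\<^sup>+u. f (G u) * ennreal (w u) * indicator {a..b} u \<partial>lborel)"
proof -
  have contG: "continuous_on {a..b} G"
    by (rule has_real_derivative_imp_continuous_on[OF deriv])
  have "(\<integral>\<^sup>+v. f v * indicator {G (-(-b))..G (-(-a))} v \<partial>lborel) =
    (\<integral>\<^sup>+u. f (G (-u)) * ennreal (w (-u)) * indicator {-b..-a} u \<partial>lborel)"
  proof (rule nn_integral_substitution_aux[where g="\<lambda>x. G (- x)" and g'="\<lambda>x. w (- x)"])
    fix x assume x: "x \<in> {-b..-a}"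
    then have x': "- x \<in> {a..b}" by auto
    show "((\<lambda>x. G (- x)) has_real_derivative w (- x)) (at x)"
    proof -
      have "(uminus has_real_derivative -1) (at x)"
        by (auto intro!: derivative_eq_intros)
      from DERIV_chain2[OF deriv[OF x'] this] show ?thesis by simp
    qed
    show "0 \<le> w (- x)" using nonneg[OF x'] .
  next
    show "continuous_on {-b..-a} (\<lambda>x. w (- x))"
      by (rule continuous_on_compose2[OF cont]) (auto intro!: continuous_intros)
  qed (use \<open>a < b\<close> in simp_all)
  also have "\<dots> = (\<integral>\<^sup>+u. f (G u) * ennreal (w u) * indicator {a..b} u \<partial>lborel)"
  proof -
    \<comment> \<open>\<open>G\<close> and \<open>w\<close> are controlled only on
      \<open>{a..b}\<close>; cutting them off there makes the integrand measurable on the whole line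
      without changing it.\<close>
    have [measurable]: "(\<lambda>u. w u * indicator {a..b} u) \<in> borel_measurable borel"
         "(\<lambda>u. G u * indicator {a..b} u) \<in> borel_measurable borel"
      using borel_measurable_continuous_on_indicator[OF _ cont] borel_measurable_continuous_on_indicator[OF _ contG]
      by (auto simp: mult.commute)
    have "(\<lambda>u. f (G u * indicator {a..b} u) * ennreal (w u * indicator {a..b} u) * indicator {a..b} u)
        \<in> borel_measurable borel" by measurable
    also have "(\<lambda>u. f (G u * indicator {a..b} u) * ennreal (w u * indicator {a..b} u) * indicator {a..b} u)
      = (\<lambda>u. f (G u) * ennreal (w u) * indicator {a..b} u)"
      by (rule ext) (simp split: split_indicator)
    finally have "(\<lambda>u. f (G u) * ennreal (w u) * indicator {a..b} u) \<in> borel_measurable borel" .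
    note affine = nn_integral_real_affine[OF this, of "-1" 0]
    have "indicator {-b..-a} u = (indicator {a..b} (-u) :: ennreal)" for u
      by (auto simp: indicator_def)
    then show ?thesis by (subst affine) simp_all
  qed
  finally show ?thesis unfolding minus_minus .
qed

text \<open>With \<open>v = (b - u) * B u\<close> one has
  \<open>- dv/du = B u - (b - u) * B' u\<close>, which is nonnegative where \<open>B\<close> is.
  Since \<open>B\<close> decreases, it is positive on an initial piece of the interval, and there
  \<open>v\<close> runs monotonically from \<open>(b - a) * B a\<close> down to \<open>0\<close>. In
  the application \<open>v\<close> is a simplex coordinate and \<open>B\<close> a slice
  factor.\<close>

lemma nn_integral_substitution_factored:
  fixes f :: "real \<Rightarrow> ennreal" and B B' :: "real \<Rightarrow> real"
  assumes [measurable]: "f \<in> borel_measurable borel" and "a < b"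
    and deriv: "\<And>u. u \<in> {a..b} \<Longrightarrow> (B has_real_derivative B' u) (at u)"
    and cont: "continuous_on {a..b} B'"
    and nonpos: "\<And>u. u \<in> {a..b} \<Longrightarrow> B' u \<le> 0"
  shows "(\<integral>\<^sup>+u. (if a < u \<and> u < b \<and> 0 < B u
            then ennreal (B u - (b - u) * B' u) * f ((b - u) * B u) else 0) \<partial>lborel) =
    (\<integral>\<^sup>+v. (if 0 < v \<and> v < (b - a) * B a then f v else 0) \<partial>lborel)"
proof -
  have contB: "continuous_on {a..b} B"
    by (rule has_real_derivative_imp_continuous_on[OF deriv])
  have anti: "B v \<le> B u" if "a \<le> u" "u \<le> v" "v \<le> b" for u v
  proof (rule DERIV_nonpos_imp_nonincreasing[OF that(2)])
    fix x assume "u \<le> x" "x \<le> v"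
    then have "x \<in> {a..b}" using that by auto
    from deriv[OF this] nonpos[OF this]
    show "\<exists>d. (B has_real_derivative d) (at x) \<and> d \<le> 0" by blast
  qed
  show ?thesis
  proof (cases "B a \<le> 0")
    case True
    then have "B u \<le> 0" if "a < u" "u < b" for u using anti[of a u] that by auto
    then have 1: "(a < u \<and> u < b \<and> 0 < B u) = False" for u by force
    have "(b - a) * B a \<le> 0" using True \<open>a < b\<close> by (simp add: mult_nonneg_nonpos)
    then have 2: "(0 < v \<and> v < (b - a) * B a) = False" for v by auto
    show ?thesis unfolding 1 2 by simp
  next
    case False
    \<comment> \<open>\<open>c\<close> is the right end of the part where \<open>B\<close> is
      positive: \<open>b\<close> itself if \<open>B b > 0\<close>, otherwise the first zero of
      \<open>B\<close>. In both cases \<open>v\<close> vanishes there.\<close>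
    obtain c where c: "a < c" "c \<le> b" "(b - c) * B c = 0" "\<And>u. a \<le> u \<Longrightarrow> u < c \<Longrightarrow> 0 < B u"
      "\<And>u. c \<le> u \<Longrightarrow> u < b \<Longrightarrow> B u \<le> 0" "0 \<le> B c"
    proof (cases "B b > 0")
      case True
      have "0 < B u" if "a \<le> u" "u < b" for u
        using anti[of u b] that True by auto
      with True \<open>a < b\<close> show thesis
        by (intro that[of b]) auto
    next
      case False
      define S where "S = {u\<in>{a..b}. B u \<le> 0}"
      have "closed S"
        unfolding S_def using continuous_on_closed_Collect_le[OF contB continuous_on_const[of _ 0]] by simp
      moreover have "bounded S" unfolding S_def
        by (rule bounded_subset[of "{a..b}"]) auto
      moreover have "b \<in> S" using False \<open>a < b\<close> by (auto simp: S_def)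
      ultimately obtain c where c: "c \<in> S" "\<And>u. u \<in> S \<Longrightarrow> c \<le> u"
        using compact_attains_inf[of S] by (metis compact_eq_bounded_closed empty_iff)
      have pos: "0 < B u" if "a \<le> u" "u < c" for u using c that by (force simp: S_def)
      have ac: "a < c" using c \<open>\<not> B a \<le> 0\<close> by (auto simp: S_def order.order_iff_strict)
      have "B c = 0"
      proof (rule ccontr)
        assume "B c \<noteq> 0"
        then have "B c < 0" using c by (auto simp: S_def)
        have "continuous_on {a..c} B" by (rule continuous_on_subset[OF contB]) (use c in \<open>auto simp: S_def\<close>)
        then obtain x where "a \<le> x" "x \<le> c" "B x = 0"
          using IVT2'[of B c 0 a] \<open>B c < 0\<close> \<open>\<not> B a \<le> 0\<close> ac by auto
        then show False using pos[of x] \<open>B c < 0\<close> by (cases "x = c") auto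
      qed
      then show thesis using c ac pos anti[of c]
        by (intro that[of c]) (auto simp: S_def)
    qed
    define G where "G u = (b - u) * B u" for u
    define w where "w u = B u - (b - u) * B' u" for u
    have *: "(\<integral>\<^sup>+v. f v * indicator {G c..G a} v \<partial>lborel) =
      (\<integral>\<^sup>+u. f (G u) * ennreal (w u) * indicator {a..c} u \<partial>lborel)"
    proof (rule nn_integral_substitution_decreasing)
      show "(G has_real_derivative - w u) (at u)" if "u \<in> {a..c}" for u
        unfolding G_def w_def using that c
        by (auto intro!: derivative_eq_intros deriv simp: algebra_simps)
      show "continuous_on {a..c} w" unfolding w_def using c
        by (intro continuous_intros continuous_on_subset[OF contB] continuous_on_subset[OF cont]) auto
      show "0 \<le> w u" if "u \<in> {a..c}" for u
      proof -
        have "(b - u) * B' u \<le> 0" using that c nonpos[of u] by (intro mult_nonneg_nonpos) auto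
        moreover have "0 \<le> B u"
          using c(4)[of u] c(6) that by (cases "u = c") (auto intro: less_imp_le)
        ultimately show ?thesis by (simp add: w_def)
      qed
    qed (use c in auto)
    have "(\<integral>\<^sup>+u. (if a < u \<and> u < b \<and> 0 < B u then ennreal (w u) * f (G u) else 0) \<partial>lborel) =
       (\<integral>\<^sup>+u. f (G u) * ennreal (w u) * indicator {a..c} u \<partial>lborel)"
    proof (rule nn_integral_cong_AE)
      show "AE u in lborel. (if a < u \<and> u < b \<and> 0 < B u then ennreal (w u) * f (G u) else 0) =
         f (G u) * ennreal (w u) * indicator {a..c} u"
        using AE_lborel_singleton[of a] AE_lborel_singleton[of c]
      proof eventually_elim
        case (elim u)
        then show ?case using c(2) c(4)[of u] c(5)[of u]
          by (auto simp: mult_ac indicator_def)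
      qed
    qed
    also note *[symmetric]
    also have "(\<integral>\<^sup>+v. f v * indicator {G c..G a} v \<partial>lborel) =
       (\<integral>\<^sup>+v. (if 0 < v \<and> v < G a then f v else 0) \<partial>lborel)"
    proof (rule nn_integral_cong_AE)
      show "AE v in lborel. f v * indicator {G c..G a} v = (if 0 < v \<and> v < G a then f v else 0)"
        using AE_lborel_singleton[of 0] AE_lborel_singleton[of "G a"]
      proof eventually_elim
        case (elim v)
        then show ?case using c(3) unfolding G_def by (auto simp: mult_ac indicator_def)
      qed
    qed
    finally show ?thesis unfolding G_def w_def .
  qed
qed

subsection \<open>Lagrange interpolation\<close>

text \<open>The difference of the two sides, as a polynomial in \<open>t\<close>, has degree below
  \<open>card A\<close> because both products are monic, and it vanishes at the
  \<open>card A\<close> distinct nodes \<open>y i\<close>. The minus sign of the sum comes from the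
  factors \<open>X k - y i\<close> and \<open>y k - y i\<close>: reversing them costs one sign more
  above than below.\<close>

lemma lagrange_monic:
  fixes X y :: "nat \<Rightarrow> 'a::field"
  assumes "finite A" "inj_on y A"
  shows "(\<Prod>k\<in>A. t - X k) = (\<Prod>k\<in>A. t - y k) -
    (\<Sum>i\<in>A. (\<Prod>k\<in>A. X k - y i) / (\<Prod>k\<in>A - {i}. y k - y i) * (\<Prod>k\<in>A - {i}. t - y k))"
proof -
  define c where "c i = (\<Prod>k\<in>A. X k - y i) / (\<Prod>k\<in>A - {i}. y k - y i)" for i
  define R where "R X = (\<Prod>k\<in>A. [:- X k, 1:])" for X :: "nat \<Rightarrow> 'a"
  define S where "S = (\<Sum>i\<in>A. smult (c i) (\<Prod>k\<in>A - {i}. [:- y k, 1:]))"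
  define P where "P = R X - R y + S"
  have deg: "degree (R X) = card A" for X
    unfolding R_def by (subst degree_prod_sum_eq) auto
  have lead: "lead_coeff (R X) = 1" for X
    unfolding R_def by (simp add: lead_coeff_prod)
  have "degree S \<le> card A - 1"
    unfolding S_def
  proof (rule degree_sum_le[OF \<open>finite A\<close>])
    fix i assume "i \<in> A"
    have "degree (\<Prod>k\<in>A - {i}. [:- y k, 1:]) = card A - 1"
      using \<open>i \<in> A\<close> \<open>finite A\<close> by (subst degree_prod_sum_eq) auto
    then show "degree (smult (c i) (\<Prod>k\<in>A - {i}. [:- y k, 1:])) \<le> card A - 1"
      using degree_smult_le by metis
  qed
  have roots: "poly P (y i) = 0" if "i \<in> A" for i
  proof -
    have nz: "(\<Prod>k\<in>A - {i}. y k - y i) \<noteq> 0"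
      using assms that by (auto simp: inj_on_def)
    have "poly S (y i) = (\<Sum>j\<in>A. c j * (\<Prod>k\<in>A - {j}. y i - y k))"
      by (simp add: S_def poly_sum poly_prod)
    also have "\<dots> = c i * (\<Prod>k\<in>A - {i}. y i - y k)"
      using assms that
      by (subst sum.remove[of _ i]) (auto intro!: sum.neutral)
    also have "(\<Prod>k\<in>A - {i}. y i - y k) = (-1) ^ card (A - {i}) * (\<Prod>k\<in>A - {i}. y k - y i)"
      using prod_uminus[of "\<lambda>k. y k - y i" "A - {i}"] by simp
    also have "c i * \<dots> = (-1) ^ card (A - {i}) * (\<Prod>k\<in>A. X k - y i)"
      using iffD1[OF nonzero_eq_divide_eq[OF nz] c_def] by (metis mult.left_commute)
    also have "\<dots> = - ((-1) ^ card A * (\<Prod>k\<in>A. X k - y i))"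
      unfolding card.remove[OF assms(1) that] power_Suc by simp
    also have "(-1) ^ card A * (\<Prod>k\<in>A. X k - y i) = (\<Prod>k\<in>A. y i - X k)"
      using prod_uminus[of "\<lambda>k. X k - y i" A] by simp
    finally have "poly S (y i) = - (\<Prod>k\<in>A. y i - X k)" .
    moreover have "poly (R y) (y i) = 0" using that assms(1) by (auto simp: R_def poly_prod)
    ultimately show ?thesis by (simp add: P_def R_def poly_prod)
  qed
  have "P = 0"
  proof (cases "A = {}")
    case True
    then show ?thesis by (simp add: P_def R_def S_def)
  next
    case False
    then have "0 < card A" using assms by auto
    have "coeff P (card A) = 0"
      using lead[of X] lead[of y] \<open>degree S \<le> card A - 1\<close> \<open>0 < card A\<close>
      by (simp add: P_def deg coeff_eq_0)
    moreover have "degree P \<le> card A"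
      unfolding P_def using \<open>degree S \<le> card A - 1\<close>
      by (intro degree_add_le degree_diff_le) (auto simp: deg)
    ultimately have "degree P < card A \<or> P = 0"
      by (metis leading_coeff_0_iff nat_less_le)
    then show "P = 0"
    proof
      assume "degree P < card A"
      show "P = 0"
      proof (rule ccontr)
        assume "P \<noteq> 0"
        have "card (y ` A) \<le> card {x. poly P x = 0}"
          using roots by (intro card_mono poly_roots_finite \<open>P \<noteq> 0\<close>) auto
        also have "\<dots> \<le> degree P" using card_poly_roots_bound[OF \<open>P \<noteq> 0\<close>] .
        finally show False using \<open>degree P < card A\<close> assms by (simp add: card_image)
      qed
    qed
  qed
  then have "poly P t = 0" by simp
  then show ?thesis
    by (simp add: P_def R_def S_def poly_prod poly_sum c_def algebra_simps)
qed

section \<open>Coordinates of an interlacing configuration\<close>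

definition last_coord :: "nat \<Rightarrow> nat \<Rightarrow> real \<Rightarrow> (nat \<Rightarrow> real) \<Rightarrow> (nat \<Rightarrow> real) \<Rightarrow> real" where
  "last_coord n m z y x = z * (\<Prod>i=m..n. y i) / (\<Prod>i=m..<n. x i)"

definition completed :: "nat \<Rightarrow> nat \<Rightarrow> real \<Rightarrow> (nat \<Rightarrow> real) \<Rightarrow> (nat \<Rightarrow> real) \<Rightarrow> nat \<Rightarrow> real" where
  "completed n m z y x = x(n := last_coord n m z y x)"

text \<open>The argument \<open>X\<close> is a full point rather than the free coordinates, since
  the Lagrange identities see the elimination only through the product of the
  \<open>X k\<close>.\<close>

definition eta :: "nat \<Rightarrow> nat \<Rightarrow> real \<Rightarrow> (nat \<Rightarrow> real) \<Rightarrow> (nat \<Rightarrow> real) \<Rightarrow> nat \<Rightarrow> real" where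
  "eta n m z y X i = (\<Prod>k=m..n. X k - y i) / (\<Prod>k\<in>{m..n} - {i}. y k - y i) / (y i * (z - 1))"

text \<open>The last conjunct says \<open>y\<^sub>n < x\<^sub>n\<close> if \<open>z > 1\<close>, and is automatic if \<open>z = 0\<close>. The lower index \<open>m\<close> is
  the parameter of the induction that peels off \<open>x\<^sub>m\<close> and \<open>y\<^sub>m\<close>.\<close>

definition interlacing :: "nat \<Rightarrow> nat \<Rightarrow> real \<Rightarrow> (nat \<Rightarrow> real) \<Rightarrow> (nat \<Rightarrow> real) \<Rightarrow> bool" where
  "interlacing n m z y x \<longleftrightarrow> (\<forall>i\<in>{m..<n}. y i < x i \<and> x i < y (Suc i)) \<and>
     0 < (last_coord n m z y x - y n) / (z - 1)"

text \<open>The factors \<open>z - 1\<close> also fix the sign: for \<open>z = 0\<close> and \<open>m = 1\<close> the factors \<open>x\<^sub>n - x\<^sub>i = - x\<^sub>i\<close> cancel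
  against the denominator, which leaves the density in the second integral operator.\<close>

definition weight :: "nat \<Rightarrow> nat \<Rightarrow> real \<Rightarrow> (nat \<Rightarrow> real) \<Rightarrow> (nat \<Rightarrow> real) \<Rightarrow> real" where
  "weight n m z y X = (\<Prod>(i,j)\<in>{(i,j). m \<le> i \<and> i < j \<and> j \<le> n}. (X j - X i) / (y j - y i)) /
     (\<Prod>k=m..<n. X k * (z - 1))"

text \<open>\<open>A\<close> lists the free coordinates; the strict bound on the sum is the
  positivity of the omitted one, \<open>1 - sum \<eta> A\<close>.\<close>

definition open_simplex :: "nat set \<Rightarrow> (nat \<Rightarrow> real) \<Rightarrow> bool" where
  "open_simplex A \<eta> \<longleftrightarrow> (\<forall>i\<in>A. 0 < \<eta> i) \<and> sum \<eta> A < 1"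

lemma prod_completed:
  assumes "m \<le> n" "\<forall>i\<in>{m..<n}. x i \<noteq> 0"
  shows "(\<Prod>k=m..n. completed n m z y x k) = z * (\<Prod>k=m..n. y k)"
proof -
  have "(\<Prod>k=m..n. completed n m z y x k) = (\<Prod>k=m..<n. x k) * last_coord n m z y x"
    using assms(1) by (subst prod.last_plus) (auto simp: completed_def)
  then show ?thesis using assms(2) by (simp add: last_coord_def)
qed

text \<open>At \<open>t = 0\<close>, Lagrange interpolation and the prescribed product of the
  \<open>X k\<close> force the weights to sum to \<open>1\<close>. Hence the product of the
  \<open>t - y k\<close> can be distributed over the weights, and
  \<open>(t - y i) - (z - 1) * y i = t - z * y i\<close>.\<close>

lemma
  fixes y :: "nat \<Rightarrow> real"
  assumes inj: "inj_on y {m..n}" and y0: "\<forall>i\<in>{m..n}. y i \<noteq> 0" and "z \<noteq> 1"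
    and X: "(\<Prod>k=m..n. X k) = z * (\<Prod>k=m..n. y k)"
  shows sum_eta: "sum (eta n m z y X) {m..n} = 1"
    and prod_eta: "(\<Prod>k=m..n. t - X k) =
      (\<Sum>i=m..n. eta n m z y X i * (t - z * y i) * (\<Prod>k\<in>{m..n} - {i}. t - y k))"
proof -
  let ?A = "{m..n}"
  have *: "(\<Prod>k\<in>?A. t - X k) = (\<Prod>k\<in>?A. t - y k) -
    (\<Sum>i\<in>?A. eta n m z y X i * (z - 1) * y i * (\<Prod>k\<in>?A - {i}. t - y k))" for t
  proof -
    have "(\<Prod>k\<in>?A. X k - y i) / (\<Prod>k\<in>?A - {i}. y k - y i) = eta n m z y X i * (z - 1) * y i"
      if "i \<in> ?A" for i
      using that y0 \<open>z \<noteq> 1\<close> by (auto simp: eta_def)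
    then show ?thesis by (subst lagrange_monic[OF _ inj]) (auto intro!: sum.cong)
  qed
  have rem: "(\<Prod>k\<in>?A. f k) = f i * (\<Prod>k\<in>?A - {i}. f k)" if "i \<in> ?A" for i and f :: "nat \<Rightarrow> real"
    using that by (simp add: prod.remove)
  let ?Y = "\<Prod>k\<in>?A. - y k"
  have "(\<Prod>k\<in>?A. - X k) = z * ?Y"
    using X by (simp add: prod_uminus)
  moreover have "(\<Sum>i\<in>?A. eta n m z y X i * (z - 1) * y i * (\<Prod>k\<in>?A - {i}. - y k)) =
      - ((z - 1) * ?Y) * sum (eta n m z y X) ?A"
    unfolding sum_distrib_left
  proof (rule sum.cong[OF refl])
    fix i assume "i \<in> ?A"
    from rem[OF this, of "\<lambda>k. - y k"]
    show "eta n m z y X i * (z - 1) * y i * (\<Prod>k\<in>?A - {i}. - y k) =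
        - ((z - 1) * ?Y) * eta n m z y X i" by simp
  qed
  ultimately have "z * ?Y = ?Y + (z - 1) * ?Y * sum (eta n m z y X) ?A"
    using *[of 0] by simp
  then have "(z - 1) * ?Y * (sum (eta n m z y X) ?A - 1) = 0" by (simp add: algebra_simps)
  moreover have "?Y \<noteq> 0" using y0 by auto
  ultimately show 1: "sum (eta n m z y X) ?A = 1" using \<open>z \<noteq> 1\<close> by simp
  have "(\<Prod>k\<in>?A. t - y k) = (\<Sum>i\<in>?A. eta n m z y X i * (t - y i) * (\<Prod>k\<in>?A - {i}. t - y k))"
  proof -
    have "(\<Prod>k\<in>?A. t - y k) = sum (eta n m z y X) ?A * (\<Prod>k\<in>?A. t - y k)" using 1 by simp
    also have "\<dots> = (\<Sum>i\<in>?A. eta n m z y X i * ((t - y i) * (\<Prod>k\<in>?A - {i}. t - y k)))"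
      unfolding sum_distrib_right by (intro sum.cong refl, subst rem) auto
    finally show ?thesis by (simp add: mult.assoc)
  qed
  then show "(\<Prod>k\<in>?A. t - X k) =
      (\<Sum>i\<in>?A. eta n m z y X i * (t - z * y i) * (\<Prod>k\<in>?A - {i}. t - y k))"
    unfolding * by (simp add: sum_subtractf[symmetric] algebra_simps)
qed

lemma last_coord_step:
  assumes "m < n"
  shows "last_coord n m z y (x(m := u)) = last_coord n (Suc m) (z * y m / u) y x"
proof -
  have "(\<Prod>i=m..<n. (x(m := u)) i) = u * (\<Prod>i=Suc m..<n. x i)"
    using assms by (subst prod.atLeast_Suc_lessThan) auto
  moreover have "(\<Prod>i=m..n. y i) = y m * (\<Prod>i=Suc m..n. y i)"
    using assms by (subst prod.atLeast_Suc_atMost) auto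
  ultimately show ?thesis by (simp add: last_coord_def)
qed

lemma completed_step:
  assumes "m < n"
  shows "completed n m z y (x(m := u)) = (completed n (Suc m) (z * y m / u) y x)(m := u)"
  using assms by (auto simp: completed_def last_coord_step fun_eq_iff)

text \<open>The two sides differ in the factors of index \<open>m\<close> above and below, and in
  the normalisation by \<open>z - 1\<close> or \<open>z' - 1\<close>.\<close>

lemma eta_step:
  assumes "m < n" "i \<in> {Suc m..n}" "z' \<noteq> 1"
  shows "eta n m z y (X(m := u)) i =
    eta n (Suc m) z' y X i * ((z' - 1) / (z - 1)) * ((y i - u) / (y i - y m))"
proof -
  have 1: "(\<Prod>k=m..n. (X(m := u)) k - y i) = (u - y i) * (\<Prod>k=Suc m..n. X k - y i)"
    using assms by (subst prod.atLeast_Suc_atMost) auto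
  have 2: "(\<Prod>k\<in>{m..n} - {i}. y k - y i) = (y m - y i) * (\<Prod>k\<in>{Suc m..n} - {i}. y k - y i)"
  proof -
    have "{m..n} - {i} = insert m ({Suc m..n} - {i})" using assms by auto
    then show ?thesis by simp
  qed
  have 3: "(u - y i) * P / ((y m - y i) * R) = (y i - u) / (y i - y m) * (P / R)" for P R
  proof -
    have "u - y i = - (y i - u)" "y m - y i = - (y i - y m)" by auto
    then show ?thesis by (simp only: minus_mult_left[symmetric] minus_divide_divide times_divide_times_eq)
  qed
  show ?thesis
    unfolding eta_def 1 2 3 using assms(3) by (simp add: ac_simps)
qed

text \<open>The pairs \<open>(m, j)\<close> produce the product over \<open>j\<close>, the
  denominator of index \<open>m\<close> produces \<open>u * (z - 1)\<close>, and each of the other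
  \<open>n - Suc m\<close> denominators exchanges \<open>z - 1\<close> for
  \<open>z' - 1\<close>.\<close>

lemma weight_step:
  assumes "m < n" "z' \<noteq> 1"
  shows "weight n m z y (X(m := u)) = weight n (Suc m) z' y X *
    ((\<Prod>j=Suc m..n. (X j - u) / (y j - y m)) / (u * (z - 1)) * ((z' - 1) / (z - 1)) ^ (n - Suc m))"
proof -
  let ?P = "\<lambda>m. {(i,j). m \<le> i \<and> i < j \<and> j \<le> n}"
  have fin: "finite (?P m)" for m
    by (rule finite_subset[of _ "{..n} \<times> {..n}"]) auto
  have P: "?P m = Pair m ` {Suc m..n} \<union> ?P (Suc m)"
    using assms(1) by (auto simp: image_iff)
  have "(\<Prod>(i,j)\<in>?P m. ((X(m := u)) j - (X(m := u)) i) / (y j - y i)) =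
     (\<Prod>(i,j)\<in>Pair m ` {Suc m..n}. ((X(m := u)) j - (X(m := u)) i) / (y j - y i)) *
     (\<Prod>(i,j)\<in>?P (Suc m). ((X(m := u)) j - (X(m := u)) i) / (y j - y i))"
    unfolding P by (rule prod.union_disjoint) (use fin in auto)
  also have "(\<Prod>(i,j)\<in>Pair m ` {Suc m..n}. ((X(m := u)) j - (X(m := u)) i) / (y j - y i)) =
     (\<Prod>j=Suc m..n. (X j - u) / (y j - y m))"
    by (subst prod.reindex) (auto simp: inj_on_def intro!: prod.cong)
  also have "(\<Prod>(i,j)\<in>?P (Suc m). ((X(m := u)) j - (X(m := u)) i) / (y j - y i)) =
     (\<Prod>(i,j)\<in>?P (Suc m). (X j - X i) / (y j - y i))"
    by (rule prod.cong) auto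
  finally have 1: "(\<Prod>(i,j)\<in>?P m. ((X(m := u)) j - (X(m := u)) i) / (y j - y i)) =
    (\<Prod>j=Suc m..n. (X j - u) / (y j - y m)) * (\<Prod>(i,j)\<in>?P (Suc m). (X j - X i) / (y j - y i))" .
  have 2: "(\<Prod>k=m..<n. (X(m := u)) k * (z - 1)) = u * (z - 1) * (\<Prod>k=Suc m..<n. X k * (z - 1))"
    using assms by (subst prod.atLeast_Suc_lessThan) auto
  have alg: "a * b / (u * c * (p * c ^ k)) = b / (p * d ^ k) * (a / (u * c) * (d / c) ^ k)"
    if "d \<noteq> 0" for a b c d p :: real and k
    using that by (simp add: power_divide ac_simps)
  show ?thesis
    unfolding weight_def 1 2 unfolding prod.distrib prod_constant card_atLeastLessThan
    by (rule alg) (use assms(2) in simp)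
qed

section \<open>Measurability\<close>

lemma measurable_coordinate:
  "i \<in> I \<Longrightarrow> (\<lambda>x. x i) \<in> borel_measurable (leb_on I)"
  using measurable_component_singleton[of i I "\<lambda>_. lborel"] by simp

lemma measurable_last_coord:
  "last_coord n m z y \<in> borel_measurable (leb_on {m..<n})"
proof -
  have "(\<lambda>x. \<Prod>i=m..<n. x i) \<in> borel_measurable (leb_on {m..<n})"
    by (intro borel_measurable_prod measurable_coordinate)
  then show ?thesis unfolding last_coord_def [abs_def]
    by (intro borel_measurable_divide borel_measurable_const)
qed

lemma measurable_completed:
  assumes "k \<in> {m..n}"
  shows "(\<lambda>x. completed n m z y x k) \<in> borel_measurable (leb_on {m..<n})"
proof (cases "k = n")
  case True
  then have "(\<lambda>x. completed n m z y x k) = last_coord n m z y"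
    by (simp add: completed_def fun_eq_iff)
  then show ?thesis by (simp only: measurable_last_coord)
next
  case False
  then have "(\<lambda>x. completed n m z y x k) = (\<lambda>x. x k)"
    by (simp add: completed_def fun_eq_iff)
  moreover have "k \<in> {m..<n}" using False assms by auto
  ultimately show ?thesis by (simp only: measurable_coordinate)
qed

lemma measurable_eta:
  "(\<lambda>x. eta n m z y (completed n m z y x) i) \<in> borel_measurable (leb_on {m..<n})"
proof -
  have "(\<lambda>x. \<Prod>k=m..n. completed n m z y x k - y i) \<in> borel_measurable (leb_on {m..<n})"
    by (intro borel_measurable_prod borel_measurable_diff measurable_completed) auto
  then show ?thesis unfolding eta_def by (intro borel_measurable_divide borel_measurable_const)
qed

lemma measurable_eta_restrict:
  "(\<lambda>x. restrict (eta n m z y (completed n m z y x)) J)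
    \<in> measurable (leb_on {m..<n}) (leb_on J)"
  by (intro measurable_restrict) (simp add: measurable_eta)

lemma measurable_weight:
  "(\<lambda>x. weight n m z y (completed n m z y x)) \<in> borel_measurable (leb_on {m..<n})"
proof -
  let ?M = "leb_on {m..<n}"
  have "(\<lambda>x. \<Prod>p\<in>{(i,j). m \<le> i \<and> i < j \<and> j \<le> n}. (completed n m z y x (snd p) -
      completed n m z y x (fst p)) / (y (snd p) - y (fst p))) \<in> borel_measurable ?M"
    by (intro borel_measurable_prod borel_measurable_divide borel_measurable_diff
        measurable_completed borel_measurable_const) auto
  moreover have "(\<lambda>x. \<Prod>k=m..<n. completed n m z y x k * (z - 1)) \<in> borel_measurable ?M"
    by (intro borel_measurable_prod borel_measurable_times measurable_completed borel_measurable_const) auto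
  ultimately show ?thesis unfolding weight_def case_prod_beta by (intro borel_measurable_divide)
qed

lemma measurable_interlacing:
  "Measurable.pred (leb_on {m..<n}) (interlacing n m z y)"
  unfolding interlacing_def [abs_def]
  by (intro pred_intros_logic pred_intros_finite borel_measurable_pred_less measurable_coordinate
      borel_measurable_divide borel_measurable_diff borel_measurable_const measurable_last_coord) auto

lemma measurable_positive:
  "finite J \<Longrightarrow> J \<subseteq> I \<Longrightarrow> Measurable.pred (leb_on I) (\<lambda>\<eta>. \<forall>i\<in>J. 0 < (\<eta> i :: real))"
  by (intro pred_intros_finite borel_measurable_pred_less measurable_coordinate
      borel_measurable_const) auto

lemma measurable_open_simplex:
  "finite I \<Longrightarrow> Measurable.pred (leb_on I) (open_simplex I)"
  unfolding open_simplex_def [abs_def]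
  by (intro pred_intros_logic measurable_positive borel_measurable_pred_less
      borel_measurable_const borel_measurable_sum measurable_coordinate) auto

text \<open>In the application \<open>c i = y i - y m\<close> and \<open>d i = y i - u\<close>,
  while \<open>cm\<close> and \<open>dm\<close> are these differences for the index
  \<open>Suc m\<close> and \<open>J\<close> collects the indices above it. The left side multiplies
  the Jacobian of the scaling by \<open>l\<close> with the factor from \<open>weight_step\<close>;
  the right side is \<open>B - dm * B'\<close> for the slice factor \<open>B\<close>. The products
  over \<open>J\<close> and the power of \<open>\<kappa>\<close> cancel, and a partial fraction
  expansion does the rest.\<close>

lemma Jacobian_identity:
  fixes c d \<eta> :: "nat \<Rightarrow> real"
  assumes "finite J" and c: "\<And>i. i \<in> J \<Longrightarrow> 0 < c i" and d: "\<And>i. i \<in> J \<Longrightarrow> 0 < d i"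
    and "0 < dm" "0 < cm" "\<kappa> \<noteq> 0" "z \<noteq> 1" "u \<noteq> 0" and \<kappa>: "\<kappa> = (z' - 1) / (z - 1)"
  defines "l \<equiv> \<lambda>i. c i / (\<kappa> * d i)"
  shows "(\<Prod>i\<in>J. l i) * (((dm / cm) * (\<Prod>i\<in>J. d i / c i)) *
      ((1 - (\<Sum>i\<in>J. l i * \<eta> i)) * (z' * (dm + u) - u) / dm +
        (\<Sum>i\<in>J. l i * \<eta> i * (z' * (d i + u) - u) / d i)) / (u * (z - 1)) * \<kappa> ^ card J) =
    (\<kappa> - (\<Sum>i\<in>J. \<eta> i * c i / d i)) / cm +
      dm * ((z' / (u * (z - 1)) + (\<Sum>i\<in>J. \<eta> i * c i / (d i)\<^sup>2)) / cm)"
proof -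
  have *: "(\<Prod>i\<in>J. l i) * (\<Prod>i\<in>J. d i / c i) * \<kappa> ^ card J = 1"
  proof -
    have "(\<Prod>i\<in>J. l i) * (\<Prod>i\<in>J. d i / c i) * \<kappa> ^ card J = (\<Prod>i\<in>J. l i * (d i / c i) * \<kappa>)"
      by (simp only: prod.distrib prod_constant)
    also have "\<dots> = (\<Prod>i\<in>J. 1)"
    proof (rule prod.cong[OF refl])
      fix i assume "i \<in> J"
      with c[of i] d[of i] \<open>\<kappa> \<noteq> 0\<close> show "l i * (d i / c i) * \<kappa> = 1" by (simp add: l_def)
    qed
    finally show ?thesis by simp
  qed
  \<comment> \<open>Partial fractions in \<open>e\<close>: the numerator is
    \<open>z' * e + (z' - 1) * u\<close>, and \<open>z' - 1 = \<kappa> * (z - 1)\<close>.\<close>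
  have frac: "(z' * (e + u) - u) / e = (z' / (u * (z - 1)) + \<kappa> / e) * (u * (z - 1))" if "e > 0" for e
  proof -
    define w where "w = z - 1"
    have "w \<noteq> 0" using \<open>z \<noteq> 1\<close> by (simp add: w_def)
    have "(z' / (u * w) + \<kappa> / e) * (u * w) = z' + \<kappa> * w * u / e"
      using \<open>u \<noteq> 0\<close> \<open>w \<noteq> 0\<close> by (simp add: distrib_right)
    also have "\<kappa> * w = z' - 1" using \<kappa> \<open>w \<noteq> 0\<close> by (simp add: w_def)
    finally show ?thesis using that by (simp add: w_def field_simps)
  qed
  define s where "s = (\<Sum>i\<in>J. l i * \<eta> i)"
  have "(1 - s) * (z' * (dm + u) - u) / dm + (\<Sum>i\<in>J. l i * \<eta> i * (z' * (d i + u) - u) / d i) =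
    (1 - s) * ((z' * (dm + u) - u) / dm) + (\<Sum>i\<in>J. l i * \<eta> i * ((z' * (d i + u) - u) / d i))"
    by simp
  also have "\<dots> = (1 - s) * ((z' / (u * (z - 1)) + \<kappa> / dm) * (u * (z - 1))) +
      (\<Sum>i\<in>J. l i * \<eta> i * ((z' / (u * (z - 1)) + \<kappa> / d i) * (u * (z - 1))))"
    using frac[OF \<open>0 < dm\<close>] frac[OF d] by simp
  also have "(\<Sum>i\<in>J. l i * \<eta> i * ((z' / (u * (z - 1)) + \<kappa> / d i) * (u * (z - 1)))) =
      (s * (z' / (u * (z - 1))) + (\<Sum>i\<in>J. l i * \<eta> i * (\<kappa> / d i))) * (u * (z - 1))"
    unfolding s_def sum_distrib_right sum.distrib[symmetric]
    by (intro sum.cong refl) (simp only: distrib_left distrib_right mult.assoc)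
  also have "(\<Sum>i\<in>J. l i * \<eta> i * (\<kappa> / d i)) = (\<Sum>i\<in>J. \<eta> i * c i / (d i)\<^sup>2)"
    using \<open>\<kappa> \<noteq> 0\<close> by (intro sum.cong) (auto simp: l_def power2_eq_square)
  finally have E: "(1 - s) * (z' * (dm + u) - u) / dm + (\<Sum>i\<in>J. l i * \<eta> i * (z' * (d i + u) - u) / d i) =
      (1 - s) * ((z' / (u * (z - 1)) + \<kappa> / dm) * (u * (z - 1))) +
      (s * (z' / (u * (z - 1))) + (\<Sum>i\<in>J. \<eta> i * c i / (d i)\<^sup>2)) * (u * (z - 1))" .
  have cancel: "((1 - s) * ((q + \<kappa> / dm) * U) + (s * q + T) * U) / U = q + (\<kappa> - \<kappa> * s) / dm + T"
    if "U \<noteq> 0" for q T U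
  proof -
    have "((1 - s) * ((q + \<kappa> / dm) * U) + (s * q + T) * U) / U = (1 - s) * (q + \<kappa> / dm) + (s * q + T)"
      using that by (simp add: add_divide_distrib)
    then show ?thesis by (simp add: algebra_simps diff_divide_distrib)
  qed
  have "u * (z - 1) \<noteq> 0" using \<open>u \<noteq> 0\<close> \<open>z \<noteq> 1\<close> by simp
  then have 1: "((1 - s) * (z' * (dm + u) - u) / dm + (\<Sum>i\<in>J. l i * \<eta> i * (z' * (d i + u) - u) / d i))
       / (u * (z - 1)) = z' / (u * (z - 1)) + (\<kappa> - \<kappa> * s) / dm + (\<Sum>i\<in>J. \<eta> i * c i / (d i)\<^sup>2)"
    unfolding E by (rule cancel)
  have 2: "\<kappa> * s = (\<Sum>i\<in>J. \<eta> i * c i / d i)"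
    unfolding s_def sum_distrib_left using \<open>\<kappa> \<noteq> 0\<close> by (intro sum.cong) (auto simp: l_def)
  have 3: "P * (((dm / cm) * D) * E / U * K) = (P * D * K) * ((dm / cm) * (E / U))" for P D E U K
    by simp
  show ?thesis
    unfolding 3 * unfolding s_def[symmetric] 1 2 using \<open>0 < dm\<close> \<open>0 < cm\<close>
    by (simp add: field_simps)
qed

subsection \<open>The interlacing integral\<close>

text \<open>The positive quotient says that \<open>z - 1\<close> and \<open>z' - 1\<close> have the
  same sign, so the condition on the eliminated coordinate may be stated with either of
  them.\<close>

lemma interlacing_step:
  assumes "m < n" "y m < u" "0 < (z' - 1) / (z - 1)" "u < y (Suc m)" and z': "z' = z * y m / u"
  shows "interlacing n m z y (x(m := u)) \<longleftrightarrow> interlacing n (Suc m) z' y x"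
proof -
  have "0 < (L - y n) / (z - 1) \<longleftrightarrow> 0 < (L - y n) / (z' - 1)" for L
    using assms(3) by (auto simp: zero_less_divide_iff)
  moreover have "(\<forall>i\<in>{m..<n}. y i < (x(m := u)) i \<and> (x(m := u)) i < y (Suc i)) \<longleftrightarrow>
     (\<forall>i\<in>{Suc m..<n}. y i < x i \<and> x i < y (Suc i))"
    using assms by (auto simp: Suc_le_eq)
  ultimately show ?thesis
    using assms(1) by (simp add: interlacing_def last_coord_step z')
qed

text \<open>The eliminated coordinate is \<open>z * y m / u\<close> times ratios
  \<open>y i / x i\<close>, which are below \<open>1\<close>, times \<open>y n\<close>; hence it
  cannot exceed \<open>y n\<close>.\<close>

lemma not_interlacing_step:
  assumes "m < n" "1 < z" "z * y m / u \<le> 1" "0 < u" "\<forall>i\<in>{m..n}. 0 < y i"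
  shows "\<not> interlacing n m z y (x(m := u))"
proof
  assume int: "interlacing n m z y (x(m := u))"
  let ?z = "z * y m / u"
  have x: "y i < x i" if "i \<in> {Suc m..<n}" for i
    using int that unfolding interlacing_def by (auto dest!: bspec[of _ _ i])
  have "(\<Prod>i=Suc m..<n. y i) \<le> (\<Prod>i=Suc m..<n. x i)"
    using x assms(5) by (intro prod_mono) (auto intro: less_imp_le)
  moreover have "0 < (\<Prod>i=Suc m..<n. x i)"
  proof (rule prod_pos)
    fix i assume "i \<in> {Suc m..<n}"
    with x[OF this] assms(5) show "0 < x i" by (auto dest!: bspec[of _ _ i])
  qed
  ultimately have le: "(\<Prod>i=Suc m..<n. y i) / (\<Prod>i=Suc m..<n. x i) \<le> 1" by simp
  have "last_coord n (Suc m) ?z y x = ?z * ((\<Prod>i=Suc m..<n. y i) / (\<Prod>i=Suc m..<n. x i)) * y n"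
    using assms(1) by (simp add: last_coord_def prod.last_plus Suc_le_eq)
  also have "\<dots> \<le> 1 * 1 * y n"
    using assms le \<open>0 < (\<Prod>i=Suc m..<n. x i)\<close>
    by (intro mult_right_mono mult_mono) (auto intro!: prod_nonneg divide_nonneg_pos simp: less_imp_le)
  finally have "last_coord n m z y (x(m := u)) \<le> y n"
    using assms(1) by (simp add: last_coord_step)
  then show False using int assms(2)
    by (auto simp: interlacing_def zero_less_divide_iff)
qed

text \<open>By \<open>eta_step\<close> the weights on a slice satisfy
  \<open>\<eta> i * (y i - y m) / (y i - u) = e i * \<kappa>\<close> with
  \<open>\<kappa> = (z * y m / u - 1) / (z - 1)\<close>, where the inner weights \<open>e i\<close>
  sum to \<open>1\<close>. Solving the resulting linear equation for the weight of index
  \<open>Suc m\<close> gives \<open>y (Suc m) - u\<close> times this expression.\<close>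

definition slice_factor :: "nat \<Rightarrow> nat \<Rightarrow> real \<Rightarrow> (nat \<Rightarrow> real) \<Rightarrow> (nat \<Rightarrow> real) \<Rightarrow> real \<Rightarrow> real" where
  "slice_factor n m z y \<eta> u = ((z * y m / u - 1) / (z - 1) -
     (\<Sum>i=Suc (Suc m)..n. \<eta> i * (y i - y m) / (y i - u))) / (y (Suc m) - y m)"

definition slice_factor_deriv :: "nat \<Rightarrow> nat \<Rightarrow> real \<Rightarrow> (nat \<Rightarrow> real) \<Rightarrow> (nat \<Rightarrow> real) \<Rightarrow> real \<Rightarrow> real" where
  "slice_factor_deriv n m z y \<eta> u = - ((z * y m / u / (u * (z - 1)) +
     (\<Sum>i=Suc (Suc m)..n. \<eta> i * (y i - y m) / (y i - u)\<^sup>2)) / (y (Suc m) - y m))"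

text \<open>Freezing \<open>x\<^sub>m = u\<close> leaves the same integral for \<open>m + 1\<close> with \<open>z\<close> replaced by \<open>z y\<^sub>m / u\<close>, up to the
  rescaling of \<open>\<eta>\<close> in \<open>eta_step\<close>. On the slice, \<open>\<eta>\<^sub>m\<^sub>+\<^sub>1\<close> is \<open>(y\<^sub>m\<^sub>+\<^sub>1 - u) * slice_factor\<close>, and the
  remaining density is minus its derivative in \<open>u\<close>.\<close>

lemma nn_integral_slice:
  fixes f :: "(nat \<Rightarrow> real) \<Rightarrow> ennreal"
  assumes "m < n" and z: "z = 0 \<or> 1 < z" and mono: "strict_mono_on {m..n} y"
    and pos: "\<forall>i\<in>{m..n}. 0 < y i" and u: "y m < u" "u < y (Suc m)"
    and f: "f \<in> borel_measurable (leb_on {Suc m..n})"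
    and IH: "\<And>z' f. z' = 0 \<or> 1 < z' \<Longrightarrow> f \<in> borel_measurable (leb_on {Suc (Suc m)..n}) \<Longrightarrow>
      (\<integral>\<^sup>+x. (if interlacing n (Suc m) z' y x
        then ennreal (weight n (Suc m) z' y (completed n (Suc m) z' y x)) *
          f (restrict (eta n (Suc m) z' y (completed n (Suc m) z' y x)) {Suc (Suc m)..n}) else 0)
        \<partial>leb_on {Suc m..<n}) =
      (\<integral>\<^sup>+\<eta>. (if open_simplex {Suc (Suc m)..n} \<eta> then f \<eta> else 0) \<partial>leb_on {Suc (Suc m)..n})"
  shows "(\<integral>\<^sup>+x. (if interlacing n m z y (x(m := u))
        then ennreal (weight n m z y (completed n m z y (x(m := u)))) *
          f (restrict (eta n m z y (completed n m z y (x(m := u)))) {Suc m..n}) else 0)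
        \<partial>leb_on {Suc m..<n}) =
    (\<integral>\<^sup>+\<eta>. (if (\<forall>i\<in>{Suc (Suc m)..n}. 0 < \<eta> i) \<and> 0 < slice_factor n m z y \<eta> u
        then ennreal (slice_factor n m z y \<eta> u - (y (Suc m) - u) * slice_factor_deriv n m z y \<eta> u) *
          f (\<eta>(Suc m := (y (Suc m) - u) * slice_factor n m z y \<eta> u)) else 0)
      \<partial>leb_on {Suc (Suc m)..n})"
    (is "(\<integral>\<^sup>+x. ?F x \<partial>_) = (\<integral>\<^sup>+\<eta>. ?H \<eta> \<partial>_)")
proof -
  define J where "J = {Suc (Suc m)..n}"
  let ?M = leb_on
  define z' where "z' = z * y m / u"
  define \<kappa> where "\<kappa> = (z' - 1) / (z - 1)"
  have SucJ: "{Suc m..n} = insert (Suc m) J" "Suc m \<notin> J" "finite J" "card J = n - Suc m"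
    using \<open>m < n\<close> by (auto simp: J_def)
  have "0 < y m" using pos \<open>m < n\<close> by auto
  then have "0 < u" using u by simp
  have less: "y i < y j" if "m \<le> i" "i < j" "j \<le> n" for i j
    using strict_mono_onD[OF mono] that by auto
  have c: "0 < y i - y m" and d: "0 < y i - u" if "i \<in> J" for i
    using less[of m i] less[of "Suc m" i] that u by (auto simp: J_def)
  have ab: "0 < y (Suc m) - y m" "0 < y (Suc m) - u" using u by auto
  show ?thesis
  proof (cases "0 < \<kappa>")
    \<comment> \<open>Here necessarily \<open>z > 1\<close> and \<open>z' \<le> 1\<close>: the slice
      on the left is empty, and on the right the slice factor is nonpositive.\<close>
    case False
    then have zz: "1 < z" "z' \<le> 1" using z
      by (auto simp: \<kappa>_def z'_def zero_less_divide_iff not_less)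
    have "?F x = 0" for x
      using not_interlacing_step[OF \<open>m < n\<close> \<open>1 < z\<close> _ \<open>0 < u\<close> pos] zz by (simp add: z'_def)
    moreover have "?H \<eta> = 0" for \<eta>
    proof -
      have "slice_factor n m z y \<eta> u \<le> 0" if "\<forall>i\<in>J. 0 < \<eta> i"
      proof -
        have "0 \<le> (\<Sum>i\<in>J. \<eta> i * (y i - y m) / (y i - u))"
          using that c d by (intro sum_nonneg divide_nonneg_nonneg mult_nonneg_nonneg) (auto intro: less_imp_le)
        then have "\<kappa> - (\<Sum>i\<in>J. \<eta> i * (y i - y m) / (y i - u)) \<le> 0" using False by simp
        then show ?thesis
          using ab unfolding slice_factor_def J_def \<kappa>_def z'_def by (intro divide_nonpos_pos) auto
      qed
      then show ?thesis by (force simp: J_def)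
    qed
    ultimately show ?thesis by simp
  next
    case True
    have z': "z' = 0 \<or> 1 < z'" "z' \<noteq> 1" "z \<noteq> 1" using z True
      by (auto simp: \<kappa>_def z'_def zero_less_divide_iff)
    \<comment> \<open>\<open>?W\<close> is the factor of \<open>weight_step\<close> in terms of the
      inner weights \<open>e\<close>, \<open>?hh\<close> restores the dependent weight
      \<open>Suc m\<close> from the free ones in \<open>J\<close>, and \<open>?r\<close> passes to
      the outer weights by \<open>eta_step\<close>. Together they form the test function
      \<open>f'\<close> for the induction hypothesis.\<close>
    let ?W = "\<lambda>e. ((\<Prod>i=Suc m..n. (y i - u) / (y i - y m)) *
       (\<Sum>i=Suc m..n. e i * (z' * y i - u) / (y i - u))) / (u * (z - 1)) * \<kappa> ^ (n - Suc m)"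
    let ?hh = "\<lambda>h. h(Suc m := 1 - sum h J)"
    let ?r = "\<lambda>e. \<lambda>i\<in>{Suc m..n}. e i * \<kappa> * ((y i - u) / (y i - y m))"
    define f' where "f' h = ennreal (?W (?hh h)) * f (?r (?hh h))" for h
    have hh: "(\<lambda>h. ?hh h i) \<in> borel_measurable (?M J)" if "i \<in> {Suc m..n}" for i
      using that SucJ by (cases "i = Suc m")
        (auto intro!: borel_measurable_diff borel_measurable_sum measurable_coordinate)
    have f': "f' \<in> borel_measurable (?M J)"
    proof -
      have "(\<lambda>h. ?r (?hh h)) \<in> measurable (?M J) (?M {Suc m..n})"
        using hh by (intro measurable_restrict) (simp del: fun_upd_apply)
      from measurable_compose[OF this f] have "(\<lambda>h. f (?r (?hh h))) \<in> borel_measurable (?M J)" .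
      moreover have "(\<lambda>h. ?W (?hh h)) \<in> borel_measurable (?M J)"
        by (intro borel_measurable_times borel_measurable_divide borel_measurable_sum
            borel_measurable_const hh)
      ultimately show ?thesis unfolding f'_def by measurable
    qed
    define l where "l i = (y i - y m) / (\<kappa> * (y i - u))" for i
    have l: "0 < l i" if "i \<in> J" for i using c[OF that] d[OF that] True by (simp add: l_def)
    have "(\<integral>\<^sup>+x. ?F x \<partial>?M {Suc m..<n}) =
      (\<integral>\<^sup>+x. (if interlacing n (Suc m) z' y x
        then ennreal (weight n (Suc m) z' y (completed n (Suc m) z' y x)) *
          f' (restrict (eta n (Suc m) z' y (completed n (Suc m) z' y x)) J) else 0) \<partial>?M {Suc m..<n})"
    proof (rule nn_integral_cong, goal_cases)
      case (1 x)
      define X where "X = completed n (Suc m) z' y x"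
      define e where "e = eta n (Suc m) z' y X"
      have iff: "interlacing n m z y (x(m := u)) \<longleftrightarrow> interlacing n (Suc m) z' y x"
        using interlacing_step[OF \<open>m < n\<close> u(1) _ u(2) z'_def] True by (simp add: \<kappa>_def)
      show ?case
      proof (cases "interlacing n (Suc m) z' y x")
        case int: True
        have x0: "\<forall>i\<in>{Suc m..<n}. x i \<noteq> 0"
        proof
          fix i assume "i \<in> {Suc m..<n}"
          with int pos show "x i \<noteq> 0" by (auto simp: interlacing_def dest!: bspec[of _ _ i])
        qed
        have compl: "completed n m z y (x(m := u)) = X(m := u)"
          using completed_step[OF \<open>m < n\<close>] by (simp add: X_def z'_def)
        have prodX: "(\<Prod>k=Suc m..n. X k) = z' * (\<Prod>k=Suc m..n. y k)"
          unfolding X_def using \<open>m < n\<close> x0 by (intro prod_completed) auto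
        have inj: "inj_on y {Suc m..n}"
          by (rule inj_onI, rule ccontr) (metis less atLeastAtMost_iff Suc_leD linorder_neqE_nat less_irrefl)
        have y0: "\<forall>i\<in>{Suc m..n}. y i \<noteq> 0"
        proof
          fix i assume "i \<in> {Suc m..n}"
          then have "i \<in> {m..n}" by auto
          with pos show "y i \<noteq> 0" by (metis less_irrefl)
        qed
        have "sum e {Suc m..n} = 1"
          unfolding e_def using inj y0 z'(2) prodX by (rule sum_eta)
        then have "e (Suc m) = 1 - sum e J" using SucJ by simp
        then have hhe: "?hh (restrict e J) i = e i" if "i \<in> {Suc m..n}" for i
          using that SucJ by (auto simp: restrict_def)
        have r: "restrict (eta n m z y (X(m := u))) {Suc m..n} = ?r (?hh (restrict e J))"
        proof (rule restrict_ext)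
          fix i assume i: "i \<in> {Suc m..n}"
          show "eta n m z y (X(m := u)) i = ?hh (restrict e J) i * \<kappa> * ((y i - u) / (y i - y m))"
            unfolding hhe[OF i] unfolding e_def \<kappa>_def by (rule eta_step[OF \<open>m < n\<close> i z'(2)])
        qed
        have du: "y i - u > 0" if "i \<in> {Suc m..n}" for i
          using that SucJ d ab by auto
        \<comment> \<open>This is \<open>prod_eta\<close> at \<open>t = u\<close>, with equally many
          signs reversed on both sides; it expresses the factor of \<open>weight_step\<close>
          through the inner weights alone.\<close>
        have prodXu: "(\<Prod>j=Suc m..n. (X j - u) / (y j - y m)) =
           (\<Prod>i=Suc m..n. (y i - u) / (y i - y m)) * (\<Sum>i=Suc m..n. e i * (z' * y i - u) / (y i - u))"
        proof -
          let ?A = "{Suc m..n}"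
          have rem: "(\<Prod>k\<in>?A. u - y k) = (u - y i) * (\<Prod>k\<in>?A - {i}. u - y k)" if "i \<in> ?A" for i
            using that by (simp add: prod.remove)
          have "(\<Prod>k\<in>?A. u - X k) = (\<Sum>i\<in>?A. e i * (u - z' * y i) * (\<Prod>k\<in>?A - {i}. u - y k))"
            unfolding e_def using inj y0 z'(2) prodX by (rule prod_eta)
          also have "\<dots> = (\<Sum>i\<in>?A. (\<Prod>k\<in>?A. u - y k) * (e i * (z' * y i - u) / (y i - u)))"
          proof (rule sum.cong[OF refl])
            fix i assume i: "i \<in> ?A"
            have "e i * (u - w) * D = (u - y i) * D * (e i * (w - u) / (y i - u))" for w D
            proof -
              have "- g * D * (E / g) = - (D * E)" if "0 < g" for g E
                using that by simp
              from this[OF du[OF i], of "e i * (w - u)"]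
              have "(u - y i) * D * (e i * (w - u) / (y i - u)) = - (D * (e i * (w - u)))"
                by (simp only: minus_diff_eq)
              then show ?thesis by (simp add: algebra_simps)
            qed
            then show "e i * (u - z' * y i) * (\<Prod>k\<in>?A - {i}. u - y k) =
              (\<Prod>k\<in>?A. u - y k) * (e i * (z' * y i - u) / (y i - u))"
              unfolding rem[OF i] .
          qed
          finally have "(\<Prod>k\<in>?A. u - X k) = (\<Prod>k\<in>?A. u - y k) *
              (\<Sum>i\<in>?A. e i * (z' * y i - u) / (y i - u))" by (simp add: sum_distrib_left)
          moreover have "(\<Prod>k\<in>?A. u - X k) = (-1) ^ card ?A * (\<Prod>k\<in>?A. X k - u)" for X :: "nat \<Rightarrow> real"
            using prod_uminus[of "\<lambda>k. X k - u" ?A] by simp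
          ultimately have "(\<Prod>k\<in>?A. X k - u) = (\<Prod>k\<in>?A. y k - u) *
              (\<Sum>i\<in>?A. e i * (z' * y i - u) / (y i - u))" by simp
          then show ?thesis by (simp add: prod_dividef)
        qed
        have wt: "weight n m z y (X(m := u)) = weight n (Suc m) z' y X * ?W (?hh (restrict e J))"
        proof -
          have "(\<Sum>i=Suc m..n. ?hh (restrict e J) i * (z' * y i - u) / (y i - u)) =
            (\<Sum>i=Suc m..n. e i * (z' * y i - u) / (y i - u))"
            by (intro sum.cong refl) (simp only: hhe)
          then show ?thesis
            using weight_step[OF \<open>m < n\<close> z'(2), of z y X u] by (simp only: prodXu \<kappa>_def)
        qed
        \<comment> \<open>The sign is needed to split \<open>ennreal\<close> of the product. The
          delicate factor is the one of index \<open>n\<close>: \<open>X n - u\<close> has the sign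
          of \<open>z - 1\<close>, because \<open>X n = 0 < u\<close> for \<open>z = 0\<close> and
          \<open>u < y n < X n\<close> for \<open>z > 1\<close>.\<close>
        have "0 \<le> ?W (?hh (restrict e J))"
        proof -
          have X: "X j = x j" if "j \<in> {Suc m..<n}" for j using that by (simp add: X_def completed_def)
          have un: "u < y n" using less[of "Suc m" n] \<open>m < n\<close> u by (cases "n = Suc m") auto
          have "0 \<le> (X n - u) / (z - 1)"
          proof (cases "z = 0")
            case True
            then show ?thesis using \<open>0 < u\<close> by (simp add: X_def completed_def last_coord_def z'_def)
          next
            case False
            then have "1 < z" "1 < z'" using z z' \<open>0 < y m\<close> \<open>0 < u\<close> by (auto simp: z'_def)
            then have "y n < X n" using int
              by (auto simp: interlacing_def X_def completed_def zero_less_divide_iff)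
            then show ?thesis using un \<open>1 < z\<close> by simp
          qed
          moreover have "0 \<le> (\<Prod>j=Suc m..<n. (X j - u) / (y j - y m))"
          proof (intro prod_nonneg divide_nonneg_nonneg)
            fix j assume j: "j \<in> {Suc m..<n}"
            then have "y j < x j" using int by (auto simp: interlacing_def dest!: bspec[of _ _ j])
            then show "0 \<le> X j - u" using du[of j] X[OF j] j by auto
            show "0 \<le> y j - y m" using less[of m j] j by auto
          qed
          moreover have "0 < y n - y m" using less[of m n] \<open>m < n\<close> by auto
          ultimately have "0 \<le> (\<Prod>j=Suc m..<n. (X j - u) / (y j - y m)) *
              ((X n - u) / (z - 1) / (u * (y n - y m))) * \<kappa> ^ (n - Suc m)"
            using True \<open>0 < u\<close> divide_nonneg_nonneg[of "(X n - u) / (z - 1)" "u * (y n - y m)"]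
            by (intro mult_nonneg_nonneg zero_le_power) auto
          also have "\<dots> = (\<Prod>j=Suc m..n. (X j - u) / (y j - y m)) / (u * (z - 1)) * \<kappa> ^ (n - Suc m)"
            using \<open>m < n\<close> by (simp add: prod.last_plus mult_ac Suc_le_eq)
          also have "\<dots> = ?W (?hh (restrict e J))"
          proof -
            have "(\<Sum>i=Suc m..n. ?hh (restrict e J) i * (z' * y i - u) / (y i - u)) =
              (\<Sum>i=Suc m..n. e i * (z' * y i - u) / (y i - u))"
              by (intro sum.cong refl) (simp only: hhe)
            then show ?thesis by (simp only: prodXu)
          qed
          finally show ?thesis .
        qed
        then show ?thesis
          unfolding iff compl wt r f'_def X_def[symmetric] e_def[symmetric] using int
          by (simp only: if_True ennreal_mult'' mult.assoc)
      qed (simp add: iff)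
    qed
    also have "\<dots> = (\<integral>\<^sup>+h. (if open_simplex J h then f' h else 0) \<partial>?M J)"
      unfolding J_def by (rule IH) (use z' f' in \<open>auto simp: J_def\<close>)
    \<comment> \<open>Scaling by \<open>l\<close> inverts \<open>eta_step\<close>, so
      \<open>\<eta>\<close> now consists of outer weights.\<close>
    also have "\<dots> = ennreal (prod l J) *
        (\<integral>\<^sup>+\<eta>. (if open_simplex J (\<lambda>i\<in>J. l i * \<eta> i) then f' (\<lambda>i\<in>J. l i * \<eta> i) else 0) \<partial>?M J)"
      using SucJ l f' measurable_open_simplex[of J]
      by (intro nn_integral_PiM_scale) (auto intro!: measurable_If)
    also have "\<dots> = (\<integral>\<^sup>+\<eta>. ennreal (prod l J) * (if open_simplex J (\<lambda>i\<in>J. l i * \<eta> i) then f' (\<lambda>i\<in>J. l i * \<eta> i) else 0) \<partial>?M J)"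
    proof (rule nn_integral_cmult[symmetric])
      have "(\<lambda>\<eta>. \<lambda>i\<in>J. l i * \<eta> i) \<in> measurable (?M J) (?M J)"
        by (intro measurable_restrict) (auto intro!: borel_measurable_times measurable_coordinate)
      from measurable_compose[OF this] show "(\<lambda>\<eta>. if open_simplex J (\<lambda>i\<in>J. l i * \<eta> i) then f' (\<lambda>i\<in>J. l i * \<eta> i) else 0)
          \<in> borel_measurable (?M J)"
        using f' measurable_open_simplex[OF SucJ(3)] by (intro measurable_If) auto
    qed
    also have "\<dots> = (\<integral>\<^sup>+\<eta>. ?H \<eta> \<partial>?M J)"
    proof (rule nn_integral_cong, goal_cases)
      case (1 \<eta>)
      \<comment> \<open>The equality of functions in \<open>r\<close> below also concerns indices
        outside \<open>J\<close>, where points of the product space are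
        \<open>undefined\<close>.\<close>
      then have ext: "\<eta> i = undefined" if "i \<notin> J" for i
        using that by (auto simp: space_PiM PiE_def extensional_def)
      define h where "h = (\<lambda>i\<in>J. l i * \<eta> i)"
      let ?B = "slice_factor n m z y \<eta> u"
      have sumh: "sum h J = (\<Sum>i\<in>J. \<eta> i * (y i - y m) / (y i - u)) / \<kappa>"
        unfolding sum_divide_distrib h_def by (intro sum.cong) (auto simp: l_def mult.commute)
      \<comment> \<open>The bound on the sum in the inner simplex thus becomes positivity of the
        slice factor.\<close>
      have B: "?B * (y (Suc m) - y m) = \<kappa> * (1 - sum h J)"
      proof -
        define S where "S = (\<Sum>i\<in>J. \<eta> i * (y i - y m) / (y i - u))"
        define cm where "cm = y (Suc m) - y m"
        have "?B = (\<kappa> - S) / cm"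
          unfolding slice_factor_def S_def cm_def J_def \<kappa>_def z'_def ..
        moreover have "cm \<noteq> 0" using ab by (simp add: cm_def)
        ultimately have "?B * cm = \<kappa> - S" by simp
        also have "\<dots> = \<kappa> * (1 - sum h J)"
          unfolding sumh S_def[symmetric] using True by (simp add: right_diff_distrib)
        finally show ?thesis by (simp only: cm_def)
      qed
      have "sum h J < 1 \<longleftrightarrow> 0 < \<kappa> * (1 - sum h J)" using True by (simp add: zero_less_mult_iff)
      also have "\<dots> \<longleftrightarrow> 0 < ?B" unfolding B[symmetric] using ab by (simp add: zero_less_mult_iff)
      finally have "sum h J < 1 \<longleftrightarrow> 0 < ?B" .
      have iff: "open_simplex J h \<longleftrightarrow> (\<forall>i\<in>J. 0 < \<eta> i) \<and> 0 < ?B"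
      proof -
        have "0 < h i \<longleftrightarrow> 0 < \<eta> i" if "i \<in> J" for i
          using l[OF that] that by (simp add: h_def zero_less_mult_iff)
        then show ?thesis using \<open>sum h J < 1 \<longleftrightarrow> 0 < ?B\<close>
          unfolding open_simplex_def by auto
      qed
      have r: "?r (?hh h) = \<eta>(Suc m := (y (Suc m) - u) * ?B)"
      proof
        fix i
        show "?r (?hh h) i = (\<eta>(Suc m := (y (Suc m) - u) * ?B)) i"
        proof (cases "i = Suc m")
          case True
          have "(1 - sum h J) * \<kappa> * ((y (Suc m) - u) / (y (Suc m) - y m)) =
             ?B * (y (Suc m) - y m) * ((y (Suc m) - u) / (y (Suc m) - y m))"
            unfolding B by (simp add: mult.commute)
          also have "\<dots> = (y (Suc m) - u) * ?B" using ab by simp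
          finally show ?thesis using True \<open>m < n\<close> by simp
        next
          case False
          show ?thesis
          proof (cases "i \<in> J")
            case iJ: True
            then show ?thesis using False c[OF iJ] d[OF iJ] True by (auto simp: h_def l_def J_def)
          next
            case iJ: False
            then show ?thesis using False ext[OF iJ] by (auto simp: J_def)
          qed
        qed
      qed
      have W: "prod l J * ?W (?hh h) = ?B - (y (Suc m) - u) * slice_factor_deriv n m z y \<eta> u"
      proof -
        have "(\<Prod>i=Suc m..n. (y i - u) / (y i - y m)) =
          (y (Suc m) - u) / (y (Suc m) - y m) * (\<Prod>i\<in>J. (y i - u) / (y i - y m))"
          using SucJ by simp
        moreover have "(\<Sum>i=Suc m..n. ?hh h i * (z' * y i - u) / (y i - u)) =
           (1 - (\<Sum>i\<in>J. l i * \<eta> i)) * (z' * (y (Suc m) - u + u) - u) / (y (Suc m) - u) +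
           (\<Sum>i\<in>J. l i * \<eta> i * (z' * (y i - u + u) - u) / (y i - u))"
        proof -
          have "(\<Sum>i\<in>J. ?hh h i * (z' * y i - u) / (y i - u)) =
            (\<Sum>i\<in>J. l i * \<eta> i * (z' * (y i - u + u) - u) / (y i - u))"
            using SucJ by (intro sum.cong) (auto simp: h_def)
          moreover have "sum h J = (\<Sum>i\<in>J. l i * \<eta> i)" by (simp add: h_def)
          ultimately show ?thesis unfolding SucJ(1) using SucJ(2,3) by simp
        qed
        ultimately have "prod l J * ?W (?hh h) = (\<Prod>i\<in>J. l i) * (((y (Suc m) - u) / (y (Suc m) - y m) *
            (\<Prod>i\<in>J. (y i - u) / (y i - y m))) *
            ((1 - (\<Sum>i\<in>J. l i * \<eta> i)) * (z' * (y (Suc m) - u + u) - u) / (y (Suc m) - u) +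
           (\<Sum>i\<in>J. l i * \<eta> i * (z' * (y i - u + u) - u) / (y i - u))) / (u * (z - 1)) * \<kappa> ^ card J)"
          unfolding SucJ(4) by (simp only:)
        also have "\<dots> = (\<kappa> - (\<Sum>i\<in>J. \<eta> i * (y i - y m) / (y i - u))) / (y (Suc m) - y m) +
           (y (Suc m) - u) * ((z' / (u * (z - 1)) + (\<Sum>i\<in>J. \<eta> i * (y i - y m) / (y i - u)\<^sup>2)) / (y (Suc m) - y m))"
          unfolding l_def using True z' \<open>0 < u\<close>
          by (intro Jacobian_identity[OF SucJ(3) c d ab(2) ab(1) _ _ _ \<kappa>_def]) auto
        finally show ?thesis
          by (simp add: slice_factor_def slice_factor_deriv_def J_def \<kappa>_def z'_def)
      qed
      have p: "0 \<le> prod l J" using l by (intro prod_nonneg) (auto intro: less_imp_le)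
      show ?case
        unfolding h_def[symmetric] J_def[symmetric] iff[symmetric] r[symmetric] W[symmetric] f'_def
        by (cases "open_simplex J h")
          (simp_all only: if_True if_False ennreal_mult'[OF p] mult.assoc mult_zero_right)
    qed
    finally show ?thesis unfolding J_def .
  qed
qed

text \<open>Downward induction from \<open>m = n\<close>, where no free coordinate is left and both
  sides are the value of \<open>f\<close> at a single point. Both \<open>z\<close> and
  \<open>f\<close> vary, since a slice has another \<open>z\<close> and hands a modified function to
  the induction hypothesis.\<close>

theorem nn_integral_interlacing:
  fixes f :: "(nat \<Rightarrow> real) \<Rightarrow> ennreal"
  assumes "m \<le> n" and "z = 0 \<or> 1 < z" and "strict_mono_on {m..n} y"
    and "\<forall>i\<in>{m..n}. 0 < y i"
    and "f \<in> borel_measurable (leb_on {Suc m..n})"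
  shows "(\<integral>\<^sup>+x. (if interlacing n m z y x
        then ennreal (weight n m z y (completed n m z y x)) *
          f (restrict (eta n m z y (completed n m z y x)) {Suc m..n}) else 0)
        \<partial>leb_on {m..<n}) =
    (\<integral>\<^sup>+\<eta>. (if open_simplex {Suc m..n} \<eta> then f \<eta> else 0) \<partial>leb_on {Suc m..n})"
  using assms
proof (induction m arbitrary: z f rule: inc_induct)
  case base
  have pairs: "{(i, j). n \<le> i \<and> i < j \<and> j \<le> n} = {}" by auto
  have "weight n n z y X = 1" for X
    unfolding weight_def pairs by simp
  moreover have "0 < (z * y n - y n) / (z - 1)"
  proof -
    have "(z * y n - y n) / (z - 1) = y n"
      using base(1) by (auto simp: left_diff_distrib[of z 1, simplified, symmetric])
    then show ?thesis using base(3) by simp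
  qed
  moreover have E: "{n..<n} = {}" "{Suc n..n} = {}" by auto
  moreover have empty: "integral\<^sup>N (PiM {} (\<lambda>_::nat. lborel :: real measure)) g = g (\<lambda>_. undefined)" for g
    by (rule lebesgue_product.nn_integral_empty) simp
  ultimately show ?case
    unfolding E empty
    by (simp add: interlacing_def last_coord_def open_simplex_def restrict_def)
next
  case (step m)
  let ?M = leb_on
  define J where "J = {Suc (Suc m)..n}"
  define a b where "a = y m" and "b = y (Suc m)"
  note \<open>m < n\<close>
  have I: "{m..<n} = insert m {Suc m..<n}" "{Suc m..n} = insert (Suc m) J" "finite J" "Suc m \<notin> J"
    using \<open>m < n\<close> by (auto simp: J_def)
  note z = step.prems(1) and mono = step.prems(2) and pos = step.prems(3) and f = step.prems(4)
  have mono': "strict_mono_on {Suc m..n} y"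
    using mono by (auto simp: strict_mono_on_def monotone_on_def)
  have pos': "\<forall>i\<in>{Suc m..n}. 0 < y i" using pos by auto
  have less: "y i < y j" if "m \<le> i" "i < j" "j \<le> n" for i j
    using strict_mono_onD[OF mono] that by auto
  have ab: "a < b" "0 < a" using less[of m "Suc m"] pos \<open>m < n\<close> by (auto simp: a_def b_def)
  let ?F = "\<lambda>x. if interlacing n m z y x
        then ennreal (weight n m z y (completed n m z y x)) *
          f (restrict (eta n m z y (completed n m z y x)) {Suc m..n}) else 0"
  let ?B = "\<lambda>\<eta>. slice_factor n m z y \<eta>" and ?B' = "\<lambda>\<eta>. slice_factor_deriv n m z y \<eta>"
  \<comment> \<open>The integrand that slicing produces, as a function of \<open>\<eta>\<close> and
    \<open>u\<close> together and extended by zero outside \<open>a < u < b\<close>.\<close>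
  define H where "H \<eta> u = (if (\<forall>i\<in>J. 0 < \<eta> i) \<and> a < u \<and> u < b \<and> 0 < ?B \<eta> u
        then ennreal (?B \<eta> u - (b - u) * ?B' \<eta> u) * f (\<eta>(Suc m := (b - u) * ?B \<eta> u)) else 0)" for \<eta> u
  have F: "?F \<in> borel_measurable (?M (insert m {Suc m..<n}))"
    unfolding I(1)[symmetric]
    by (intro measurable_If borel_measurable_times_ennreal measurable_compose[OF _ measurable_ennreal]
        measurable_compose[OF measurable_eta_restrict f] measurable_weight predE[OF measurable_interlacing]
        borel_measurable_const)
  have H: "case_prod H \<in> borel_measurable (?M J \<Otimes>\<^sub>M lborel)"
  proof -
    let ?P = "?M J \<Otimes>\<^sub>M (lborel :: real measure)"
    have u: "(\<lambda>p. snd p) \<in> borel_measurable ?P" using measurable_snd[of "?M J" lborel] by simp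
    have e: "(\<lambda>p. fst p i) \<in> borel_measurable ?P" if "i \<in> J" for i
      using measurable_compose[OF measurable_fst measurable_coordinate[OF that]] .
    have e': "(\<lambda>p. fst p i) \<in> borel_measurable ?P" if "i \<in> {Suc (Suc m)..n}" for i
      using e that by (simp add: J_def)
    have B: "(\<lambda>p. ?B (fst p) (snd p)) \<in> borel_measurable ?P"
      unfolding slice_factor_def
      by (intro borel_measurable_divide borel_measurable_diff borel_measurable_sum
          borel_measurable_times borel_measurable_const u e')
    have B': "(\<lambda>p. ?B' (fst p) (snd p)) \<in> borel_measurable ?P"
      unfolding slice_factor_deriv_def
      by (intro borel_measurable_divide borel_measurable_diff borel_measurable_sum borel_measurable_power
          borel_measurable_times borel_measurable_const borel_measurable_uminus borel_measurable_add u e')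
    have "(\<lambda>p. (fst p)(Suc m := (b - snd p) * ?B (fst p) (snd p))) \<in> measurable ?P (?M {Suc m..n})"
      by (rule measurable_fun_upd[where J=J])
        (use I B u in \<open>auto intro!: borel_measurable_times borel_measurable_diff\<close>)
    from measurable_compose[OF this f]
    have f': "(\<lambda>p. f ((fst p)(Suc m := (b - snd p) * ?B (fst p) (snd p)))) \<in> borel_measurable ?P" .
    have P: "Measurable.pred ?P (\<lambda>p. (\<forall>i\<in>J. 0 < fst p i) \<and> a < snd p \<and> snd p < b \<and> 0 < ?B (fst p) (snd p))"
      using I(3) by (intro pred_intros_logic pred_intros_finite borel_measurable_pred_less
          borel_measurable_const u e B)
    show ?thesis unfolding case_prod_beta H_def
      by (intro measurable_If predE[OF P] f' B B' u borel_measurable_times_ennreal measurable_compose[OF _ measurable_ennreal]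
          borel_measurable_diff borel_measurable_times borel_measurable_const)
  qed
  \<comment> \<open>The variable \<open>u = x m\<close> is first made the outer one, for the
    slicing; the later exchange makes it the inner one, for the substitution
    \<open>v = (b - u) * ?B \<eta> u\<close> at fixed \<open>\<eta>\<close>.\<close>
  have "(\<integral>\<^sup>+x. ?F x \<partial>?M {m..<n}) = (\<integral>\<^sup>+u. (\<integral>\<^sup>+x. ?F (x(m := u)) \<partial>?M {Suc m..<n}) \<partial>lborel)"
    unfolding I(1) by (rule lebesgue_product.product_nn_integral_insert_rev[OF _ _ F]) auto
  also have "\<dots> = (\<integral>\<^sup>+u. (\<integral>\<^sup>+\<eta>. H \<eta> u \<partial>?M J) \<partial>lborel)"
  proof (rule nn_integral_cong)
    fix u
    show "(\<integral>\<^sup>+x. ?F (x(m := u)) \<partial>?M {Suc m..<n}) = (\<integral>\<^sup>+\<eta>. H \<eta> u \<partial>?M J)"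
    proof (cases "a < u \<and> u < b")
      case True
      have "(\<integral>\<^sup>+x. ?F (x(m := u)) \<partial>?M {Suc m..<n}) =
        (\<integral>\<^sup>+\<eta>. (if (\<forall>i\<in>{Suc (Suc m)..n}. 0 < \<eta> i) \<and> 0 < ?B \<eta> u
        then ennreal (?B \<eta> u - (y (Suc m) - u) * ?B' \<eta> u) *
          f (\<eta>(Suc m := (y (Suc m) - u) * ?B \<eta> u)) else 0) \<partial>?M {Suc (Suc m)..n})"
        using True step.IH[OF _ mono' pos']
        by (intro nn_integral_slice[OF \<open>m < n\<close> z mono pos _ _ f]) (auto simp: a_def b_def)
      also have "\<dots> = (\<integral>\<^sup>+\<eta>. H \<eta> u \<partial>?M J)"
        unfolding H_def J_def b_def[symmetric] using True by simp
      finally show ?thesis .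
    next
      case False
      then have "\<not> interlacing n m z y (x(m := u))" for x
        using \<open>m < n\<close> by (auto simp: interlacing_def a_def b_def)
      moreover have "H \<eta> u = 0" for \<eta> using False by (auto simp: H_def)
      ultimately show ?thesis by simp
    qed
  qed
  also have "\<dots> = (\<integral>\<^sup>+\<eta>. (\<integral>\<^sup>+u. H \<eta> u \<partial>lborel) \<partial>?M J)"
  proof -
    interpret J: sigma_finite_measure "?M J" by (rule lebesgue_product.sigma_finite[OF I(3)])
    interpret pair_sigma_finite "?M J" lborel ..
    show ?thesis by (rule Fubini'[OF H])
  qed
  also have "\<dots> = (\<integral>\<^sup>+\<eta>. (\<integral>\<^sup>+v. (if open_simplex {Suc m..n} (\<eta>(Suc m := v)) then f (\<eta>(Suc m := v)) else 0) \<partial>lborel) \<partial>?M J)"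
  proof (rule nn_integral_cong)
    fix \<eta> assume \<eta>: "\<eta> \<in> space (?M J)"
    have simplex: "open_simplex {Suc m..n} (\<eta>(Suc m := v)) \<longleftrightarrow> (\<forall>i\<in>J. 0 < \<eta> i) \<and> 0 < v \<and> v < 1 - sum \<eta> J" for v
    proof -
      have "sum (\<eta>(Suc m := v)) J = sum \<eta> J" using I(4) by (intro sum.cong) auto
      then show ?thesis unfolding open_simplex_def I(2) using I(3,4) by auto
    qed
    show "(\<integral>\<^sup>+u. H \<eta> u \<partial>lborel) =
      (\<integral>\<^sup>+v. (if open_simplex {Suc m..n} (\<eta>(Suc m := v)) then f (\<eta>(Suc m := v)) else 0) \<partial>lborel)"
    proof (cases "\<forall>i\<in>J. 0 < \<eta> i")
      case True
      have c: "0 < y i - y m" and d: "0 < y i - u" if "i \<in> {Suc (Suc m)..n}" "u \<le> b" for i u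
        using less[of m i] less[of "Suc m" i] that by (auto simp: b_def)
      have "(\<integral>\<^sup>+u. H \<eta> u \<partial>lborel) =
        (\<integral>\<^sup>+v. (if 0 < v \<and> v < (b - a) * ?B \<eta> a then f (\<eta>(Suc m := v)) else 0) \<partial>lborel)"
      proof -
        have "(\<integral>\<^sup>+u. (if a < u \<and> u < b \<and> 0 < ?B \<eta> u
            then ennreal (?B \<eta> u - (b - u) * ?B' \<eta> u) * f (\<eta>(Suc m := (b - u) * ?B \<eta> u)) else 0) \<partial>lborel) =
        (\<integral>\<^sup>+v. (if 0 < v \<and> v < (b - a) * ?B \<eta> a then f (\<eta>(Suc m := v)) else 0) \<partial>lborel)"
        proof (rule nn_integral_substitution_factored[where f="\<lambda>v. f (\<eta>(Suc m := v))"])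
          show "(\<lambda>v. f (\<eta>(Suc m := v))) \<in> borel_measurable borel"
            using measurable_compose[OF measurable_component_update[OF \<eta> I(4)] f[unfolded I(2)]]
            by (simp add: fun_upd_def)
          fix u assume u: "u \<in> {a..b}"
          then have "0 < u" using ab by auto
          have z1: "z - 1 \<noteq> 0" using z by auto
          show "(?B \<eta> has_real_derivative ?B' \<eta> u) (at u)"
            unfolding slice_factor_def [abs_def] slice_factor_deriv_def
          proof -
            have "((\<lambda>u. (z * y m / u - 1) / (z - 1)) has_real_derivative - (z * y m / u / (u * (z - 1)))) (at u)"
            proof -
              have "((\<lambda>u. z * y m / u - 1) has_real_derivative - (z * y m / (u * u))) (at u)"
                using \<open>0 < u\<close> by (auto intro!: derivative_eq_intros)
              from DERIV_cdivide[OF this, of "z - 1"] show ?thesis by (simp add: mult.assoc)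
            qed
            moreover have "((\<lambda>u. \<Sum>i=Suc (Suc m)..n. \<eta> i * (y i - y m) / (y i - u)) has_real_derivative
              (\<Sum>i=Suc (Suc m)..n. \<eta> i * (y i - y m) / (y i - u)\<^sup>2)) (at u)"
            proof (rule DERIV_sum)
              fix i assume "i \<in> {Suc (Suc m)..n}"
              then have "y i - u \<noteq> 0" using d[of i u] u by auto
              then show "((\<lambda>u. \<eta> i * (y i - y m) / (y i - u)) has_real_derivative
                 \<eta> i * (y i - y m) / (y i - u)\<^sup>2) (at u)"
                by (auto intro!: derivative_eq_intros simp: power2_eq_square)
            qed
            ultimately have "((\<lambda>u. ((z * y m / u - 1) / (z - 1) -
                (\<Sum>i=Suc (Suc m)..n. \<eta> i * (y i - y m) / (y i - u))) / (y (Suc m) - y m)) has_real_derivative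
              (- (z * y m / u / (u * (z - 1))) - (\<Sum>i=Suc (Suc m)..n. \<eta> i * (y i - y m) / (y i - u)\<^sup>2)) /
                (y (Suc m) - y m)) (at u)"
              by (intro DERIV_cdivide DERIV_diff)
            then show "((\<lambda>u. ((z * y m / u - 1) / (z - 1) -
                (\<Sum>i=Suc (Suc m)..n. \<eta> i * (y i - y m) / (y i - u))) / (y (Suc m) - y m)) has_real_derivative
              - ((z * y m / u / (u * (z - 1)) + (\<Sum>i=Suc (Suc m)..n. \<eta> i * (y i - y m) / (y i - u)\<^sup>2)) /
                (y (Suc m) - y m))) (at u)"
              by (simp only: minus_divide_left minus_add_distrib diff_conv_add_uminus)
          qed
          \<comment> \<open>For \<open>z = 0\<close> or \<open>z > 1\<close> both terms of the
            derivative have the same sign, which makes the slice factor decreasing.\<close>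
          have "0 \<le> z * y m / u / (u * (z - 1))"
          proof (cases "z = 0")
            case False
            then show ?thesis using z ab \<open>0 < u\<close>
              by (intro divide_nonneg_nonneg mult_nonneg_nonneg) (auto simp: a_def)
          qed simp
          moreover have "0 \<le> (\<Sum>i=Suc (Suc m)..n. \<eta> i * (y i - y m) / (y i - u)\<^sup>2)"
            using True c[of _ u] u unfolding J_def
            by (intro sum_nonneg divide_nonneg_nonneg mult_nonneg_nonneg) (auto intro: less_imp_le)
          ultimately show "?B' \<eta> u \<le> 0"
            unfolding slice_factor_deriv_def using ab by (simp add: a_def b_def)
        next
          have z1: "z - 1 \<noteq> 0" using z by auto
          show "continuous_on {a..b} (?B' \<eta>)"
            unfolding slice_factor_deriv_def [abs_def] using ab z1 d
            by (intro continuous_intros) (force simp: a_def b_def)+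
        qed (use ab in auto)
        then show ?thesis unfolding H_def using True by simp
      qed
      \<comment> \<open>At \<open>u = y m\<close> the parameter \<open>z * y m / u\<close> is
        \<open>z\<close> again and all fractions equal \<open>1\<close>, so the range of
        \<open>v\<close> ends exactly at the face of the simplex.\<close>
      also have "(b - a) * ?B \<eta> a = 1 - sum \<eta> J"
      proof -
        have "(\<Sum>i=Suc (Suc m)..n. \<eta> i * (y i - y m) / (y i - y m)) = sum \<eta> J"
          unfolding J_def
        proof (rule sum.cong[OF refl])
          fix i assume "i \<in> {Suc (Suc m)..n}"
          from c[OF this, of a] ab show "\<eta> i * (y i - y m) / (y i - y m) = \<eta> i" by simp
        qed
        moreover have "(z * y m / y m - 1) / (z - 1) = 1" using z ab by (auto simp: a_def)
        ultimately show ?thesis unfolding slice_factor_def using ab by (simp add: a_def b_def)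
      qed
      finally show ?thesis unfolding simplex using True by simp
    next
      case False
      then have "H \<eta> u = 0" for u by (auto simp: H_def)
      moreover have "\<not> open_simplex {Suc m..n} (\<eta>(Suc m := v))" for v using simplex False by blast
      ultimately show ?thesis by simp
    qed
  qed
  also have "\<dots> = (\<integral>\<^sup>+\<eta>. (if open_simplex {Suc m..n} \<eta> then f \<eta> else 0) \<partial>?M {Suc m..n})"
  proof -
    have "(\<lambda>\<eta>. if open_simplex {Suc m..n} \<eta> then f \<eta> else 0) \<in> borel_measurable (?M {Suc m..n})"
      using f measurable_open_simplex[of "{Suc m..n}"] by (intro measurable_If) auto
    then show ?thesis unfolding I(2) using I(3,4)
      by (subst lebesgue_product.product_nn_integral_insert) auto
  qed
  finally show ?case .
qed

text \<open>Each pair \<open>(i, n)\<close> is combined with the denominator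
  \<open>X i * (z - 1)\<close>. For \<open>z = 0\<close> the negative signs of
  \<open>X n - X i\<close> and \<open>z - 1\<close> cancel and \<open>1 / (y n - y i)\<close>
  remains; for \<open>z > 1\<close> everything is nonnegative separately.\<close>

lemma weight_nonneg:
  assumes z: "z = 0 \<or> 1 < z" and mono: "strict_mono_on {m..n} y"
    and pos: "\<forall>i\<in>{m..n}. 0 < y i" and int: "interlacing n m z y x"
  shows "0 \<le> weight n m z y (completed n m z y x)"
proof (cases "m \<le> n")
  case False
  then have "{(i, j). m \<le> i \<and> i < j \<and> j \<le> n} = {}" "{m..<n} = {}" by auto
  then show ?thesis by (simp only: weight_def) simp
next
  case True
  define X where "X = completed n m z y x"
  have X: "X i = x i" "y i < X i" "X i < y (Suc i)" "0 < y i" if "i \<in> {m..<n}" for i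
    using int pos that by (auto simp: X_def completed_def interlacing_def dest!: bspec[of _ _ i])
  have le: "y i \<le> y j" if "m \<le> i" "i \<le> j" "j \<le> n" for i j
    using strict_mono_on_leD[OF mono] that by auto
  have less: "X i < X j" if "m \<le> i" "i < j" "j < n" for i j
    using X(3)[of i] X(2)[of j] le[of "Suc i" j] that by auto
  have "0 \<le> (X n - X i) / (y n - y i) / (X i * (z - 1))" if i: "i \<in> {m..<n}" for i
  proof -
    have "0 < X i" using X(2,4)[OF i] by simp
    have yi: "0 \<le> y n - y i" using le[of i n] i by auto
    show ?thesis
    proof (cases "z = 0")
      case True
      then have "X n = 0" by (simp add: X_def completed_def last_coord_def)
      then have "(X n - X i) / (y n - y i) / (X i * (z - 1)) = 1 / (y n - y i)"
        using \<open>0 < X i\<close> True by simp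
      then show ?thesis using yi by simp
    next
      case False
      then have "1 < z" using z by auto
      then have "y n < X n" using int by (simp add: interlacing_def X_def completed_def zero_less_divide_iff)
      then have "X i \<le> X n" using X(3)[OF i] le[of "Suc i" n] i by auto
      then show ?thesis using \<open>1 < z\<close> \<open>0 < X i\<close> yi by simp
    qed
  qed
  then have last: "0 \<le> (\<Prod>i=m..<n. (X n - X i) / (y n - y i) / (X i * (z - 1)))"
    by (intro prod_nonneg) auto
  have rest: "0 \<le> (\<Prod>(i,j)\<in>{(i,j). m \<le> i \<and> i < j \<and> j < n}. (X j - X i) / (y j - y i))"
    using less le by (intro prod_nonneg) (auto intro!: divide_nonneg_nonneg simp: less_imp_le)
  have split: "{(i,j). m \<le> i \<and> i < j \<and> j \<le> n} =
      {(i,j). m \<le> i \<and> i < j \<and> j < n} \<union> (\<lambda>i. (i, n)) ` {m..<n}"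
    by (auto simp: image_iff)
  have fin: "finite {(i,j). m \<le> i \<and> i < j \<and> j < n}"
    by (rule finite_subset[of _ "{..n} \<times> {..n}"]) auto
  have "(\<Prod>(i,j)\<in>{(i,j). m \<le> i \<and> i < j \<and> j \<le> n}. (X j - X i) / (y j - y i)) =
     (\<Prod>(i,j)\<in>{(i,j). m \<le> i \<and> i < j \<and> j < n}. (X j - X i) / (y j - y i)) *
     (\<Prod>(i,j)\<in>(\<lambda>i. (i, n)) ` {m..<n}. (X j - X i) / (y j - y i))"
    unfolding split by (rule prod.union_disjoint) (use fin in auto)
  also have "(\<Prod>(i,j)\<in>(\<lambda>i. (i, n)) ` {m..<n}. (X j - X i) / (y j - y i)) =
     (\<Prod>i=m..<n. (X n - X i) / (y n - y i))"
    by (subst prod.reindex) (auto simp: inj_on_def)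
  finally have P: "(\<Prod>(i,j)\<in>{(i,j). m \<le> i \<and> i < j \<and> j \<le> n}. (X j - X i) / (y j - y i)) =
     (\<Prod>(i,j)\<in>{(i,j). m \<le> i \<and> i < j \<and> j < n}. (X j - X i) / (y j - y i)) *
     (\<Prod>i=m..<n. (X n - X i) / (y n - y i))" .
  have "weight n m z y X = (\<Prod>(i,j)\<in>{(i,j). m \<le> i \<and> i < j \<and> j < n}. (X j - X i) / (y j - y i)) *
      (\<Prod>i=m..<n. (X n - X i) / (y n - y i) / (X i * (z - 1)))"
    unfolding weight_def P unfolding prod_dividef times_divide_eq_right ..
  then show ?thesis using last rest by (simp add: X_def)
qed

definition weight_on :: "nat \<Rightarrow> nat \<Rightarrow> real \<Rightarrow> (nat \<Rightarrow> real) \<Rightarrow> (nat \<Rightarrow> real) \<Rightarrow> real" where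
  "weight_on n m z y x = (if interlacing n m z y x then weight n m z y (completed n m z y x) else 0)"

text \<open>Applied to indicator functions, \<open>nn_integral_interlacing\<close> says that
  \<open>T\<close> pushes the measure with density \<open>weight_on\<close> forward to Lebesgue
  measure on the open simplex. Complex integrands, including the question of their integrability,
  then transfer by the rules for image and density measures.\<close>

lemma integral_interlacing:
  fixes \<phi> :: "(nat \<Rightarrow> real) \<Rightarrow> complex"
  assumes "m \<le> n" and z: "z = 0 \<or> 1 < z" and mono: "strict_mono_on {m..n} y"
    and pos: "\<forall>i\<in>{m..n}. 0 < y i"
    and \<phi>: "\<phi> \<in> borel_measurable (leb_on {Suc m..n})"
  defines "T \<equiv> \<lambda>x. restrict (eta n m z y (completed n m z y x)) {Suc m..n}"
  shows "integrable (leb_on {m..<n}) (\<lambda>x. weight_on n m z y x *\<^sub>R \<phi> (T x)) \<longleftrightarrow>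
      integrable (leb_on {Suc m..n}) (\<lambda>\<eta>. of_bool (open_simplex {Suc m..n} \<eta>) *\<^sub>R \<phi> \<eta>)"
    and "(LINT x|leb_on {m..<n}. weight_on n m z y x *\<^sub>R \<phi> (T x)) =
      (LINT \<eta>|leb_on {Suc m..n}. of_bool (open_simplex {Suc m..n} \<eta>) *\<^sub>R \<phi> \<eta>)"
proof -
  let ?M = "leb_on {m..<n}" and ?N = "leb_on {Suc m..n}"
  let ?w = "weight_on n m z y" and ?s = "\<lambda>\<eta>. of_bool (open_simplex {Suc m..n} \<eta>) :: real"
  have w: "?w \<in> borel_measurable ?M"
    unfolding weight_on_def [abs_def]
    by (intro measurable_If measurable_weight borel_measurable_const predE[OF measurable_interlacing])
  have w0: "0 \<le> ?w x" for x
    using weight_nonneg[OF z mono pos] by (simp add: weight_on_def)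
  have s: "?s \<in> borel_measurable ?N"
  proof -
    have "?s = (\<lambda>\<eta>. if open_simplex {Suc m..n} \<eta> then 1 else 0)" by auto
    also have "\<dots> \<in> borel_measurable ?N"
      by (intro measurable_If borel_measurable_const predE[OF measurable_open_simplex]) auto
    finally show ?thesis .
  qed
  have T: "T \<in> measurable ?M ?N" unfolding T_def by (rule measurable_eta_restrict)
  have T': "T \<in> measurable (density ?M (\<lambda>x. ennreal (?w x))) ?N" using T by simp
  have \<phi>T: "(\<lambda>x. \<phi> (T x)) \<in> borel_measurable ?M" by (rule measurable_compose[OF T \<phi>])
  have eq: "distr (density ?M (\<lambda>x. ennreal (?w x))) ?N T = density ?N (\<lambda>\<eta>. ennreal (?s \<eta>))"
  proof (rule measure_eqI)
    fix A assume "A \<in> sets (distr (density ?M (\<lambda>x. ennreal (?w x))) ?N T)"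
    then have A: "A \<in> sets ?N" by simp
    have TA: "T -` A \<inter> space ?M \<in> sets ?M" using measurable_sets[OF T A] .
    have "emeasure (distr (density ?M (\<lambda>x. ennreal (?w x))) ?N T) A =
      (\<integral>\<^sup>+x. ennreal (?w x) * indicator (T -` A \<inter> space ?M) x \<partial>?M)"
      using A TA w T' by (simp add: emeasure_distr emeasure_density)
    also have "\<dots> = (\<integral>\<^sup>+x. (if interlacing n m z y x
        then ennreal (weight n m z y (completed n m z y x)) * indicator A (T x) else 0) \<partial>?M)"
      by (intro nn_integral_cong) (auto simp: weight_on_def indicator_def)
    also have "\<dots> = (\<integral>\<^sup>+\<eta>. (if open_simplex {Suc m..n} \<eta> then indicator A \<eta> else 0) \<partial>?N)"
      unfolding T_def using A by (intro nn_integral_interlacing assms) auto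
    also have "\<dots> = (\<integral>\<^sup>+\<eta>. ennreal (?s \<eta>) * indicator A \<eta> \<partial>?N)"
      by (intro nn_integral_cong) auto
    also have "\<dots> = emeasure (density ?N (\<lambda>\<eta>. ennreal (?s \<eta>))) A"
      using A s by (simp add: emeasure_density)
    finally show "emeasure (distr (density ?M (\<lambda>x. ennreal (?w x))) ?N T) A =
      emeasure (density ?N (\<lambda>\<eta>. ennreal (?s \<eta>))) A" .
  qed simp
  have "integrable ?M (\<lambda>x. ?w x *\<^sub>R \<phi> (T x)) \<longleftrightarrow> integrable (density ?M (\<lambda>x. ennreal (?w x))) (\<lambda>x. \<phi> (T x))"
    by (rule integrable_density[OF \<phi>T w, symmetric]) (simp add: w0)
  also have "\<dots> \<longleftrightarrow> integrable (density ?N (\<lambda>\<eta>. ennreal (?s \<eta>))) \<phi>"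
    unfolding eq[symmetric] by (rule integrable_distr_eq[OF T' \<phi>, symmetric])
  also have "\<dots> \<longleftrightarrow> integrable ?N (\<lambda>\<eta>. ?s \<eta> *\<^sub>R \<phi> \<eta>)"
    by (rule integrable_density[OF \<phi> s]) simp
  finally show "integrable ?M (\<lambda>x. ?w x *\<^sub>R \<phi> (T x)) \<longleftrightarrow> integrable ?N (\<lambda>\<eta>. ?s \<eta> *\<^sub>R \<phi> \<eta>)" .
  have "(LINT x|?M. ?w x *\<^sub>R \<phi> (T x)) = (LINT x|density ?M (\<lambda>x. ennreal (?w x)). \<phi> (T x))"
    by (rule integral_density[OF \<phi>T w, symmetric]) (simp add: w0)
  also have "\<dots> = (LINT \<eta>|density ?N (\<lambda>\<eta>. ennreal (?s \<eta>)). \<phi> \<eta>)"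
    unfolding eq[symmetric] by (rule integral_distr[OF T' \<phi>, symmetric])
  also have "\<dots> = (LINT \<eta>|?N. ?s \<eta> *\<^sub>R \<phi> \<eta>)"
    by (rule integral_density[OF \<phi> s]) simp
  finally show "(LINT x|?M. ?w x *\<^sub>R \<phi> (T x)) = (LINT \<eta>|?N. ?s \<eta> *\<^sub>R \<phi> \<eta>)" .
qed

subsection \<open>Integrals over the simplex\<close>

text \<open>For weights of total \<open>1\<close> this undoes the restriction to the free
  coordinates \<open>{Suc m..n}\<close>.\<close>

definition barycentric :: "nat \<Rightarrow> nat \<Rightarrow> (nat \<Rightarrow> real) \<Rightarrow> nat \<Rightarrow> real" where
  "barycentric m n \<eta> = \<eta>(m := 1 - sum \<eta> {Suc m..n})"

text \<open>The product form covers the moments, and values in \<open>ennreal\<close> allow the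
  factors to be permuted before any integrability is known.\<close>

definition simplex_integral :: "nat \<Rightarrow> nat \<Rightarrow> (nat \<Rightarrow> real \<Rightarrow> ennreal) \<Rightarrow> ennreal" where
  "simplex_integral m n \<psi> = (\<integral>\<^sup>+\<eta>. (if open_simplex {Suc m..n} \<eta>
     then \<Prod>i=m..n. \<psi> i (barycentric m n \<eta> i) else 0) \<partial>leb_on {Suc m..n})"

lemma measurable_barycentric:
  "i \<in> {m..n} \<Longrightarrow> (\<lambda>\<eta>. barycentric m n \<eta> i) \<in> borel_measurable (leb_on {Suc m..n})"
  unfolding barycentric_def
  by (cases "i = m") (auto intro!: borel_measurable_diff borel_measurable_sum measurable_coordinate)

lemma measurable_simplex_integrand:
  assumes "\<And>i. i \<in> {m..n} \<Longrightarrow> \<psi> i \<in> borel_measurable borel"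
  shows "(\<lambda>\<eta>. if open_simplex {Suc m..n} \<eta> then \<Prod>i=m..n. \<psi> i (barycentric m n \<eta> i) else (0::ennreal))
    \<in> borel_measurable (leb_on {Suc m..n})"
  using assms
  by (intro measurable_If predE[OF measurable_open_simplex] borel_measurable_const
      borel_measurable_prod_ennreal measurable_compose[OF measurable_barycentric]) auto

lemma barycentric_simplex:
  assumes "m \<le> n" "open_simplex {Suc m..n} \<eta>"
  shows "\<And>i. i \<in> {m..n} \<Longrightarrow> 0 < barycentric m n \<eta> i"
    and "\<And>i. i \<in> {m..n} \<Longrightarrow> barycentric m n \<eta> i \<le> 1"
    and "sum (barycentric m n \<eta>) {m..n} = 1"
proof -
  let ?e = "barycentric m n \<eta>"
  show sum1: "sum ?e {m..n} = 1"
    using assms(1) by (simp add: sum.atLeast_Suc_atMost barycentric_def)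
  show pos: "0 < ?e i" if "i \<in> {m..n}" for i
    using assms(2) that by (cases "i = m") (auto simp: barycentric_def open_simplex_def)
  show "?e i \<le> 1" if "i \<in> {m..n}" for i
    unfolding sum1[symmetric] using pos that by (intro member_le_sum) (auto intro: less_imp_le)
qed

text \<open>With the free coordinate \<open>b\<close> integrated innermost, the reflection of
  \<open>v\<close> to \<open>s - v\<close>, where \<open>s = 1 - sum h K\<close>, exchanges it with
  the dependent coordinate \<open>m\<close> and leaves the others alone.\<close>

lemma simplex_integral_transpose_first:
  assumes \<psi>: "\<And>i. i \<in> {m..n} \<Longrightarrow> \<psi> i \<in> borel_measurable borel" and b: "b \<in> {Suc m..n}"
  shows "simplex_integral m n (\<psi> \<circ> Transposition.transpose m b) = simplex_integral m n \<psi>"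
proof -
  define K where "K = {Suc m..n} - {b}"
  have K: "{Suc m..n} = insert b K" "b \<notin> K" "finite K" "{m..n} = insert m (insert b K)"
    "m \<notin> K" "b \<noteq> m"
    using b by (auto simp: K_def)
  let ?M = leb_on
  let ?E = "\<lambda>\<psi>. (\<integral>\<^sup>+h. (\<integral>\<^sup>+v. (if (\<forall>i\<in>K. 0 < h i) \<and> 0 < v \<and> v < 1 - sum h K
      then \<psi> m (1 - sum h K - v) * (\<psi> b v * (\<Prod>i\<in>K. \<psi> i (h i))) else 0) \<partial>lborel) \<partial>?M K)"
  have expand: "simplex_integral m n \<psi> = ?E \<psi>"
    if \<psi>: "\<And>i. i \<in> {m..n} \<Longrightarrow> \<psi> i \<in> borel_measurable borel" for \<psi> :: "nat \<Rightarrow> real \<Rightarrow> ennreal"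
  proof -
    have "simplex_integral m n \<psi> = (\<integral>\<^sup>+h. (\<integral>\<^sup>+v. (if open_simplex {Suc m..n} (h(b := v))
      then \<Prod>i=m..n. \<psi> i (barycentric m n (h(b := v)) i) else 0) \<partial>lborel) \<partial>?M K)"
      unfolding simplex_integral_def K(1)
      by (rule lebesgue_product.product_nn_integral_insert[OF K(3,2)
            measurable_simplex_integrand[of m n \<psi>, OF \<psi>, unfolded K(1)]])
    also have "\<dots> = (\<integral>\<^sup>+h. (\<integral>\<^sup>+v. (if (\<forall>i\<in>K. 0 < h i) \<and> 0 < v \<and> v < 1 - sum h K
      then \<psi> m (1 - sum h K - v) * (\<psi> b v * (\<Prod>i\<in>K. \<psi> i (h i))) else 0) \<partial>lborel) \<partial>?M K)"
    proof (intro nn_integral_cong)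
      fix h and v :: real
      have s: "sum (h(b := v)) {Suc m..n} = v + sum h K"
      proof -
        have "sum (h(b := v)) K = sum h K" using K by (intro sum.cong) auto
        then show ?thesis unfolding K(1) using K by simp
      qed
      have "open_simplex {Suc m..n} (h(b := v)) \<longleftrightarrow> (\<forall>i\<in>K. 0 < h i) \<and> 0 < v \<and> v < 1 - sum h K"
        unfolding open_simplex_def s unfolding K(1) using K(2) by auto
      moreover have "(\<Prod>i=m..n. \<psi> i (barycentric m n (h(b := v)) i)) =
         \<psi> m (1 - sum h K - v) * (\<psi> b v * (\<Prod>i\<in>K. \<psi> i (h i)))"
      proof -
        have "barycentric m n (h(b := v)) m = 1 - sum h K - v"
          unfolding barycentric_def s by simp
        moreover have "barycentric m n (h(b := v)) b = v" using K by (simp add: barycentric_def)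
        moreover have "(\<Prod>i\<in>K. \<psi> i (barycentric m n (h(b := v)) i)) = (\<Prod>i\<in>K. \<psi> i (h i))"
          using K by (intro prod.cong) (auto simp: barycentric_def)
        ultimately show ?thesis unfolding K(4) using K by simp
      qed
      ultimately show "(if open_simplex {Suc m..n} (h(b := v))
          then \<Prod>i=m..n. \<psi> i (barycentric m n (h(b := v)) i) else 0) =
        (if (\<forall>i\<in>K. 0 < h i) \<and> 0 < v \<and> v < 1 - sum h K
          then \<psi> m (1 - sum h K - v) * (\<psi> b v * (\<Prod>i\<in>K. \<psi> i (h i))) else 0)"
        by simp
    qed
    finally show ?thesis .
  qed
  have tr: "(\<psi> \<circ> Transposition.transpose m b) i \<in> borel_measurable borel" if "i \<in> {m..n}" for i
  proof -
    have "Transposition.transpose m b i \<in> {m..n}"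
      using that b by (auto simp: Transposition.transpose_def)
    then show ?thesis unfolding comp_apply by (rule \<psi>)
  qed
  have [measurable]: "\<psi> m \<in> borel_measurable borel" "\<psi> b \<in> borel_measurable borel"
    using \<psi> b by auto
  have "simplex_integral m n (\<psi> \<circ> Transposition.transpose m b) = ?E (\<psi> \<circ> Transposition.transpose m b)"
    by (rule expand[OF tr])
  also have "\<dots> = ?E \<psi>"
  proof (rule nn_integral_cong)
    fix h :: "nat \<Rightarrow> real"
    define s where "s = 1 - sum h K"
    define c where "c = (\<Prod>i\<in>K. \<psi> i (h i))"
    define P where "P \<longleftrightarrow> (\<forall>i\<in>K. 0 < h i)"
    let ?G = "\<lambda>v. if P \<and> 0 < v \<and> v < s then \<psi> m (s - v) * (\<psi> b v * c) else 0"
    have "(\<Prod>i\<in>K. (\<psi> \<circ> Transposition.transpose m b) i (h i)) = c"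
      unfolding c_def using K by (intro prod.cong) (auto simp: Transposition.transpose_def)
    then have "(\<integral>\<^sup>+v. (if (\<forall>i\<in>K. 0 < h i) \<and> 0 < v \<and> v < 1 - sum h K
      then (\<psi> \<circ> Transposition.transpose m b) m (1 - sum h K - v) *
        ((\<psi> \<circ> Transposition.transpose m b) b v * (\<Prod>i\<in>K. (\<psi> \<circ> Transposition.transpose m b) i (h i))) else 0) \<partial>lborel) =
      (\<integral>\<^sup>+v. (if P \<and> 0 < v \<and> v < s then \<psi> b (s - v) * (\<psi> m v * c) else 0) \<partial>lborel)"
      by (simp only: s_def[symmetric] P_def[symmetric] comp_apply transpose_apply_first
          transpose_apply_second)
    also have "\<dots> = (\<integral>\<^sup>+v. ?G (s + (- 1) * v) \<partial>lborel)"
      by (intro nn_integral_cong) (auto simp: mult_ac)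
    also have "\<dots> = (\<integral>\<^sup>+v. ?G v \<partial>lborel)"
    proof -
      have "?G \<in> borel_measurable borel" by measurable
      from nn_integral_real_affine[OF this, of "-1" s] show ?thesis by simp
    qed
    finally show "(\<integral>\<^sup>+v. (if (\<forall>i\<in>K. 0 < h i) \<and> 0 < v \<and> v < 1 - sum h K
      then (\<psi> \<circ> Transposition.transpose m b) m (1 - sum h K - v) *
        ((\<psi> \<circ> Transposition.transpose m b) b v * (\<Prod>i\<in>K. (\<psi> \<circ> Transposition.transpose m b) i (h i))) else 0) \<partial>lborel) =
      (\<integral>\<^sup>+v. (if (\<forall>i\<in>K. 0 < h i) \<and> 0 < v \<and> v < 1 - sum h K
      then \<psi> m (1 - sum h K - v) * (\<psi> b v * (\<Prod>i\<in>K. \<psi> i (h i))) else 0) \<partial>lborel)"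
      by (simp only: s_def P_def c_def)
  qed
  also have "\<dots> = simplex_integral m n \<psi>"
    by (rule expand[OF \<psi>, symmetric])
  finally show ?thesis .
qed

text \<open>A transposition of two free coordinates is the conjugate
  \<open>(m b) (m a) (m b)\<close> of exchanges with the dependent coordinate.\<close>

lemma simplex_integral_transpose:
  assumes \<psi>: "\<And>i. i \<in> {m..n} \<Longrightarrow> \<psi> i \<in> borel_measurable borel" and ab: "a \<in> {m..n}" "b \<in> {m..n}"
  shows "simplex_integral m n (\<psi> \<circ> Transposition.transpose a b) = simplex_integral m n \<psi>"
proof -
  have first: "simplex_integral m n (\<psi> \<circ> Transposition.transpose m c) = simplex_integral m n \<psi>"
    if "\<And>i. i \<in> {m..n} \<Longrightarrow> \<psi> i \<in> borel_measurable borel" "c \<in> {m..n}" for c and \<psi> :: "nat \<Rightarrow> real \<Rightarrow> ennreal"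
    using simplex_integral_transpose_first[of m n \<psi> c] that by (cases "c = m") auto
  have tr: "(\<psi> \<circ> Transposition.transpose m c) i \<in> borel_measurable borel"
    if "\<And>i. i \<in> {m..n} \<Longrightarrow> \<psi> i \<in> borel_measurable borel" "c \<in> {m..n}" "i \<in> {m..n}"
    for c i and \<psi> :: "nat \<Rightarrow> real \<Rightarrow> ennreal"
  proof -
    have "Transposition.transpose m c i \<in> {m..n}"
      using that(2,3) by (auto simp: Transposition.transpose_def)
    then show ?thesis unfolding comp_apply by (rule that(1))
  qed
  show ?thesis
  proof (cases "a = m \<or> b = m \<or> a = b")
    case True
    then show ?thesis
      using first[OF \<psi> ab(1)] first[OF \<psi> ab(2)] by (auto simp: transpose_commute[of _ m])
  next
    case False
    then have "\<psi> \<circ> Transposition.transpose a b =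
      ((\<psi> \<circ> Transposition.transpose m b) \<circ> Transposition.transpose m a) \<circ> Transposition.transpose m b"
      by (auto simp: fun_eq_iff Transposition.transpose_def)
    then show ?thesis
      by (simp only: first[OF \<psi> ab(2)] first[OF tr[OF \<psi> ab(2)] ab(1)]
        first[OF tr[OF tr[OF \<psi> ab(2)] ab(1)] ab(2)])
  qed
qed

lemma simplex_integral_permute:
  assumes "\<pi> permutes {m..n}" and \<psi>: "\<And>i. i \<in> {m..n} \<Longrightarrow> \<psi> i \<in> borel_measurable borel"
  shows "simplex_integral m n (\<psi> \<circ> \<pi>) = simplex_integral m n \<psi>"
  using assms(1) finite_atLeastAtMost assms(2)
proof (induction arbitrary: \<psi> rule: permutes_induct)
  case id
  then show ?case by simp
next
  case (swap a b p)
  have "(\<psi> \<circ> Transposition.transpose a b) i \<in> borel_measurable borel" if "i \<in> {m..n}" for i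
  proof -
    have "Transposition.transpose a b i \<in> {m..n}"
      using that swap.hyps by (auto simp: Transposition.transpose_def)
    then show ?thesis unfolding comp_apply by (rule swap.prems)
  qed
  then have "simplex_integral m n ((\<psi> \<circ> Transposition.transpose a b) \<circ> p) =
      simplex_integral m n (\<psi> \<circ> Transposition.transpose a b)"
    using swap by blast
  also have "\<dots> = simplex_integral m n \<psi>"
    using swap by (intro simplex_integral_transpose) auto
  finally show ?case by (simp only: comp_assoc)
qed

text \<open>Some barycentric coordinate is at least \<open>1 / N\<close>, so its factor is bounded; by symmetry it may be
  taken to be the dependent one, and the other factors are integrated over the cube.\<close>

lemma simplex_integral_powr_finite:
  assumes "m \<le> n" "0 < g"
  shows "simplex_integral m n (\<lambda>_ t. ennreal (t powr (g - 1))) < \<infinity>"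
proof -
  let ?p = "\<lambda>t::real. ennreal (t powr (g - 1))"
  let ?M = "leb_on {Suc m..n}"
  define N where "N = real (card {m..n})"
  have N: "0 < N" "1 \<le> N" using \<open>m \<le> n\<close> by (auto simp: N_def)
  \<comment> \<open>\<open>C\<close> bounds \<open>t powr (g - 1)\<close> on
    \<open>[1 / N, 1]\<close>: the power is at most \<open>1\<close> for \<open>g \<ge> 1\<close>,
    and largest at \<open>1 / N\<close> for \<open>g < 1\<close>.\<close>
  define C where "C = max 1 (N powr (1 - g))"
  have bound: "t powr (g - 1) \<le> C" if "1 / N \<le> t" "t \<le> 1" for t
  proof (cases "g \<ge> 1")
    case True
    have "0 < 1 / N" using N by simp
    then have "0 < t" using that by linarith
    then have "t powr (g - 1) \<le> 1" using True that
      by (intro powr_le1) auto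
    then show ?thesis by (simp add: C_def)
  next
    case False
    have "t powr (g - 1) \<le> (1 / N) powr (g - 1)"
      using that N False by (intro powr_mono2') auto
    also have "\<dots> = N powr (1 - g)"
      using N by (simp add: powr_divide powr_minus_divide[symmetric] powr_minus[symmetric])
    finally show ?thesis by (simp add: C_def)
  qed
  define \<psi> where "\<psi> k = (\<lambda>i t. if i = k then ennreal C else ?p t)" for k :: nat
  have \<psi>: "\<psi> k i \<in> borel_measurable borel" for k i
    unfolding \<psi>_def by (cases "i = k") auto
  \<comment> \<open>Which coordinate is at least \<open>1 / N\<close> depends on the point; summing
    over all \<open>k\<close> removes that choice.\<close>
  have le: "(\<Prod>i=m..n. ?p (e i)) \<le> (\<Sum>k=m..n. \<Prod>i=m..n. \<psi> k i (e i))"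
    if e: "\<And>i. i \<in> {m..n} \<Longrightarrow> 0 < e i" "\<And>i. i \<in> {m..n} \<Longrightarrow> e i \<le> 1" "sum e {m..n} = 1" for e
  proof -
    have "\<exists>k\<in>{m..n}. 1 / N \<le> e k"
    proof (rule ccontr)
      assume "\<not> ?thesis"
      then have "sum e {m..n} < (\<Sum>k\<in>{m..n}. 1 / N)"
        using \<open>m \<le> n\<close> by (intro sum_strict_mono) (auto simp: not_le)
      also have "\<dots> = 1" using N by (simp only: sum_constant N_def) simp
      finally show False using e(3) by simp
    qed
    then obtain k where k: "k \<in> {m..n}" "1 / N \<le> e k" ..
    have "(\<Prod>i=m..n. ?p (e i)) \<le> (\<Prod>i=m..n. \<psi> k i (e i))"
    proof -
      define r where "r i = (if i = k then C else e i powr (g - 1))" for i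
      have "0 \<le> C" by (simp add: C_def)
      then have r: "\<psi> k i (e i) = ennreal (r i)" "0 \<le> r i" "e i powr (g - 1) \<le> r i" for i
        using bound[OF k(2) e(2)[OF k(1)]] by (auto simp: \<psi>_def r_def)
      show ?thesis
        unfolding r(1) using r(2,3) by (simp add: prod_ennreal prod_mono ennreal_leI)
    qed
    also have "\<dots> \<le> (\<Sum>k=m..n. \<Prod>i=m..n. \<psi> k i (e i))"
      using k(1) by (intro member_le_sum) auto
    finally show ?thesis .
  qed
  have "simplex_integral m n (\<lambda>_. ?p) \<le> (\<integral>\<^sup>+\<eta>. (\<Sum>k=m..n. if open_simplex {Suc m..n} \<eta>
     then \<Prod>i=m..n. \<psi> k i (barycentric m n \<eta> i) else 0) \<partial>?M)"
    unfolding simplex_integral_def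
    by (intro nn_integral_mono) (auto intro!: le barycentric_simplex[OF \<open>m \<le> n\<close>])
  also have "\<dots> = (\<Sum>k=m..n. simplex_integral m n (\<psi> k))"
    unfolding simplex_integral_def
    by (rule nn_integral_sum) (rule measurable_simplex_integrand[OF \<psi>])
  also have "\<dots> = (\<Sum>k=m..n. simplex_integral m n (\<psi> m))"
  proof (rule sum.cong[OF refl])
    fix k assume k: "k \<in> {m..n}"
    have "\<psi> k = \<psi> m \<circ> Transposition.transpose m k"
      by (auto simp: fun_eq_iff \<psi>_def Transposition.transpose_def)
    then show "simplex_integral m n (\<psi> k) = simplex_integral m n (\<psi> m)"
      using simplex_integral_transpose[OF \<psi>, of m m n k] k by simp
  qed
  also have "\<dots> < \<infinity>"
  proof -
    have I: "(\<integral>\<^sup>+t. ?p t * indicator {0..1} t \<partial>lborel) < \<infinity>"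
    proof -
      have "((\<lambda>t. t powr (g - 1)) has_integral (1 powr (g - 1 + 1) / (g - 1 + 1))) {0..1}"
        using \<open>0 < g\<close> by (intro has_integral_powr_from_0) auto
      then have "(\<integral>\<^sup>+t. ennreal (indicator {0..1} t * t powr (g - 1)) \<partial>lborel) = ennreal (1 powr (g - 1 + 1) / (g - 1 + 1))"
        by (intro nn_integral_has_integral_lebesgue) auto
      moreover have "(\<integral>\<^sup>+t. ?p t * indicator {0..1} t \<partial>lborel) = (\<integral>\<^sup>+t. ennreal (indicator {0..1} t * t powr (g - 1)) \<partial>lborel)"
        by (intro nn_integral_cong) (auto simp: indicator_def)
      ultimately show ?thesis by simp
    qed
    \<comment> \<open>For \<open>k = m\<close> the factor of the dependent coordinate is the
      constant \<open>C\<close>, so after enlarging the simplex to the cube the integral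
      factorises.\<close>
    have "simplex_integral m n (\<psi> m) \<le> (\<integral>\<^sup>+\<eta>. ennreal C * (\<Prod>i\<in>{Suc m..n}. ?p (\<eta> i) * indicator {0..1} (\<eta> i)) \<partial>?M)"
      unfolding simplex_integral_def
    proof (intro nn_integral_mono)
      fix \<eta> :: "nat \<Rightarrow> real"
      show "(if open_simplex {Suc m..n} \<eta> then \<Prod>i=m..n. \<psi> m i (barycentric m n \<eta> i) else 0) \<le>
         ennreal C * (\<Prod>i\<in>{Suc m..n}. ?p (\<eta> i) * indicator {0..1} (\<eta> i))"
      proof (cases "open_simplex {Suc m..n} \<eta>")
        case True
        have "(\<Prod>i=m..n. \<psi> m i (barycentric m n \<eta> i)) = ennreal C * (\<Prod>i=Suc m..n. ?p (\<eta> i) * indicator {0..1} (\<eta> i))"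
        proof -
          have "(\<Prod>i=Suc m..n. \<psi> m i (barycentric m n \<eta> i)) = (\<Prod>i=Suc m..n. ?p (\<eta> i) * indicator {0..1} (\<eta> i))"
          proof (rule prod.cong[OF refl])
            fix i assume "i \<in> {Suc m..n}"
            then show "\<psi> m i (barycentric m n \<eta> i) = ?p (\<eta> i) * indicator {0..1} (\<eta> i)"
              using barycentric_simplex(1,2)[OF \<open>m \<le> n\<close> True, of i]
              by (auto simp: \<psi>_def barycentric_def indicator_def)
          qed
          then show ?thesis using \<open>m \<le> n\<close> by (simp add: prod.atLeast_Suc_atMost \<psi>_def)
        qed
        then show ?thesis using True by simp
      qed simp
    qed
    also have "\<dots> = ennreal C * (\<Prod>i\<in>{Suc m..n}. \<integral>\<^sup>+t. ?p t * indicator {0..1} t \<partial>lborel)"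
    proof -
      have "(\<lambda>\<eta>. \<Prod>i\<in>{Suc m..n}. ?p (\<eta> i) * indicator {0..1} (\<eta> i)) \<in> borel_measurable ?M"
        by (intro borel_measurable_prod_ennreal measurable_compose[OF measurable_coordinate]) auto
      then show ?thesis
        by (subst nn_integral_cmult, assumption, subst lebesgue_product.product_nn_integral_prod) auto
    qed
    also have "\<dots> < \<infinity>"
      using I by (simp add: ennreal_mult_less_top power_less_top_ennreal)
    finally show ?thesis by (simp add: ennreal_mult_less_top of_nat_less_top)
  qed
  finally show ?thesis .
qed

subsection \<open>Symmetric polynomials\<close>

lemma poly_mapping_monomials: "p = (\<Sum>m\<in>Poly_Mapping.keys p. Poly_Mapping.single m (Poly_Mapping.lookup p m))"
proof (rule poly_mapping_eqI)
  fix k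
  have "(\<Sum>m\<in>Poly_Mapping.keys p. Poly_Mapping.lookup (Poly_Mapping.single m (Poly_Mapping.lookup p m)) k) =
    (\<Sum>m\<in>Poly_Mapping.keys p. if m = k then Poly_Mapping.lookup p m else 0)"
    by (intro sum.cong) (auto simp: lookup_single when_def)
  then show "Poly_Mapping.lookup p k =
      Poly_Mapping.lookup (\<Sum>m\<in>Poly_Mapping.keys p. Poly_Mapping.single m (Poly_Mapping.lookup p m)) k"
    by (simp add: lookup_sum in_keys_iff)
qed

section \<open>Evaluation and substitution as ring homomorphisms\<close>

definition monomial_value :: "(nat \<Rightarrow> 'a::comm_semiring_1) \<Rightarrow> (nat \<Rightarrow>\<^sub>0 nat) \<Rightarrow> 'a" where
  "monomial_value \<sigma> m = (\<Prod>i\<in>Poly_Mapping.keys m. \<sigma> i ^ Poly_Mapping.lookup m i)"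

lemma monomial_value_superset:
  assumes "finite S" "Poly_Mapping.keys m \<subseteq> S"
  shows "monomial_value \<sigma> m = (\<Prod>i\<in>S. \<sigma> i ^ Poly_Mapping.lookup m i)"
  unfolding monomial_value_def
  by (rule prod.mono_neutral_left) (use assms in \<open>auto simp: in_keys_iff\<close>)

lemma monomial_value_add: "monomial_value \<sigma> (m + m') = monomial_value \<sigma> m * monomial_value \<sigma> m'"
proof -
  let ?S = "Poly_Mapping.keys m \<union> Poly_Mapping.keys m'"
  have "monomial_value \<sigma> (m + m') = (\<Prod>i\<in>?S. \<sigma> i ^ Poly_Mapping.lookup (m + m') i)"
    by (rule monomial_value_superset) (use Poly_Mapping.keys_add[of m m'] in auto)
  also have "\<dots> = (\<Prod>i\<in>?S. \<sigma> i ^ Poly_Mapping.lookup m i) * (\<Prod>i\<in>?S. \<sigma> i ^ Poly_Mapping.lookup m' i)"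
    by (simp add: lookup_add power_add prod.distrib)
  also have "\<dots> = monomial_value \<sigma> m * monomial_value \<sigma> m'"
    by (simp add: monomial_value_superset[of ?S])
  finally show ?thesis .
qed

text \<open>Evaluation at numbers and substitution of polynomials differ only in how coefficients
  are embedded; the homomorphism laws are proved once for both.\<close>

locale coefficient_hom =
  fixes \<iota> :: "complex \<Rightarrow> 'a::comm_semiring_1"
  assumes \<iota>_0: "\<iota> 0 = 0" and \<iota>_1: "\<iota> 1 = 1"
    and \<iota>_add: "\<iota> (a + b) = \<iota> a + \<iota> b" and \<iota>_mult: "\<iota> (a * b) = \<iota> a * \<iota> b"
begin

lemma insertion_superset:
  assumes "finite S" "Poly_Mapping.keys p \<subseteq> S"
  shows "insertion \<iota> \<sigma> p = (\<Sum>m\<in>S. \<iota> (Poly_Mapping.lookup p m) * monomial_value \<sigma> m)"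
  unfolding insertion_def monomial_value_def[symmetric]
  by (rule sum.mono_neutral_left) (use assms in \<open>auto simp: in_keys_iff \<iota>_0\<close>)

lemma insertion_add: "insertion \<iota> \<sigma> (p + q) = insertion \<iota> \<sigma> p + insertion \<iota> \<sigma> q"
proof -
  let ?S = "Poly_Mapping.keys p \<union> Poly_Mapping.keys q"
  have "insertion \<iota> \<sigma> (p + q) = (\<Sum>m\<in>?S. \<iota> (Poly_Mapping.lookup (p + q) m) * monomial_value \<sigma> m)"
    by (rule insertion_superset) (use Poly_Mapping.keys_add[of p q] in auto)
  also have "\<dots> = (\<Sum>m\<in>?S. \<iota> (Poly_Mapping.lookup p m) * monomial_value \<sigma> m) +
      (\<Sum>m\<in>?S. \<iota> (Poly_Mapping.lookup q m) * monomial_value \<sigma> m)"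
    by (simp add: lookup_add \<iota>_add distrib_right sum.distrib)
  also have "\<dots> = insertion \<iota> \<sigma> p + insertion \<iota> \<sigma> q"
    by (simp add: insertion_superset[of ?S])
  finally show ?thesis .
qed

lemma insertion_zero: "insertion \<iota> \<sigma> 0 = 0"
  by (simp add: insertion_def)

lemma insertion_sum: "insertion \<iota> \<sigma> (sum f A) = (\<Sum>a\<in>A. insertion \<iota> \<sigma> (f a))"
  by (induction A rule: infinite_finite_induct) (auto simp: insertion_zero insertion_add)

lemma insertion_single: "insertion \<iota> \<sigma> (Poly_Mapping.single m c) = \<iota> c * monomial_value \<sigma> m"
  by (simp add: insertion_def monomial_value_def \<iota>_0)

lemma insertion_mult: "insertion \<iota> \<sigma> (p * q) = insertion \<iota> \<sigma> p * insertion \<iota> \<sigma> q"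
proof -
  have "p * q = (\<Sum>m\<in>Poly_Mapping.keys p. \<Sum>m'\<in>Poly_Mapping.keys q.
      Poly_Mapping.single (m + m') (Poly_Mapping.lookup p m * Poly_Mapping.lookup q m'))"
    by (subst (1) poly_mapping_monomials[of p], subst (1) poly_mapping_monomials[of q])
      (simp only: sum_product mult_single)
  then have "insertion \<iota> \<sigma> (p * q) = (\<Sum>m\<in>Poly_Mapping.keys p. \<Sum>m'\<in>Poly_Mapping.keys q.
      (\<iota> (Poly_Mapping.lookup p m) * monomial_value \<sigma> m) * (\<iota> (Poly_Mapping.lookup q m') * monomial_value \<sigma> m'))"
    by (simp only: insertion_sum insertion_single \<iota>_mult monomial_value_add ac_simps)
  then show ?thesis
    by (simp only: insertion_superset[OF finite_keys subset_refl] sum_product)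
qed

lemma insertion_Const: "insertion \<iota> \<sigma> (Const c) = \<iota> c"
  by (simp add: Const_def insertion_single monomial_value_def)

lemma insertion_Var: "insertion \<iota> \<sigma> (Var i) = \<sigma> i"
  by (simp add: Var_def insertion_single monomial_value_def \<iota>_1)

lemma insertion_one: "insertion \<iota> \<sigma> 1 = 1"
  using insertion_Const[of \<sigma> 1] by (simp add: Const_def \<iota>_1)

lemma insertion_prod: "insertion \<iota> \<sigma> (prod f A) = (\<Prod>a\<in>A. insertion \<iota> \<sigma> (f a))"
  by (induction A rule: infinite_finite_induct) (auto simp: insertion_one insertion_mult)

lemma insertion_power: "insertion \<iota> \<sigma> (p ^ k) = insertion \<iota> \<sigma> p ^ k"
  by (induction k) (auto simp: insertion_one insertion_mult)

lemmas insertion_hom = insertion_add insertion_zero insertion_sum insertion_mult insertion_Const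
  insertion_Var insertion_one insertion_prod insertion_power

end

lemma Const_0 [simp]: "Const 0 = 0" and Const_1 [simp]: "Const 1 = 1"
  by (auto simp: Const_def)

lemma Const_add: "Const (a + b) = Const a + Const b" and Const_mult: "Const (a * b) = Const a * Const b"
  by (auto simp: Const_def single_add mult_single)

lemma Const_power: "Const (c ^ k) = Const c ^ k"
  by (induction k) (auto simp: Const_mult)

interpretation evaluation: coefficient_hom "\<lambda>c. c"
  by unfold_locales auto

interpretation substitution: coefficient_hom Const
  by unfold_locales (auto simp: Const_add Const_mult)

lemmas peval_hom = evaluation.insertion_hom[of "\<lambda>i. of_real (x i)" for x, folded peval_def]
lemmas psubst_hom = substitution.insertion_hom[of \<sigma> for \<sigma>, folded psubst_def]

lemma hom_monomial_value:
  assumes "\<And>p q. h (p * q) = h p * h q" "h 1 = 1"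
  shows "h (monomial_value \<sigma> m) = monomial_value (h \<circ> \<sigma>) m"
proof -
  have pow: "h (p ^ k) = h p ^ k" for p k by (induction k) (auto simp: assms)
  have "h (prod f A) = (\<Prod>a\<in>A. h (f a))" for f and A :: "nat set"
    by (induction A rule: infinite_finite_induct) (auto simp: assms)
  then show ?thesis by (simp add: monomial_value_def pow)
qed

lemma peval_insertion: "peval p x = (\<Sum>m\<in>Poly_Mapping.keys p. Poly_Mapping.lookup p m * monomial_value (\<lambda>i. of_real (x i)) m)"
  by (simp add: peval_def insertion_def monomial_value_def)

lemma peval_psubst: "peval (psubst \<tau> p) x = insertion (\<lambda>c. c) (\<lambda>i. peval (\<tau> i) x) p"
proof -
  have "psubst \<tau> p = (\<Sum>m\<in>Poly_Mapping.keys p. Const (Poly_Mapping.lookup p m) * monomial_value \<tau> m)"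
    by (simp add: psubst_def insertion_def monomial_value_def)
  moreover have "peval (monomial_value \<tau> m) x = monomial_value (\<lambda>i. peval (\<tau> i) x) m" for m
    using hom_monomial_value[of "\<lambda>p. peval p x" \<tau> m] by (simp add: peval_hom comp_def)
  ultimately show ?thesis
    by (simp add: peval_hom insertion_def monomial_value_def)
qed

lemma peval_psubst_Var: "peval (psubst (\<lambda>i. Var (\<pi> i)) p) x = peval p (\<lambda>i. x (\<pi> i))"
  by (simp only: peval_psubst peval_hom) (simp add: peval_def)

lemma peval_set_last_zero: "peval (set_last_zero n p) x = peval p (x(n := 0))"
proof -
  have "(\<lambda>i. peval ((Var(n := 0)) i) x) = (\<lambda>i. of_real ((x(n := 0)) i))"
    by (auto simp: fun_eq_iff peval_hom)
  then show ?thesis unfolding set_last_zero_def peval_psubst by (simp add: peval_def)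
qed

section \<open>Supports, and polynomials determined by their values\<close>

definition vars_in :: "nat \<Rightarrow> cpoly \<Rightarrow> bool" where
  "vars_in n p \<longleftrightarrow> (\<forall>m\<in>Poly_Mapping.keys p. Poly_Mapping.keys m \<subseteq> {1..n})"

lemma vars_in_add: "vars_in n p \<Longrightarrow> vars_in n q \<Longrightarrow> vars_in n (p + q)"
  using Poly_Mapping.keys_add[of p q] by (auto simp: vars_in_def)

lemma vars_in_mult:
  assumes "vars_in n p" "vars_in n q"
  shows "vars_in n (p * q)"
  unfolding vars_in_def
proof
  fix m assume "m \<in> Poly_Mapping.keys (p * q)"
  then obtain a b where "m = a + b" "a \<in> Poly_Mapping.keys p" "b \<in> Poly_Mapping.keys q"
    using keys_mult[of p q] by auto
  then show "Poly_Mapping.keys m \<subseteq> {1..n}"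
    using assms Poly_Mapping.keys_add[of a b] unfolding vars_in_def by blast
qed

lemma vars_in_Const: "vars_in n (Const c)"
  by (simp add: vars_in_def Const_def)

lemma vars_in_Var: "i \<in> {1..n} \<Longrightarrow> vars_in n (Var i)"
  by (simp add: vars_in_def Var_def)

lemma vars_in_zero: "vars_in n 0" and vars_in_one: "vars_in n 1"
  using vars_in_Const[of n 0] vars_in_Const[of n 1] by auto

lemma vars_in_sum: "(\<And>a. a \<in> A \<Longrightarrow> vars_in n (f a)) \<Longrightarrow> vars_in n (sum f A)"
  by (induction A rule: infinite_finite_induct) (auto simp: vars_in_zero vars_in_add)

lemma vars_in_prod: "(\<And>a. a \<in> A \<Longrightarrow> vars_in n (f a)) \<Longrightarrow> vars_in n (prod f A)"
  by (induction A rule: infinite_finite_induct) (auto simp: vars_in_one vars_in_mult)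

lemma vars_in_power: "vars_in n p \<Longrightarrow> vars_in n (p ^ k)"
  by (induction k) (auto simp: vars_in_one vars_in_mult)

lemma vars_in_psubst:
  assumes "\<And>i. i \<in> {1..n} \<Longrightarrow> vars_in k (\<tau> i)" "vars_in n p"
  shows "vars_in k (psubst \<tau> p)"
  unfolding psubst_def insertion_def
proof (intro vars_in_sum vars_in_mult vars_in_prod vars_in_power vars_in_Const)
  fix m i assume "m \<in> Poly_Mapping.keys p" "i \<in> Poly_Mapping.keys m"
  then show "vars_in k (\<tau> i)" using assms unfolding vars_in_def[of n] by blast
qed

text \<open>The remainder modulo \<open>B\<close> recovers the digit of index \<open>0\<close>,
  after which the expansion shifts down by one. Exponent vectors will be read off as digit strings
  in this way.\<close>

lemma digits_unique:
  fixes a b :: "nat \<Rightarrow> nat"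
  assumes "\<And>i. i < n \<Longrightarrow> a i < B" "\<And>i. i < n \<Longrightarrow> b i < B"
    and "(\<Sum>i<n. B ^ i * a i) = (\<Sum>i<n. B ^ i * b i)" "i < n"
  shows "a i = b i"
  using assms
proof (induction n arbitrary: a b i)
  case (Suc n)
  have split: "(\<Sum>i<Suc n. B ^ i * c i) = c 0 + B * (\<Sum>i<n. B ^ i * c (Suc i))" for c :: "nat \<Rightarrow> nat"
    by (simp add: sum.lessThan_Suc_shift sum_distrib_left mult.assoc del: sum.lessThan_Suc)
  have eq: "a 0 + B * (\<Sum>i<n. B ^ i * a (Suc i)) = b 0 + B * (\<Sum>i<n. B ^ i * b (Suc i))"
    using Suc.prems(3) by (simp only: split)
  have "a 0 < B" "b 0 < B" using Suc.prems(1,2)[of 0] by auto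
  then have "a 0 = b 0"
    using arg_cong[OF eq, of "\<lambda>x. x mod B"] by simp
  moreover have "B > 0" using \<open>a 0 < B\<close> by simp
  ultimately have "(\<Sum>i<n. B ^ i * a (Suc i)) = (\<Sum>i<n. B ^ i * b (Suc i))"
    using eq by simp
  then have "a (Suc i) = b (Suc i)" if "i < n" for i
    using Suc.IH[of "\<lambda>i. a (Suc i)" "\<lambda>i. b (Suc i)" i] Suc.prems(1,2) that by auto
  then show ?case using \<open>a 0 = b 0\<close> Suc.prems(4) by (cases i) auto
qed simp

text \<open>The substitution \<open>y\<^sub>i = t ^ (B ^ i)\<close> with large \<open>B\<close> maps distinct monomials to distinct powers of \<open>t\<close>.\<close>

lemma peval_eq_0_imp:
  assumes p: "vars_in n p" and zero: "\<And>y. pos_increasing n y \<Longrightarrow> peval p y = 0"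
  shows "p = 0"
proof (rule ccontr)
  assume "p \<noteq> 0"
  then obtain m0 where m0: "m0 \<in> Poly_Mapping.keys p"
    by (metis all_not_in_conv keys_eq_empty)
  define E where "E = (\<Union>m\<in>Poly_Mapping.keys p. Poly_Mapping.lookup m ` {1..n})"
  have "finite E" by (simp add: E_def)
  \<comment> \<open>One successor makes \<open>B\<close> exceed every exponent, so that exponents
    are digits; the second ensures \<open>B \<ge> 2\<close>, so that \<open>t ^ (B ^ i)\<close>
    increases with \<open>i\<close> for \<open>t > 1\<close>. Inserting \<open>0\<close> covers an
    empty \<open>E\<close>.\<close>
  define B where "B = Suc (Suc (Max (insert 0 E)))"
  have B: "Poly_Mapping.lookup m i < B" if "m \<in> Poly_Mapping.keys p" "i \<in> {1..n}" for m i
  proof -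
    have "Poly_Mapping.lookup m i \<in> insert 0 E"
      unfolding E_def using that by blast
    then have "Poly_Mapping.lookup m i \<le> Max (insert 0 E)" using \<open>finite E\<close> by (intro Max_ge) auto
    then show ?thesis by (simp add: B_def)
  qed
  have "0 < B" by (simp add: B_def)
  define N where "N m = (\<Sum>i=1..n. B ^ i * Poly_Mapping.lookup m i)" for m
  have inj: "inj_on N (Poly_Mapping.keys p)"
  proof (rule inj_onI)
    fix m m' assume mm: "m \<in> Poly_Mapping.keys p" "m' \<in> Poly_Mapping.keys p" "N m = N m'"
    have N: "N m = B * (\<Sum>i<n. B ^ i * Poly_Mapping.lookup m (Suc i))" for m
    proof -
      have "N m = (\<Sum>i<n. B ^ Suc i * Poly_Mapping.lookup m (Suc i))"
        unfolding N_def by (rule sum.reindex_bij_witness[of _ Suc "\<lambda>i. i - 1"]) auto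
      then show ?thesis by (simp add: sum_distrib_left mult.assoc)
    qed
    have "(\<Sum>i<n. B ^ i * Poly_Mapping.lookup m (Suc i)) = (\<Sum>i<n. B ^ i * Poly_Mapping.lookup m' (Suc i))"
      using mm(3) \<open>0 < B\<close> unfolding N by simp
    then have eq: "Poly_Mapping.lookup m (Suc i) = Poly_Mapping.lookup m' (Suc i)" if "i < n" for i
      using digits_unique[of n "\<lambda>i. Poly_Mapping.lookup m (Suc i)" B "\<lambda>i. Poly_Mapping.lookup m' (Suc i)" i]
        B[OF mm(1)] B[OF mm(2)] that by auto
    show "m = m'"
    proof (rule poly_mapping_eqI)
      fix i
      show "Poly_Mapping.lookup m i = Poly_Mapping.lookup m' i"
      proof (cases "i \<in> {1..n}")
        case True
        then show ?thesis using eq[of "i - 1"] by auto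
      next
        case False
        then show ?thesis using p mm(1,2) unfolding vars_in_def
          by (metis in_keys_iff subsetD)
      qed
    qed
  qed
  define P where "P = (\<Sum>m\<in>Poly_Mapping.keys p. Polynomial.monom (Poly_Mapping.lookup p m) (N m))"
  have "poly P (of_real t) = 0" if "t > 1" for t :: real
  proof -
    define y where "y i = t ^ (B ^ i)" for i
    have "pos_increasing n y"
      unfolding pos_increasing_def strict_mono_on_def monotone_on_def y_def
      using that by (auto intro!: power_strict_increasing simp: B_def)
    have "poly P (of_real t) = (\<Sum>m\<in>Poly_Mapping.keys p. Poly_Mapping.lookup p m * of_real t ^ N m)"
      by (simp add: P_def poly_sum poly_monom)
    also have "\<dots> = peval p y"
      unfolding peval_insertion
    proof (rule sum.cong[OF refl])
      fix m assume "m \<in> Poly_Mapping.keys p"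
      then have "monomial_value (\<lambda>i. complex_of_real (y i)) m = (\<Prod>i\<in>{1..n}. of_real (y i) ^ Poly_Mapping.lookup m i)"
        using p by (intro monomial_value_superset) (auto simp: vars_in_def)
      also have "\<dots> = of_real t ^ N m"
        by (simp add: y_def N_def power_mult[symmetric] power_sum)
      finally show "Poly_Mapping.lookup p m * of_real t ^ N m =
          Poly_Mapping.lookup p m * monomial_value (\<lambda>i. complex_of_real (y i)) m" by simp
    qed
    also have "\<dots> = 0" by (rule zero) fact
    finally show ?thesis .
  qed
  then have "of_real ` {1<..} \<subseteq> {z. poly P z = 0}" by auto
  moreover have "infinite (complex_of_real ` {1<..})"
    using infinite_Ioi[of "1::real"] by (simp add: finite_image_iff inj_on_def)
  ultimately have "P = 0" using poly_roots_finite finite_subset by blast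
  have "coeff P (N m0) = (\<Sum>m\<in>Poly_Mapping.keys p. if m = m0 then Poly_Mapping.lookup p m else 0)"
    unfolding P_def coeff_sum using inj m0 by (intro sum.cong) (auto simp: inj_on_eq_iff)
  also have "\<dots> = Poly_Mapping.lookup p m0" using m0 by simp
  finally show False using \<open>P = 0\<close> m0 by (simp add: in_keys_iff)
qed

lemma peval_eqI:
  assumes "vars_in n p" "vars_in n q" "\<And>y. pos_increasing n y \<Longrightarrow> peval p y = peval q y"
  shows "p = q"
proof -
  have "p + Const (-1) * q = 0"
    using assms by (intro peval_eq_0_imp[of n] vars_in_add vars_in_mult vars_in_Const)
      (simp_all add: peval_hom)
  moreover have "Const (-1) * q = - q" by (simp add: Const_def single_uminus)
  ultimately show ?thesis by simp
qed

lemma sym_polys_iff: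
  "p \<in> sym_polys n \<longleftrightarrow> vars_in n p \<and> (\<forall>\<pi>. \<pi> permutes {1..n} \<longrightarrow> psubst (\<lambda>i. Var (\<pi> i)) p = p)"
  by (simp add: sym_polys_def vars_in_def)

lemma sym_polys_add: "p \<in> sym_polys n \<Longrightarrow> q \<in> sym_polys n \<Longrightarrow> p + q \<in> sym_polys n"
  by (simp add: sym_polys_iff vars_in_add psubst_hom)

lemma sym_polys_mult: "p \<in> sym_polys n \<Longrightarrow> q \<in> sym_polys n \<Longrightarrow> p * q \<in> sym_polys n"
  by (simp add: sym_polys_iff vars_in_mult psubst_hom)

lemma sym_polys_Const: "Const c \<in> sym_polys n"
  by (simp add: sym_polys_iff vars_in_Const psubst_hom)

section \<open>Power sums generate the symmetric polynomials\<close>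

definition power_sum :: "nat \<Rightarrow> nat \<Rightarrow> cpoly" where
  "power_sum n a = (\<Sum>k=1..n. Var k ^ a)"

lemma sym_polys_power_sum: "power_sum n a \<in> sym_polys n"
proof -
  have "vars_in n (power_sum n a)"
    unfolding power_sum_def by (intro vars_in_sum vars_in_power vars_in_Var)
  moreover have "(\<Sum>k=1..n. Var (\<pi> k) ^ a) = (\<Sum>k=1..n. Var k ^ a)" if "\<pi> permutes {1..n}" for \<pi>
    using sum.permute[OF that, of "\<lambda>k. Var k ^ a"] by (simp add: comp_def)
  ultimately show ?thesis by (simp add: sym_polys_iff power_sum_def psubst_hom)
qed

definition injections :: "nat \<Rightarrow> nat set \<Rightarrow> (nat \<Rightarrow> nat) set" where
  "injections n A = {f \<in> A \<rightarrow>\<^sub>E {1..n}. inj_on f A}"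

text \<open>An augmented monomial symmetric polynomial. The index set is arbitrary so that it can
  shrink in an induction.\<close>

definition injection_sum :: "nat \<Rightarrow> nat set \<Rightarrow> (nat \<Rightarrow> nat) \<Rightarrow> cpoly" where
  "injection_sum n A a = (\<Sum>f\<in>injections n A. \<Prod>i\<in>A. Var (f i) ^ a i)"

lemma finite_injections: "finite A \<Longrightarrow> finite (injections n A)"
  unfolding injections_def by (rule finite_subset[of _ "A \<rightarrow>\<^sub>E {1..n}"]) (auto intro: finite_PiE)

text \<open>Letting the index \<open>j\<close> go to any variable gives the product with a power
  sum. The surplus terms, in which \<open>j\<close> meets the variable of some \<open>l\<close>, are
  sums over injections of \<open>A\<close> with the exponents of \<open>j\<close> and
  \<open>l\<close> added.\<close>

lemma injection_sum_insert:
  assumes A: "finite A" "j \<notin> A"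
  shows "injection_sum n (insert j A) a = power_sum n (a j) * injection_sum n A a -
     (\<Sum>l\<in>A. injection_sum n A (a(l := a l + a j)))"
proof -
  let ?m = "\<lambda>f. \<Prod>i\<in>A. Var (f i) ^ a i"
  have "injection_sum n (insert j A) a =
      (\<Sum>(f, k)\<in>(SIGMA f:injections n A. {1..n} - f ` A). Var k ^ a j * ?m f)"
    unfolding injection_sum_def
  proof (rule sum.reindex_bij_witness[of _ "\<lambda>(f, k). f(j := k)" "\<lambda>f. (restrict f A, f j)"], goal_cases)
    case (1 f)
    then show ?case using A by (auto simp: injections_def fun_eq_iff PiE_def extensional_def)
  next
    case (2 f)
    then show ?case using A
      by (auto simp: injections_def PiE_def Pi_def inj_on_def)
  next
    case (3 p)
    then show ?case using A
      by (auto simp: injections_def fun_eq_iff PiE_def extensional_def)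
  next
    case (4 p)
    then obtain f k where p: "p = (f, k)" "f \<in> A \<rightarrow>\<^sub>E {1..n}" "inj_on f A" "k \<in> {1..n}" "k \<notin> f ` A"
      by (auto simp: injections_def)
    have "(f(j := k)) ` A = f ` A" using A by (intro image_cong) auto
    then have "inj_on (f(j := k)) (insert j A)"
      using p A by (simp add: inj_on_insert inj_on_fun_updI)
    moreover have "f(j := k) \<in> insert j A \<rightarrow>\<^sub>E {1..n}"
      using p by (intro PiE_fun_upd) auto
    ultimately show ?case by (simp add: p(1) injections_def)
  next
    case (5 f)
    then show ?case using A by simp
  qed
  also have "\<dots> = (\<Sum>f\<in>injections n A. \<Sum>k\<in>{1..n} - f ` A. Var k ^ a j * ?m f)"
    using finite_injections[OF A(1)] by (subst sum.Sigma) auto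
  also have "\<dots> = (\<Sum>f\<in>injections n A. power_sum n (a j) * ?m f - (\<Sum>l\<in>A. Var (f l) ^ a j * ?m f))"
  proof (rule sum.cong[OF refl])
    fix f assume "f \<in> injections n A"
    then have f: "f ` A \<subseteq> {1..n}" "inj_on f A" by (auto simp: injections_def)
    have "(\<Sum>k\<in>{1..n} - f ` A. Var k ^ a j) = power_sum n (a j) - (\<Sum>k\<in>f ` A. Var k ^ a j)"
      unfolding power_sum_def using f(1) by (intro sum_diff) auto
    also have "(\<Sum>k\<in>f ` A. Var k ^ a j) = (\<Sum>l\<in>A. Var (f l) ^ a j)"
      using f(2) by (simp add: sum.reindex)
    finally have "(\<Sum>k\<in>{1..n} - f ` A. Var k ^ a j) * ?m f =
        (power_sum n (a j) - (\<Sum>l\<in>A. Var (f l) ^ a j)) * ?m f" by simp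
    then show "(\<Sum>k\<in>{1..n} - f ` A. Var k ^ a j * ?m f) =
       power_sum n (a j) * ?m f - (\<Sum>l\<in>A. Var (f l) ^ a j * ?m f)"
      by (simp only: left_diff_distrib sum_distrib_right)
  qed
  also have "\<dots> = power_sum n (a j) * injection_sum n A a -
      (\<Sum>l\<in>A. \<Sum>f\<in>injections n A. Var (f l) ^ a j * ?m f)"
    by (simp only: sum_subtractf sum_distrib_left injection_sum_def sum.swap[of _ A])
  also have "(\<Sum>l\<in>A. \<Sum>f\<in>injections n A. Var (f l) ^ a j * ?m f) =
      (\<Sum>l\<in>A. injection_sum n A (a(l := a l + a j)))"
    unfolding injection_sum_def
  proof (intro sum.cong refl)
    fix l f assume l: "l \<in> A"
    have "(\<Prod>i\<in>A - {l}. Var (f i) ^ (a(l := a l + a j)) i) = (\<Prod>i\<in>A - {l}. Var (f i) ^ a i)"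
      by (intro prod.cong) auto
    then show "Var (f l) ^ a j * ?m f = (\<Prod>i\<in>A. Var (f i) ^ (a(l := a l + a j)) i)"
      using A(1) l by (simp add: prod.remove[of A l] power_add mult_ac)
  qed
  finally show ?thesis .
qed

text \<open>Symmetrisation writes \<open>fact n\<close> times \<open>p\<close> as a combination of
  the sums \<open>injection_sum n {1..n}\<close>, and \<open>injection_sum_insert\<close> reduces
  these to power sums. The case of power sums is restricted to positive exponents because exponent
  \<open>0\<close> counts the variables, which would spoil the compatibility with
  \<open>set_last_zero\<close>.\<close>

lemma sym_polys_induct [consumes 1, case_names Const power_sum add mult]:
  assumes "p \<in> sym_polys n"
    and Const: "\<And>c. P (Const c)" and power_sum: "\<And>a. 0 < a \<Longrightarrow> P (power_sum n a)"
    and add: "\<And>p q. P p \<Longrightarrow> P q \<Longrightarrow> P (p + q)" and mult: "\<And>p q. P p \<Longrightarrow> P q \<Longrightarrow> P (p * q)"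
  shows "P p"
proof -
  have zero: "P 0" using Const[of 0] by simp
  have sum: "P (sum f A)" if "\<And>a. a \<in> A \<Longrightarrow> P (f a)" for f and A :: "'b set"
    using that by (induction A rule: infinite_finite_induct) (auto simp: zero add)
  have diff: "P (q - r)" if "P q" "P r" for q r
  proof -
    have eq: "q - r = q + Const (-1) * r"
      by (simp add: Const_def single_uminus)
    show ?thesis unfolding eq using that by (intro add mult Const)
  qed
  \<comment> \<open>The power sum of exponent \<open>0\<close> is the constant
    \<open>n\<close>.\<close>
  have power_sum: "P (power_sum n a)" for a
  proof (cases "a = 0")
    case True
    then have "power_sum n a = Const (of_nat n)" by (simp add: power_sum_def Const_def)
    then show ?thesis using Const by simp
  qed (use power_sum in auto)
  have inj: "P (injection_sum n A a)" if "finite A" for A a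
    using that
  proof (induction A arbitrary: a rule: finite_induct)
    case empty
    have "injections n {} = {\<lambda>_. undefined}" by (auto simp: injections_def)
    then show ?case using Const[of 1] by (simp add: injection_sum_def)
  next
    case (insert j A)
    show ?case
      unfolding injection_sum_insert[OF insert.hyps]
      by (intro diff mult power_sum sum insert.IH)
  qed
  let ?A = "{1..n}"
  have p: "vars_in n p" "\<And>\<pi>. \<pi> permutes ?A \<Longrightarrow> psubst (\<lambda>i. Var (\<pi> i)) p = p"
    using assms(1) by (auto simp: sym_polys_iff)
  \<comment> \<open>An injection of \<open>{1..n}\<close> into itself is a permutation, up to the
    values outside, which are \<open>undefined\<close> for the one and fixed points for the
    other.\<close>
  have orbit: "(\<Sum>\<pi> | \<pi> permutes ?A. \<Prod>i\<in>?A. Var (\<pi> i) ^ a i) = injection_sum n ?A a" for a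
    unfolding injection_sum_def
  proof (rule sum.reindex_bij_witness[of _ "\<lambda>f i. if i \<in> ?A then f i else i" "\<lambda>\<pi>. restrict \<pi> ?A"], goal_cases)
    case (1 \<pi>)
    then show ?case by (auto simp: fun_eq_iff permutes_def)
  next
    case (2 \<pi>)
    then have "\<pi> permutes ?A" by simp
    then have "inj_on \<pi> ?A" "\<pi> ` ?A = ?A"
      using permutes_inj_on permutes_image by blast+
    then show ?case by (auto simp: injections_def inj_on_restrict_eq)
  next
    case (3 f)
    then show ?case by (auto simp: injections_def PiE_def extensional_def fun_eq_iff)
  next
    case (4 f)
    then have "inj_on f ?A" "f ` ?A \<subseteq> ?A" by (auto simp: injections_def)
    then have "f ` ?A = ?A" by (intro endo_inj_surj) auto
    then have "bij_betw f ?A ?A" using \<open>inj_on f ?A\<close> by (simp add: bij_betw_def)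
    then have "bij_betw (\<lambda>i. if i \<in> ?A then f i else i) ?A ?A"
      by (subst bij_betw_cong[of _ _ f]) auto
    then show ?case by (intro CollectI bij_imp_permutes) auto
  next
    case (5 \<pi>)
    then show ?case by (intro prod.cong) auto
  qed
  have fact: "of_nat (fact n) * p = (\<Sum>m\<in>Poly_Mapping.keys p. Const (Poly_Mapping.lookup p m) *
      injection_sum n ?A (Poly_Mapping.lookup m))"
  proof -
    have "of_nat (fact n) * p = (\<Sum>\<pi> | \<pi> permutes ?A. p)"
      using card_permutations[of ?A n] by simp
    also have "\<dots> = (\<Sum>\<pi> | \<pi> permutes ?A. \<Sum>m\<in>Poly_Mapping.keys p. Const (Poly_Mapping.lookup p m) *
       (\<Prod>i\<in>?A. Var (\<pi> i) ^ Poly_Mapping.lookup m i))"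
    proof (rule sum.cong[OF refl])
      fix \<pi> assume "\<pi> \<in> {\<pi>. \<pi> permutes ?A}"
      then have "p = psubst (\<lambda>i. Var (\<pi> i)) p" using p(2) by simp
      also have "\<dots> = (\<Sum>m\<in>Poly_Mapping.keys p. Const (Poly_Mapping.lookup p m) * monomial_value (\<lambda>i. Var (\<pi> i)) m)"
        by (simp add: psubst_def insertion_def monomial_value_def)
      also have "\<dots> = (\<Sum>m\<in>Poly_Mapping.keys p. Const (Poly_Mapping.lookup p m) *
          (\<Prod>i\<in>?A. Var (\<pi> i) ^ Poly_Mapping.lookup m i))"
        using p(1) unfolding vars_in_def
        by (intro sum.cong refl arg_cong2[of _ _ _ _ "(*)"] monomial_value_superset) auto
      finally show "p = \<dots>" .
    qed
    also have "\<dots> = (\<Sum>m\<in>Poly_Mapping.keys p. \<Sum>\<pi> | \<pi> permutes ?A. Const (Poly_Mapping.lookup p m) *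
       (\<Prod>i\<in>?A. Var (\<pi> i) ^ Poly_Mapping.lookup m i))"
      by (rule sum.swap)
    finally show ?thesis by (simp only: sum_distrib_left[symmetric] orbit)
  qed
  have "p = Const (1 / of_nat (fact n)) * (of_nat (fact n) * p)"
  proof -
    have "of_nat k = Const (of_nat k)" for k by (simp add: Const_def)
    then have "Const (1 / of_nat (fact n)) * of_nat (fact n) = Const (1 / of_nat (fact n) * of_nat (fact n))"
      by (simp only: Const_mult)
    also have "\<dots> = 1" by simp
    finally show ?thesis by (simp only: mult.assoc[symmetric] mult_1)
  qed
  also have "P \<dots>" unfolding fact by (intro mult Const sum inj) auto
  finally show ?thesis .
qed

lemma set_last_zero_sym_polys:
  assumes "p \<in> sym_polys n"
  shows "set_last_zero n p \<in> sym_polys (n - 1)"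
  using assms
proof (induction rule: sym_polys_induct)
  case (power_sum a)
  have "set_last_zero n (power_sum n a) = power_sum (n - 1) a"
  proof (cases n)
    case (Suc k)
    then show ?thesis using power_sum by (simp add: power_sum_def set_last_zero_def psubst_hom)
  qed (simp add: power_sum_def set_last_zero_def psubst_hom)
  then show ?case by (simp add: sym_polys_power_sum)
qed (auto simp: set_last_zero_def psubst_hom intro: sym_polys_Const sym_polys_add sym_polys_mult)

text \<open>The image is closed under sums and products and contains the constants and, as images of
  power sums with one more term, the generating power sums.\<close>

lemma set_last_zero_surj:
  assumes "p \<in> sym_polys (n - 1)"
  shows "\<exists>q\<in>sym_polys n. set_last_zero n q = p"
  using assms
proof (induction rule: sym_polys_induct)
  case (Const c)
  show ?case by (intro bexI[of _ "Const c"] sym_polys_Const) (simp add: set_last_zero_def psubst_hom)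
next
  case (power_sum a)
  have "set_last_zero n (power_sum n a) = power_sum (n - 1) a"
  proof (cases n)
    case (Suc k)
    then show ?thesis using power_sum by (simp add: power_sum_def set_last_zero_def psubst_hom)
  qed (simp add: power_sum_def set_last_zero_def psubst_hom)
  then show ?case using sym_polys_power_sum by blast
next
  case (add p q)
  then show ?case by (metis sym_polys_add set_last_zero_def psubst_hom(1))
next
  case (mult p q)
  then show ?case by (metis sym_polys_mult set_last_zero_def psubst_hom(4))
qed

subsection \<open>Dirichlet averages of polynomial families\<close>

type_synonym family = "(nat \<Rightarrow> real) \<Rightarrow> complex \<Rightarrow> (nat \<Rightarrow> real) \<Rightarrow> complex"

text \<open>Closing the monomials under sums alone lets the integral over \<open>\<eta>\<close> be
  taken term by term through moments; closure under products is derived.\<close>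

inductive poly_fun :: "nat \<Rightarrow> family \<Rightarrow> bool" for n where
  monomial: "vars_in n c \<Longrightarrow> poly_fun n (\<lambda>\<eta> z y. of_real (\<Prod>i=1..n. \<eta> i ^ a i) * (z ^ k * peval c y))"
| add: "poly_fun n F \<Longrightarrow> poly_fun n G \<Longrightarrow> poly_fun n (\<lambda>\<eta> z y. F \<eta> z y + G \<eta> z y)"

lemma poly_fun_mult:
  assumes "poly_fun n F" "poly_fun n G"
  shows "poly_fun n (\<lambda>\<eta> z y. F \<eta> z y * G \<eta> z y)"
  using assms
proof (induction F rule: poly_fun.induct)
  case (monomial c a k)
  from monomial(2) show ?case
  proof (induction G rule: poly_fun.induct)
    case (monomial c' a' k')
    have "poly_fun n (\<lambda>\<eta> z y. of_real (\<Prod>i=1..n. \<eta> i ^ (a i + a' i)) * (z ^ (k + k') * peval (c * c') y))"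
      using \<open>vars_in n c\<close> monomial by (intro poly_fun.monomial vars_in_mult)
    then show ?case by (simp add: power_add prod.distrib peval_hom mult_ac)
  next
    case (add F G)
    then show ?case using poly_fun.add by (simp add: distrib_left)
  qed
next
  case (add F F')
  then show ?case using poly_fun.add by (simp add: distrib_right)
qed

lemma poly_fun_peval: "vars_in n c \<Longrightarrow> poly_fun n (\<lambda>\<eta> z y. peval c y)"
  using poly_fun.monomial[of n c "\<lambda>_. 0" 0] by simp

lemma poly_fun_const: "poly_fun n (\<lambda>\<eta> z y. c)"
  using poly_fun_peval[OF vars_in_Const, of n c] by (simp add: peval_hom)

lemma poly_fun_param: "poly_fun n (\<lambda>\<eta> z y. z)"
  using poly_fun.monomial[OF vars_in_one, of n "\<lambda>_. 0" 1] by (simp add: peval_hom)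

lemma poly_fun_y: "i \<in> {1..n} \<Longrightarrow> poly_fun n (\<lambda>\<eta> z y. of_real (y i))"
  using poly_fun_peval[OF vars_in_Var, of i n] by (simp add: peval_hom)

lemma poly_fun_eta:
  assumes "i \<in> {1..n}"
  shows "poly_fun n (\<lambda>\<eta> z y. of_real (\<eta> i))"
proof -
  have "(\<Prod>j=1..n. \<eta> j ^ (if j = i then 1 else 0)) = \<eta> i" for \<eta> :: "nat \<Rightarrow> real"
  proof -
    have "(\<Prod>j=1..n. \<eta> j ^ (if j = i then 1 else 0)) = (\<Prod>j=1..n. if j = i then \<eta> j else 1)"
      by (intro prod.cong) auto
    then show ?thesis using assms by simp
  qed
  then show ?thesis
    using poly_fun.monomial[OF vars_in_one, of n "\<lambda>j. if j = i then 1 else 0" 0] by (simp add: peval_hom)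
qed

lemma poly_fun_sum: "(\<And>a. a \<in> A \<Longrightarrow> poly_fun n (F a)) \<Longrightarrow> poly_fun n (\<lambda>\<eta> z y. \<Sum>a\<in>A. F a \<eta> z y)"
proof (induction A rule: infinite_finite_induct)
  case (insert a A)
  then show ?case using poly_fun.add[of n "F a" "\<lambda>\<eta> z y. \<Sum>a\<in>A. F a \<eta> z y"] by simp
qed (auto simp: poly_fun_const)

lemma poly_fun_uminus: "poly_fun n F \<Longrightarrow> poly_fun n (\<lambda>\<eta> z y. - F \<eta> z y)"
  using poly_fun_mult[OF poly_fun_const, of n F "-1"] by simp

definition coeffs_poly_fun :: "nat \<Rightarrow> ((nat \<Rightarrow> real) \<Rightarrow> complex \<Rightarrow> (nat \<Rightarrow> real) \<Rightarrow> complex poly) \<Rightarrow> bool" where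
  "coeffs_poly_fun n P \<longleftrightarrow> (\<forall>r. poly_fun n (\<lambda>\<eta> z y. coeff (P \<eta> z y) r))"

lemma coeffs_poly_fun_mult:
  "coeffs_poly_fun n P \<Longrightarrow> coeffs_poly_fun n Q \<Longrightarrow> coeffs_poly_fun n (\<lambda>\<eta> z y. P \<eta> z y * Q \<eta> z y)"
  unfolding coeffs_poly_fun_def coeff_mult by (intro allI poly_fun_sum poly_fun_mult) auto

lemma coeffs_poly_fun_sum:
  "(\<And>a. a \<in> A \<Longrightarrow> coeffs_poly_fun n (P a)) \<Longrightarrow> coeffs_poly_fun n (\<lambda>\<eta> z y. \<Sum>a\<in>A. P a \<eta> z y)"
  unfolding coeffs_poly_fun_def coeff_sum by (intro allI poly_fun_sum) auto

lemma coeffs_poly_fun_linear: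
  assumes "poly_fun n F" "poly_fun n G"
  shows "coeffs_poly_fun n (\<lambda>\<eta> z y. [:F \<eta> z y, G \<eta> z y:])"
  unfolding coeffs_poly_fun_def
proof
  fix r
  show "poly_fun n (\<lambda>\<eta> z y. coeff [:F \<eta> z y, G \<eta> z y:] r)"
  proof (cases r)
    case (Suc s)
    then show ?thesis using assms by (cases s) (auto simp: poly_fun_const)
  qed (use assms in simp)
qed

lemma coeffs_poly_fun_prod:
  "(\<And>a. a \<in> A \<Longrightarrow> coeffs_poly_fun n (P a)) \<Longrightarrow> coeffs_poly_fun n (\<lambda>\<eta> z y. \<Prod>a\<in>A. P a \<eta> z y)"
proof (induction A rule: infinite_finite_induct)
  case (insert a A)
  then show ?case using coeffs_poly_fun_mult[of n "P a" "\<lambda>\<eta> z y. \<Prod>a\<in>A. P a \<eta> z y"] by simp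
qed (auto simp: coeffs_poly_fun_def poly_fun_const)

text \<open>The reversed polynomial \<open>t\<^sup>n q(1 / t)\<close> of \<open>q(t) = \<Sum>\<^sub>i \<eta>\<^sub>i (t - z y\<^sub>i) \<Prod>\<^sub>k\<^sub>\<noteq>\<^sub>i (t - y\<^sub>k)\<close>.\<close>

definition pencil :: "nat \<Rightarrow> (nat \<Rightarrow> real) \<Rightarrow> complex \<Rightarrow> (nat \<Rightarrow> real) \<Rightarrow> complex poly" where
  "pencil n \<eta> z y = (\<Sum>i=1..n. [:of_real (\<eta> i), - of_real (\<eta> i) * (z * of_real (y i)):] *
     (\<Prod>k\<in>{1..n} - {i}. [:1, - of_real (y k):]))"

lemma coeffs_poly_fun_pencil: "coeffs_poly_fun n (pencil n)"
  unfolding pencil_def [abs_def]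
  by (intro coeffs_poly_fun_sum coeffs_poly_fun_mult coeffs_poly_fun_linear coeffs_poly_fun_prod
      poly_fun_mult poly_fun_uminus poly_fun_const poly_fun_eta poly_fun_y poly_fun_param) auto

definition jointly_symmetric :: "nat \<Rightarrow> family \<Rightarrow> bool" where
  "jointly_symmetric n F \<longleftrightarrow> (\<forall>\<pi> \<eta> z y. \<pi> permutes {1..n} \<longrightarrow> F (\<eta> \<circ> \<pi>) z (y \<circ> \<pi>) = F \<eta> z y)"

lemma pencil_permute:
  assumes "\<pi> permutes {1..n}"
  shows "pencil n (\<eta> \<circ> \<pi>) z (y \<circ> \<pi>) = pencil n \<eta> z y"
proof -
  let ?f = "\<lambda>i. [:of_real (\<eta> i), - of_real (\<eta> i) * (z * of_real (y i)):] *
     (\<Prod>k\<in>{1..n} - {i}. [:1, - complex_of_real (y k):])"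
  have "(\<Prod>k\<in>{1..n} - {i}. [:1, - complex_of_real (y (\<pi> k)):]) = (\<Prod>k\<in>{1..n} - {\<pi> i}. [:1, - complex_of_real (y k):])"
    if "i \<in> {1..n}" for i
  proof (rule prod.reindex_bij_betw)
    show "bij_betw \<pi> ({1..n} - {i}) ({1..n} - {\<pi> i})"
      unfolding bij_betw_def
      using permutes_inj[OF assms] permutes_image[OF assms] inj_on_subset[OF permutes_inj[OF assms] subset_UNIV]
      by (simp add: image_set_diff)
  qed
  then have "pencil n (\<eta> \<circ> \<pi>) z (y \<circ> \<pi>) = (\<Sum>i=1..n. ?f (\<pi> i))"
    unfolding pencil_def by (intro sum.cong) auto
  also have "\<dots> = (\<Sum>i=1..n. ?f i)"
    using sum.permute[OF assms, of ?f] by (simp add: comp_def)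
  finally show ?thesis by (simp add: pencil_def)
qed

text \<open>Logarithmic derivative: each factor \<open>1 - X k * t\<close> contributes
  \<open>- X k / (1 - X k * t)\<close>, whose expansion is a geometric series.\<close>

lemma newton_fps:
  fixes X :: "nat \<Rightarrow> complex"
  assumes "finite A"
  shows "fps_deriv (fps_of_poly (\<Prod>k\<in>A. [:1, - X k:])) =
    - fps_of_poly (\<Prod>k\<in>A. [:1, - X k:]) * Abs_fps (\<lambda>a. \<Sum>k\<in>A. X k ^ Suc a)"
  using assms
proof (induction A rule: finite_induct)
  case empty
  then show ?case by (simp add: fps_eq_iff)
next
  case (insert j A)
  let ?E = "fps_of_poly (\<Prod>k\<in>A. [:1, - X k:])" and ?L = "1 - fps_const (X j) * fps_X"
  let ?P = "Abs_fps (\<lambda>a. \<Sum>k\<in>A. X k ^ Suc a)" and ?G = "Abs_fps (\<lambda>a. X j ^ Suc a)"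
  have L: "fps_of_poly [:1, - X j:] = ?L"
    by (simp add: fps_of_poly_pCons fps_const_neg[symmetric] mult.commute del: fps_const_neg)
  have G: "?L * ?G = fps_const (X j)"
  proof (rule fps_ext)
    fix r show "fps_nth (?L * ?G) r = fps_nth (fps_const (X j)) r"
      by (cases r) (simp_all add: left_diff_distrib mult.assoc)
  qed
  have E: "fps_of_poly (\<Prod>k\<in>insert j A. [:1, - X k:]) = ?L * ?E"
    unfolding prod.insert[OF insert.hyps] fps_of_poly_mult L ..
  have P: "Abs_fps (\<lambda>a. \<Sum>k\<in>insert j A. X k ^ Suc a) = ?G + ?P"
    using insert.hyps by (simp add: fps_eq_iff)
  have "fps_deriv (?L * ?E) = - (?L * ?G) * ?E + ?L * (- ?E * ?P)"
    unfolding G fps_deriv_mult insert.IH by (simp add: algebra_simps)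
  also have "\<dots> = - (?L * ?E) * (?G + ?P)" by (simp add: algebra_simps)
  finally show ?case unfolding E P .
qed

text \<open>The coefficient of \<open>t ^ a\<close> in \<open>newton_fps\<close>, solved for the
  highest power sum by means of \<open>e 0 = 1\<close>. The \<open>e r\<close> are the elementary
  symmetric functions with signs \<open>(-1) ^ r\<close>.\<close>

lemma newton_identity:
  fixes X :: "nat \<Rightarrow> complex"
  assumes "finite A"
  defines "e \<equiv> coeff (\<Prod>k\<in>A. [:1, - X k:])"
  shows "(\<Sum>k\<in>A. X k ^ Suc a) = - (of_nat (Suc a) * e (Suc a)) - (\<Sum>b<a. e (a - b) * (\<Sum>k\<in>A. X k ^ Suc b))"
proof -
  let ?E = "\<Prod>k\<in>A. [:1, - X k:]"
  have e0: "e 0 = 1"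
    using poly_0_coeff_0[of ?E] by (simp add: e_def poly_prod)
  have "of_nat (Suc a) * e (Suc a) = fps_nth (fps_deriv (fps_of_poly ?E)) a"
    by (simp add: e_def)
  also have "\<dots> = - (\<Sum>b\<le>a. e (a - b) * (\<Sum>k\<in>A. X k ^ Suc b))"
  proof -
    let ?P = "Abs_fps (\<lambda>a. \<Sum>k\<in>A. X k ^ Suc a)"
    have "- fps_of_poly ?E * ?P = - (?P * fps_of_poly ?E)" by (simp add: mult.commute)
    then have "fps_nth (fps_deriv (fps_of_poly ?E)) a = - (\<Sum>b\<le>a. (\<Sum>k\<in>A. X k ^ Suc b) * e (a - b))"
      unfolding newton_fps[OF assms(1)] e_def
      by (simp only: fps_neg_nth fps_mult_nth atLeast0AtMost fps_nth_Abs_fps fps_of_poly_nth)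
    then show ?thesis by (simp only: mult.commute)
  qed
  also have "(\<Sum>b\<le>a. e (a - b) * (\<Sum>k\<in>A. X k ^ Suc b)) =
      (\<Sum>b<a. e (a - b) * (\<Sum>k\<in>A. X k ^ Suc b)) + (\<Sum>k\<in>A. X k ^ Suc a)"
    by (simp add: lessThan_Suc_atMost[symmetric] e0)
  finally show ?thesis by simp
qed

text \<open>The values \<open>X k\<close> enter through their reversed polynomial and are never
  extracted as roots. A vanishing \<open>X k\<close> contributes the factor \<open>1\<close>, so
  \<open>z = 0\<close> fits the same formula.\<close>

definition represents :: "nat \<Rightarrow> cpoly \<Rightarrow> family \<Rightarrow> bool" where
  "represents n p F \<longleftrightarrow> (\<forall>\<eta> z y X. (\<Prod>k=1..n. [:1, - of_real (X k):]) = pencil n \<eta> z y \<longrightarrow>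
     peval p X = F \<eta> z y)"

text \<open>Newton's identities give the power sums recursively in terms of the coefficients of
  \<open>pencil\<close>, which are polynomial families with the joint symmetry.\<close>

lemma power_sum_represents:
  "\<exists>F. poly_fun n F \<and> jointly_symmetric n F \<and> represents n (power_sum n (Suc a)) F"
proof (induction a rule: less_induct)
  case (less a)
  then obtain F where F: "\<And>b. b < a \<Longrightarrow> poly_fun n (F b) \<and> jointly_symmetric n (F b) \<and>
      represents n (power_sum n (Suc b)) (F b)" by metis
  define e where "e r \<eta> z y = coeff (pencil n \<eta> z y) r" for r \<eta> z y
  have e: "poly_fun n (e r)" for r
    using coeffs_poly_fun_pencil[of n] unfolding coeffs_poly_fun_def e_def by blast
  have e_sym: "jointly_symmetric n (e r)" for r
    by (simp add: jointly_symmetric_def e_def pencil_permute)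
  let ?F = "\<lambda>\<eta> z y. - (of_nat (Suc a) * e (Suc a) \<eta> z y) + - (\<Sum>b<a. e (a - b) \<eta> z y * F b \<eta> z y)"
  have "poly_fun n ?F"
    using F by (intro poly_fun.add poly_fun_uminus poly_fun_mult poly_fun_const poly_fun_sum e) auto
  moreover have "jointly_symmetric n ?F"
    using F e_sym unfolding jointly_symmetric_def by (auto intro!: sum.cong arg_cong2[of _ _ _ _ "(+)"])
  moreover have "represents n (power_sum n (Suc a)) ?F"
    unfolding represents_def
  proof (intro allI impI)
    fix \<eta> z y X assume X: "(\<Prod>k=1..n. [:1, - complex_of_real (X k):]) = pencil n \<eta> z y"
    have ps: "peval (power_sum n b) X = (\<Sum>k=1..n. of_real (X k) ^ b)" for b
      by (simp add: power_sum_def peval_hom)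
    have "F b \<eta> z y = (\<Sum>k=1..n. of_real (X k) ^ Suc b)" if "b < a" for b
      using F[OF that] X unfolding represents_def ps[symmetric] by metis
    then show "peval (power_sum n (Suc a)) X = ?F \<eta> z y"
      unfolding ps using newton_identity[of "{1..n}" "\<lambda>k. of_real (X k)" a, unfolded X]
      by (simp add: e_def)
  qed
  ultimately show ?case by blast
qed

lemma sym_poly_represents:
  assumes "p \<in> sym_polys n"
  shows "\<exists>F. poly_fun n F \<and> jointly_symmetric n F \<and> represents n p F"
  using assms
proof (induction rule: sym_polys_induct)
  case (Const c)
  show ?case
    by (intro exI[of _ "\<lambda>_ _ _. c"])
      (simp add: poly_fun_const jointly_symmetric_def represents_def peval_hom)
next
  case (power_sum a)
  then show ?case using power_sum_represents[of n "a - 1"] by simp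
next
  case (add p q)
  then obtain F G where "poly_fun n F" "jointly_symmetric n F" "represents n p F"
    "poly_fun n G" "jointly_symmetric n G" "represents n q G" by blast
  then show ?case
    by (intro exI[of _ "\<lambda>\<eta> z y. F \<eta> z y + G \<eta> z y"])
      (simp add: poly_fun.add jointly_symmetric_def represents_def peval_hom)
next
  case (mult p q)
  then obtain F G where "poly_fun n F" "jointly_symmetric n F" "represents n p F"
    "poly_fun n G" "jointly_symmetric n G" "represents n q G" by blast
  then show ?case
    by (intro exI[of _ "\<lambda>\<eta> z y. F \<eta> z y * G \<eta> z y"])
      (simp add: poly_fun_mult jointly_symmetric_def represents_def peval_hom)
qed

section \<open>Moments of the Dirichlet density\<close>

definition dirichlet_density :: "nat \<Rightarrow> real \<Rightarrow> (nat \<Rightarrow> real) \<Rightarrow> real" where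
  "dirichlet_density n g \<eta> = (\<Prod>i=1..n. barycentric 1 n \<eta> i powr (g - 1))"

text \<open>Unnormalised: the constant \<open>Gamma (n * g) / Gamma g ^ n\<close> stays in front in
  both operators.\<close>

definition moment :: "nat \<Rightarrow> real \<Rightarrow> (nat \<Rightarrow> nat) \<Rightarrow> real" where
  "moment n g a = (LINT \<eta>|leb_on {Suc 1..n}. of_bool (open_simplex {Suc 1..n} \<eta>) *\<^sub>R
     (dirichlet_density n g \<eta> * (\<Prod>i=1..n. barycentric 1 n \<eta> i ^ a i)))"

lemma measurable_dirichlet_density:
  "dirichlet_density n g \<in> borel_measurable (leb_on {Suc 1..n})"
  unfolding dirichlet_density_def [abs_def]
  by (intro borel_measurable_prod powr_real_measurable measurable_barycentric borel_measurable_const)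

lemma measurable_of_bool_simplex:
  "(\<lambda>\<eta>. of_bool (open_simplex {Suc 1..n} \<eta>) :: real) \<in> borel_measurable (leb_on {Suc 1..n})"
proof -
  have "(\<lambda>\<eta>. of_bool (open_simplex {Suc 1..n} \<eta>) :: real) = (\<lambda>\<eta>. if open_simplex {Suc 1..n} \<eta> then 1 else 0)"
    by auto
  also have "\<dots> \<in> borel_measurable (leb_on {Suc 1..n})"
    by (intro measurable_If borel_measurable_const predE[OF measurable_open_simplex]) auto
  finally show ?thesis .
qed

lemma moment_integrand_nonneg:
  assumes "1 \<le> n"
  shows "0 \<le> of_bool (open_simplex {Suc 1..n} \<eta>) *\<^sub>R
     (dirichlet_density n g \<eta> * (\<Prod>i=1..n. barycentric 1 n \<eta> i ^ a i))"
proof (cases "open_simplex {Suc 1..n} \<eta>")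
  case True
  have "0 \<le> (\<Prod>i=1..n. barycentric 1 n \<eta> i ^ a i)"
    by (intro prod_nonneg zero_le_power less_imp_le barycentric_simplex(1)[OF assms True])
  moreover have "0 \<le> dirichlet_density n g \<eta>"
    unfolding dirichlet_density_def by (intro prod_nonneg) simp
  ultimately show ?thesis using True by simp
qed simp

text \<open>On the simplex the barycentric coordinates are at most \<open>1\<close>, so the
  integrand is dominated by the one with \<open>a = 0\<close>, whose integral is finite. The
  \<open>ennreal\<close> form makes the permutation lemmas for \<open>simplex_integral\<close>
  available.\<close>

lemma
  assumes "1 \<le> n" and g: "0 < g"
  shows integrable_moment: "integrable (leb_on {Suc 1..n}) (\<lambda>\<eta>. of_bool (open_simplex {Suc 1..n} \<eta>) *\<^sub>R
     (dirichlet_density n g \<eta> * (\<Prod>i=1..n. barycentric 1 n \<eta> i ^ a i)))" (is "integrable ?M ?f")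
    and moment_eq: "ennreal (moment n g a) = simplex_integral 1 n (\<lambda>i t. ennreal (t powr (g - 1) * t ^ a i))"
proof -
  have meas: "?f \<in> borel_measurable ?M"
    by (intro borel_measurable_scaleR borel_measurable_times borel_measurable_prod borel_measurable_power
        measurable_barycentric measurable_dirichlet_density measurable_of_bool_simplex)
  have nonneg: "0 \<le> ?f \<eta>" for \<eta>
    by (rule moment_integrand_nonneg[OF assms(1)])
  have eq: "ennreal (?f \<eta>) = (if open_simplex {Suc 1..n} \<eta>
      then \<Prod>i=1..n. ennreal (barycentric 1 n \<eta> i powr (g - 1) * barycentric 1 n \<eta> i ^ a i) else 0)" for \<eta>
  proof (cases "open_simplex {Suc 1..n} \<eta>")
    case True
    then have "0 < barycentric 1 n \<eta> i" if "i \<in> {1..n}" for i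
      using barycentric_simplex(1)[OF assms(1)] that by blast
    then have "(\<Prod>i=1..n. ennreal (barycentric 1 n \<eta> i powr (g - 1) * barycentric 1 n \<eta> i ^ a i)) =
      ennreal (\<Prod>i=1..n. barycentric 1 n \<eta> i powr (g - 1) * barycentric 1 n \<eta> i ^ a i)"
      by (intro prod_ennreal mult_nonneg_nonneg zero_le_power) (simp_all add: less_imp_le)
    then show ?thesis using True by (simp only: if_True of_bool_eq scaleR_one dirichlet_density_def prod.distrib)
  qed simp
  have nn: "(\<integral>\<^sup>+\<eta>. ennreal (?f \<eta>) \<partial>?M) = simplex_integral 1 n (\<lambda>i t. ennreal (t powr (g - 1) * t ^ a i))"
    unfolding eq simplex_integral_def ..
  also have "\<dots> \<le> simplex_integral 1 n (\<lambda>_ t. ennreal (t powr (g - 1)))"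
    unfolding simplex_integral_def
  proof (rule nn_integral_mono)
    fix \<eta> :: "nat \<Rightarrow> real"
    let ?e = "barycentric 1 n \<eta>"
    show "(if open_simplex {Suc 1..n} \<eta> then \<Prod>i=1..n. ennreal (?e i powr (g - 1) * ?e i ^ a i) else 0) \<le>
      (if open_simplex {Suc 1..n} \<eta> then \<Prod>i=1..n. ennreal (?e i powr (g - 1)) else 0)"
    proof (cases "open_simplex {Suc 1..n} \<eta>")
      case True
      note e = barycentric_simplex(1,2)[OF assms(1) True]
      have "(\<Prod>i=1..n. ennreal (?e i powr (g - 1) * ?e i ^ a i)) = ennreal (\<Prod>i=1..n. ?e i powr (g - 1) * ?e i ^ a i)"
        using e by (intro prod_ennreal mult_nonneg_nonneg zero_le_power) (simp_all add: less_imp_le)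
      also have "\<dots> \<le> ennreal (\<Prod>i=1..n. ?e i powr (g - 1))"
      proof (intro ennreal_leI prod_mono conjI)
        fix i assume i: "i \<in> {1..n}"
        have "?e i ^ a i \<le> 1" using e[OF i] by (intro power_le_one) auto
        then show "?e i powr (g - 1) * ?e i ^ a i \<le> ?e i powr (g - 1)"
          by (intro mult_left_le) auto
        show "0 \<le> ?e i powr (g - 1) * ?e i ^ a i" using e[OF i] by simp
      qed
      also have "\<dots> = (\<Prod>i=1..n. ennreal (?e i powr (g - 1)))"
        by (rule prod_ennreal[symmetric]) simp
      finally show ?thesis using True by (simp only: if_True)
    qed simp
  qed
  also have "\<dots> < \<infinity>" by (rule simplex_integral_powr_finite[OF assms])
  finally have fin: "(\<integral>\<^sup>+\<eta>. ennreal (?f \<eta>) \<partial>?M) < \<infinity>" .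
  show int: "integrable ?M ?f"
    by (rule integrableI_nonneg[OF meas AE_I2 fin]) (rule nonneg)
  show "ennreal (moment n g a) = simplex_integral 1 n (\<lambda>i t. ennreal (t powr (g - 1) * t ^ a i))"
    unfolding nn[symmetric] moment_def
    by (rule nn_integral_eq_integral[symmetric, OF int AE_I2]) (rule nonneg)
qed

lemma moment_nonneg: "1 \<le> n \<Longrightarrow> 0 \<le> moment n g a"
  unfolding moment_def by (rule integral_nonneg_AE[OF AE_I2]) (rule moment_integrand_nonneg)

lemma moment_permute:
  assumes "1 \<le> n" "0 < g" "\<pi> permutes {1..n}"
  shows "moment n g (a \<circ> \<pi>) = moment n g a"
proof -
  have "ennreal (moment n g (a \<circ> \<pi>)) = simplex_integral 1 n ((\<lambda>i t. ennreal (t powr (g - 1) * t ^ a i)) \<circ> \<pi>)"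
    using assms by (simp add: moment_eq comp_def)
  also have "\<dots> = ennreal (moment n g a)"
    using assms by (subst simplex_integral_permute) (auto simp: moment_eq)
  finally show ?thesis using moment_nonneg[OF assms(1)] by (simp add: ennreal_inj)
qed

lemma poly_fun_measurable:
  "poly_fun n F \<Longrightarrow> (\<lambda>\<eta>. F (barycentric 1 n \<eta>) z y) \<in> borel_measurable (leb_on {Suc 1..n})"
proof (induction rule: poly_fun.induct)
  case (monomial c a k)
  have "(\<lambda>\<eta>. \<Prod>i=1..n. barycentric 1 n \<eta> i ^ a i) \<in> borel_measurable (leb_on {Suc 1..n})"
    by (intro borel_measurable_prod borel_measurable_power measurable_barycentric)
  from measurable_compose[OF this borel_measurable_of_real]
  show ?case by (intro borel_measurable_times borel_measurable_const)
next
  case (add F G)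
  then show ?case by (intro borel_measurable_add)
qed

definition expectation_integrand :: "nat \<Rightarrow> real \<Rightarrow> ((nat \<Rightarrow> real) \<Rightarrow> complex) \<Rightarrow> (nat \<Rightarrow> real) \<Rightarrow> complex" where
  "expectation_integrand n g \<phi> \<eta> = of_bool (open_simplex {Suc 1..n} \<eta>) *\<^sub>R
     (of_real (dirichlet_density n g \<eta>) * \<phi> (barycentric 1 n \<eta>))"

definition dirichlet_integral :: "nat \<Rightarrow> real \<Rightarrow> ((nat \<Rightarrow> real) \<Rightarrow> complex) \<Rightarrow> complex" where
  "dirichlet_integral n g \<phi> = (LINT \<eta>|leb_on {Suc 1..n}. expectation_integrand n g \<phi> \<eta>)"

lemma monomial_integral:
  assumes "1 \<le> n" "0 < g"
  shows "integrable (leb_on {Suc 1..n}) (expectation_integrand n g (\<lambda>\<eta>. of_real (\<Prod>i=1..n. \<eta> i ^ a i) * c))"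
    and "dirichlet_integral n g (\<lambda>\<eta>. of_real (\<Prod>i=1..n. \<eta> i ^ a i) * c) = of_real (moment n g a) * c"
proof -
  have eq: "expectation_integrand n g (\<lambda>\<eta>. of_real (\<Prod>i=1..n. \<eta> i ^ a i) * c) =
    (\<lambda>\<eta>. of_real (of_bool (open_simplex {Suc 1..n} \<eta>) *\<^sub>R
     (dirichlet_density n g \<eta> * (\<Prod>i=1..n. barycentric 1 n \<eta> i ^ a i))) * c)"
    by (auto simp: expectation_integrand_def fun_eq_iff)
  show "integrable (leb_on {Suc 1..n}) (expectation_integrand n g (\<lambda>\<eta>. of_real (\<Prod>i=1..n. \<eta> i ^ a i) * c))"
    unfolding eq by (intro integrable_mult_left integrable_of_real integrable_moment assms)
  show "dirichlet_integral n g (\<lambda>\<eta>. of_real (\<Prod>i=1..n. \<eta> i ^ a i) * c) = of_real (moment n g a) * c"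
    unfolding dirichlet_integral_def eq moment_def
    by (simp only: integral_mult_left_zero integral_complex_of_real)
qed

lemma expectation_integrand_add:
  "expectation_integrand n g (\<lambda>\<eta>. \<phi> \<eta> + \<psi> \<eta>) = (\<lambda>\<eta>. expectation_integrand n g \<phi> \<eta> + expectation_integrand n g \<psi> \<eta>)"
  by (auto simp: expectation_integrand_def fun_eq_iff distrib_left scaleR_add_right)

lemma poly_fun_integrable:
  assumes "1 \<le> n" "0 < g" "poly_fun n F"
  shows "integrable (leb_on {Suc 1..n}) (expectation_integrand n g (\<lambda>\<eta>. F \<eta> z y))"
  using assms(3)
proof (induction rule: poly_fun.induct)
  case (monomial c a k)
  show ?case by (rule monomial_integral(1)[OF assms(1,2)])
next
  case (add F G)
  show ?case unfolding expectation_integrand_add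
    by (intro Bochner_Integration.integrable_add add.IH)
qed

lemma dirichlet_integral_add:
  assumes "1 \<le> n" "0 < g" "poly_fun n F" "poly_fun n G"
  shows "dirichlet_integral n g (\<lambda>\<eta>. F \<eta> z y + G \<eta> z y) =
    dirichlet_integral n g (\<lambda>\<eta>. F \<eta> z y) + dirichlet_integral n g (\<lambda>\<eta>. G \<eta> z y)"
  unfolding dirichlet_integral_def expectation_integrand_add
  using assms by (intro Bochner_Integration.integral_add poly_fun_integrable)

lemma poly_fun_permute:
  assumes "\<pi> permutes {1..n}" "poly_fun n F"
  shows "poly_fun n (\<lambda>\<eta> z y. F (\<eta> \<circ> \<pi>) z y)"
  using assms(2)
proof (induction rule: poly_fun.induct)
  case (monomial c a k)
  have "(\<Prod>i=1..n. (\<eta> \<circ> \<pi>) i ^ a i) = (\<Prod>i=1..n. \<eta> i ^ (a \<circ> inv \<pi>) i)" for \<eta> :: "nat \<Rightarrow> real"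
    using prod.permute[OF assms(1), of "\<lambda>i. \<eta> i ^ (a \<circ> inv \<pi>) i"] permutes_inverses[OF assms(1)]
    by (simp add: comp_def)
  then show ?case using poly_fun.monomial[OF monomial, of "a \<circ> inv \<pi>" k] by simp
next
  case (add F G)
  show ?case by (rule poly_fun.add[OF add.IH])
qed

text \<open>On a monomial in \<open>\<eta>\<close> the permutation moves to the exponents as its
  inverse, and moments are invariant under it.\<close>

lemma dirichlet_integral_permute:
  assumes "1 \<le> n" "0 < g" "\<pi> permutes {1..n}" "poly_fun n F"
  shows "dirichlet_integral n g (\<lambda>\<eta>. F (\<eta> \<circ> \<pi>) z y) = dirichlet_integral n g (\<lambda>\<eta>. F \<eta> z y)"
  using assms(4)
proof (induction rule: poly_fun.induct)
  case (monomial c a k)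
  have "(\<Prod>i=1..n. (\<eta> \<circ> \<pi>) i ^ a i) = (\<Prod>i=1..n. \<eta> i ^ (a \<circ> inv \<pi>) i)" for \<eta> :: "nat \<Rightarrow> real"
    using prod.permute[OF assms(3), of "\<lambda>i. \<eta> i ^ (a \<circ> inv \<pi>) i"] permutes_inverses[OF assms(3)]
    by (simp add: comp_def)
  then show ?case
    by (simp only: monomial_integral(2)[OF assms(1,2)] moment_permute[OF assms(1,2) permutes_inv[OF assms(3)]])
next
  case (add F G)
  then show ?case
    by (simp only: dirichlet_integral_add[OF assms(1,2)]
        dirichlet_integral_add[OF assms(1,2) poly_fun_permute[OF assms(3)] poly_fun_permute[OF assms(3)]])
qed

text \<open>Integrating a monomial multiplies its coefficient by a moment. One \<open>H\<close>, a
  polynomial in \<open>z\<close> over polynomials in \<open>y\<close>, serves all complex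
  \<open>z\<close>; this is what connects \<open>z > 1\<close> with \<open>z = 0\<close>.\<close>

lemma dirichlet_integral_poly:
  assumes "1 \<le> n" "0 < g" "poly_fun n F"
  shows "\<exists>H. (\<forall>k. vars_in n (coeff H k)) \<and>
    (\<forall>z y. dirichlet_integral n g (\<lambda>\<eta>. F \<eta> z y) = peval (poly H (Const z)) y)"
  using assms(3)
proof (induction rule: poly_fun.induct)
  case (monomial c a k)
  show ?case
  proof (intro exI conjI allI)
    let ?H = "Polynomial.monom (Const (of_real (moment n g a)) * c) k"
    show "vars_in n (coeff ?H r)" for r
      using monomial by (auto intro: vars_in_mult vars_in_Const vars_in_zero)
    show "dirichlet_integral n g (\<lambda>\<eta>. of_real (\<Prod>i=1..n. \<eta> i ^ a i) * (z ^ k * peval c y)) =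
        peval (poly ?H (Const z)) y" for z y
      unfolding monomial_integral(2)[OF assms(1,2)] by (simp only: poly_monom peval_hom ac_simps)
  qed
next
  case (add F G)
  then obtain H K where H: "\<forall>k. vars_in n (coeff H k)" "\<forall>k. vars_in n (coeff K k)"
    "\<forall>z y. dirichlet_integral n g (\<lambda>\<eta>. F \<eta> z y) = peval (poly H (Const z)) y"
    "\<forall>z y. dirichlet_integral n g (\<lambda>\<eta>. G \<eta> z y) = peval (poly K (Const z)) y" by blast
  show ?case
    by (intro exI[of _ "H + K"])
      (use H add.hyps in \<open>auto simp: dirichlet_integral_add[OF assms(1,2)] peval_hom intro: vars_in_add\<close>)
qed

subsection \<open>The operators\<close>

lemma pos_increasingD:
  assumes "pos_increasing n y"
  shows "strict_mono_on {1..n} y" "\<forall>i\<in>{1..n}. 0 < y i" "inj_on y {1..n}" "\<forall>i\<in>{1..n}. y i \<noteq> 0"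
    "\<And>i j. 1 \<le> i \<Longrightarrow> i < j \<Longrightarrow> j \<le> n \<Longrightarrow> y i < y j"
  using assms strict_mono_on_imp_inj_on[of "{1..n}" y]
  by (auto simp: pos_increasing_def strict_mono_onD)

lemma interlacingD:
  assumes "interlacing n m z y x" "i \<in> {m..<n}"
  shows "y i < x i" "x i < y (Suc i)"
  using assms by (auto simp: interlacing_def)

lemma eta_pos:
  assumes "1 \<le> n" and z: "z = 0 \<or> 1 < z" and y: "pos_increasing n y"
    and int: "interlacing n 1 z y x" and i: "i \<in> {1..n}"
  shows "0 < eta n 1 z y (completed n 1 z y x) i"
proof -
  define X where "X = completed n 1 z y x"
  have X: "X k = x k" if "k < n" for k using that by (simp add: X_def completed_def)
  have last: "0 < (X n - y j) / (z - 1)" if "j \<in> {1..n}" for j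
  proof (cases "z = 0")
    case True
    then show ?thesis using pos_increasingD(2)[OF y] that
      by (auto simp: X_def completed_def last_coord_def)
  next
    case False
    then have "1 < z" using z by auto
    then have "y n < X n"
      using int by (simp add: interlacing_def X_def completed_def zero_less_divide_iff)
    moreover have "y j \<le> y n"
      using pos_increasingD(5)[OF y, of j n] that by (cases "j = n") auto
    ultimately show ?thesis using \<open>1 < z\<close> by simp
  qed
  have ratio: "0 < (X k - y i) / (y k - y i)" if "k \<in> {1..<n}" "k \<noteq> i" for k
  proof (cases "k < i")
    case True
    have "x k < y i"
      using interlacingD(2)[OF int that(1)] pos_increasingD(5)[OF y, of "Suc k" i] True i
      by (cases "Suc k = i") auto
    then show ?thesis using pos_increasingD(5)[OF y, of k i] True that i X[of k]
      by (auto simp: zero_less_divide_iff)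
  next
    case False
    then have "y i < y k" using pos_increasingD(5)[OF y, of i k] that i by auto
    then show ?thesis using interlacingD(1)[OF int that(1)] X[of k] that by (auto simp: zero_less_divide_iff)
  qed
  have yi: "0 < y i" using pos_increasingD(2)[OF y] i by auto
  have eq: "eta n 1 z y X i = (X i - y i) * (\<Prod>k\<in>{1..n} - {i}. (X k - y i) / (y k - y i)) / (z - 1) / y i"
    unfolding eta_def prod_dividef using i by (subst prod.remove[of _ i]) auto
  show ?thesis
  proof (cases "i = n")
    case True
    have "0 < (\<Prod>k\<in>{1..n} - {i}. (X k - y i) / (y k - y i))"
      using ratio True by (intro prod_pos) auto
    moreover have "eta n 1 z y X i = ((X n - y n) / (z - 1)) * (\<Prod>k\<in>{1..n} - {i}. (X k - y i) / (y k - y i)) / y i"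
      unfolding eq by (simp add: True)
    moreover have "0 < (X n - y n) / (z - 1)" using last[of n] \<open>1 \<le> n\<close> by auto
    ultimately show ?thesis unfolding X_def[symmetric] using yi
      by (simp only: divide_pos_pos mult_pos_pos)
  next
    case False
    then have "i < n" using i by auto
    have P: "0 < (\<Prod>k\<in>{1..n} - {i} - {n}. (X k - y i) / (y k - y i))"
      using ratio by (intro prod_pos) auto
    have "(\<Prod>k\<in>{1..n} - {i}. (X k - y i) / (y k - y i)) =
       (X n - y i) / (y n - y i) * (\<Prod>k\<in>{1..n} - {i} - {n}. (X k - y i) / (y k - y i))"
      using \<open>i < n\<close> by (subst prod.remove[of _ n]) auto
    then have E: "eta n 1 z y X i = (X i - y i) * ((X n - y i) / (z - 1)) / (y n - y i) *
        (\<Prod>k\<in>{1..n} - {i} - {n}. (X k - y i) / (y k - y i)) / y i"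
      unfolding eq by (simp add: mult_ac)
    have "0 < X i - y i" using interlacingD(1)[OF int, of i] X[of i] \<open>i < n\<close> i by auto
    moreover have "0 < y n - y i" using pos_increasingD(5)[OF y, of i n] \<open>i < n\<close> i by auto
    ultimately show ?thesis unfolding X_def[symmetric] E
      by (intro divide_pos_pos mult_pos_pos last[OF i] yi P)
  qed
qed

lemma prod_completed_interlacing:
  assumes "1 \<le> n" and y: "pos_increasing n y" and int: "interlacing n 1 z y x"
  shows "(\<Prod>k=1..n. completed n 1 z y x k) = z * (\<Prod>k=1..n. y k)"
proof (rule prod_completed[OF assms(1)], rule ballI)
  fix i assume i: "i \<in> {1..<n}"
  then have "i \<in> {1..n}" by auto
  then have "0 < y i" using pos_increasingD(2)[OF y] by blast
  then show "x i \<noteq> 0" using interlacingD(1)[OF int i] by simp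
qed

lemma barycentric_eta:
  assumes "1 \<le> n" and z: "z = 0 \<or> 1 < z" and y: "pos_increasing n y"
    and int: "interlacing n 1 z y x" and i: "i \<in> {1..n}"
  defines "e \<equiv> eta n 1 z y (completed n 1 z y x)"
  shows "barycentric 1 n (restrict e {Suc 1..n}) i = e i"
proof -
  have "sum e {1..n} = 1"
    unfolding e_def using pos_increasingD(3,4)[OF y] z prod_completed_interlacing[OF assms(1) y int]
    by (intro sum_eta) auto
  moreover have "sum e {1..n} = e 1 + sum e {Suc 1..n}"
    using assms(1) by (simp add: sum.atLeast_Suc_atMost)
  moreover have "sum (restrict e {Suc 1..n}) {Suc 1..n} = sum e {Suc 1..n}" by simp
  ultimately show ?thesis using i unfolding barycentric_def by (cases "i = 1") auto
qed

lemma pencil_cong: "(\<And>i. i \<in> {1..n} \<Longrightarrow> \<eta> i = \<eta>' i) \<Longrightarrow> pencil n \<eta> z y = pencil n \<eta>' z y"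
  unfolding pencil_def by (intro sum.cong) auto

text \<open>This is \<open>prod_eta\<close> at \<open>t = 1 / s\<close>, multiplied by
  \<open>s ^ n\<close>. It holds for infinitely many real \<open>s\<close>, hence as an identity of
  complex polynomials.\<close>

lemma pencil_eta:
  assumes "1 \<le> n" and z: "z = 0 \<or> 1 < z" and y: "pos_increasing n y"
    and int: "interlacing n 1 z y x"
  defines "X \<equiv> completed n 1 z y x"
  shows "(\<Prod>k=1..n. [:1, - complex_of_real (X k):]) =
    pencil n (barycentric 1 n (restrict (eta n 1 z y X) {Suc 1..n})) (of_real z) y"
proof -
  let ?e = "eta n 1 z y X"
  have id: "(\<Prod>k=1..n. t - X k) = (\<Sum>i=1..n. ?e i * (t - z * y i) * (\<Prod>k\<in>{1..n} - {i}. t - y k))" for t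
    unfolding X_def using pos_increasingD(3,4)[OF y] z prod_completed_interlacing[OF assms(1) y int]
    by (intro prod_eta) auto
  have real: "(\<Prod>k=1..n. 1 - s * X k) = (\<Sum>i=1..n. ?e i * (1 - s * (z * y i)) * (\<Prod>k\<in>{1..n} - {i}. 1 - s * y k))"
    if "s \<noteq> 0" for s
  proof -
    have scale: "s * (1 / s - c) = 1 - s * c" for c using that by (simp add: right_diff_distrib)
    have scale_prod: "s ^ card A * (\<Prod>k\<in>A. 1 / s - c k) = (\<Prod>k\<in>A. 1 - s * c k)" for A and c :: "nat \<Rightarrow> real"
      unfolding prod_constant[symmetric] prod.distrib[symmetric] scale ..
    have "(\<Prod>k=1..n. 1 - s * X k) = s ^ card {1..n} * (\<Prod>k=1..n. 1 / s - X k)"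
      by (rule scale_prod[symmetric])
    also have "\<dots> = (\<Sum>i=1..n. s ^ card {1..n} * (?e i * (1 / s - z * y i) * (\<Prod>k\<in>{1..n} - {i}. 1 / s - y k)))"
      unfolding id sum_distrib_left ..
    also have "\<dots> = (\<Sum>i=1..n. ?e i * (1 - s * (z * y i)) * (\<Prod>k\<in>{1..n} - {i}. 1 - s * y k))"
    proof (rule sum.cong[OF refl])
      fix i assume i: "i \<in> {1..n}"
      have "s ^ card {1..n} = s * s ^ card ({1..n} - {i})"
        unfolding card.remove[OF finite_atLeastAtMost i] by simp
      then have "s ^ card {1..n} * (?e i * (1 / s - z * y i) * (\<Prod>k\<in>{1..n} - {i}. 1 / s - y k)) =
        ?e i * (s * (1 / s - z * y i)) * (s ^ card ({1..n} - {i}) * (\<Prod>k\<in>{1..n} - {i}. 1 / s - y k))"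
        by (simp only: mult_ac)
      then show "s ^ card {1..n} * (?e i * (1 / s - z * y i) * (\<Prod>k\<in>{1..n} - {i}. 1 / s - y k)) =
        ?e i * (1 - s * (z * y i)) * (\<Prod>k\<in>{1..n} - {i}. 1 - s * y k)"
        by (simp only: scale_prod scale)
    qed
    finally show ?thesis .
  qed
  let ?P = "(\<Prod>k=1..n. [:1, - complex_of_real (X k):]) - pencil n ?e (of_real z) y"
  have "poly ?P (of_real s) = 0" if "s \<noteq> 0" for s
  proof -
    have "poly (\<Prod>k=1..n. [:1, - complex_of_real (X k):]) (of_real s) = of_real (\<Prod>k=1..n. 1 - s * X k)"
      by (simp add: poly_prod)
    moreover have "poly (pencil n ?e (of_real z) y) (of_real s) =
        of_real (\<Sum>i=1..n. ?e i * (1 - s * (z * y i)) * (\<Prod>k\<in>{1..n} - {i}. 1 - s * y k))"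
      by (simp add: pencil_def poly_sum poly_prod algebra_simps)
    ultimately have "poly ?P (of_real s) = of_real (\<Prod>k=1..n. 1 - s * X k) -
        of_real (\<Sum>i=1..n. ?e i * (1 - s * (z * y i)) * (\<Prod>k\<in>{1..n} - {i}. 1 - s * y k))"
      by (simp only: poly_diff)
    then show ?thesis by (simp only: real[OF that] diff_self)
  qed
  then have "of_real ` {0<..} \<subseteq> {s. poly ?P s = 0}" by auto
  moreover have "infinite (complex_of_real ` {0<..})"
    using infinite_Ioi[of "0::real"] by (simp add: finite_image_iff inj_on_def)
  ultimately have "?P = 0" using poly_roots_finite finite_subset by blast
  moreover have "pencil n (barycentric 1 n (restrict ?e {Suc 1..n})) (of_real z) y = pencil n ?e (of_real z) y"
    using barycentric_eta[OF assms(1) z y int] unfolding X_def by (intro pencil_cong)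
  ultimately show ?thesis by simp
qed

text \<open>On the interlacing region the powers of \<open>eta\<close> and the value of
  \<open>p\<close> are functions of the weights, for fixed \<open>y\<close> and \<open>z\<close>, so
  \<open>integral_interlacing\<close> applies. The two operators are its cases \<open>z > 1\<close>
  and \<open>z = 0\<close>.\<close>

lemma weight_integral:
  assumes n: "1 \<le> n" and g: "0 < g" and z: "z = 0 \<or> 1 < z" and y: "pos_increasing n y"
    and F: "poly_fun n F" "represents n p F"
  defines "\<Phi> \<equiv> \<lambda>x. weight_on n 1 z y x *\<^sub>R
    (of_real (\<Prod>i=1..n. eta n 1 z y (completed n 1 z y x) i powr (g - 1)) * peval p (completed n 1 z y x))"
  shows "integrable (leb_on {1..<n}) \<Phi>"
    and "(LINT x|leb_on {1..<n}. \<Phi> x) = dirichlet_integral n g (\<lambda>\<eta>. F \<eta> (of_real z) y)"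
proof -
  define \<phi> where "\<phi> \<eta> = of_real (dirichlet_density n g \<eta>) * F (barycentric 1 n \<eta>) (of_real z) y" for \<eta>
  let ?T = "\<lambda>x. restrict (eta n 1 z y (completed n 1 z y x)) {Suc 1..n}"
  have \<phi>: "\<phi> \<in> borel_measurable (leb_on {Suc 1..n})"
    unfolding \<phi>_def [abs_def]
    by (intro borel_measurable_times poly_fun_measurable[OF F(1)]
        measurable_compose[OF measurable_dirichlet_density borel_measurable_of_real])
  have eq: "\<Phi> = (\<lambda>x. weight_on n 1 z y x *\<^sub>R \<phi> (?T x))"
  proof
    fix x
    show "\<Phi> x = weight_on n 1 z y x *\<^sub>R \<phi> (?T x)"
    proof (cases "interlacing n 1 z y x")
      case True
      have "peval p (completed n 1 z y x) = F (barycentric 1 n (?T x)) (of_real z) y"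
        using F(2) pencil_eta[OF n z y True] unfolding represents_def by blast
      moreover have "dirichlet_density n g (?T x) = (\<Prod>i=1..n. eta n 1 z y (completed n 1 z y x) i powr (g - 1))"
        unfolding dirichlet_density_def
        by (intro prod.cong refl) (simp only: barycentric_eta[OF n z y True])
      ultimately show ?thesis unfolding \<Phi>_def \<phi>_def by (simp only:)
    qed (simp add: \<Phi>_def weight_on_def)
  qed
  have eq': "(\<lambda>\<eta>. of_bool (open_simplex {Suc 1..n} \<eta>) *\<^sub>R \<phi> \<eta>) = expectation_integrand n g (\<lambda>\<eta>. F \<eta> (of_real z) y)"
    by (simp add: fun_eq_iff \<phi>_def expectation_integrand_def)
  note main = integral_interlacing[OF n z pos_increasingD(1,2)[OF y] \<phi>, unfolded eq']
  show "integrable (leb_on {1..<n}) \<Phi>"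
    unfolding eq main(1) by (rule poly_fun_integrable[OF n g F(1)])
  show "(LINT x|leb_on {1..<n}. \<Phi> x) = dirichlet_integral n g (\<lambda>\<eta>. F \<eta> (of_real z) y)"
    unfolding eq main(2) dirichlet_integral_def ..
qed

lemma weight_Vandermonde:
  "weight n 1 z y X = Vandermonde n X / Vandermonde n y / (\<Prod>k=1..<n. X k * (z - 1))"
proof -
  have "(\<Prod>(i,j)\<in>A. f i j / h i j) = (\<Prod>(i,j)\<in>A. f i j) / (\<Prod>(i,j)\<in>A. h i j)"
    for A and f h :: "nat \<Rightarrow> nat \<Rightarrow> real"
    by (simp add: case_prod_beta prod_dividef)
  then show ?thesis unfolding weight_def Vandermonde_def by (simp only:)
qed

text \<open>At \<open>z = 0\<close> the eliminated coordinate is \<open>0\<close>, which turns the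
  value of \<open>q\<close> into that of \<open>set_last_zero n q\<close> and the last interlacing
  condition into \<open>0 < y n\<close>.\<close>

lemma QQ_integrand_weight:
  assumes n: "2 \<le> n" and y: "pos_increasing n y"
  shows "indicator (Omega' n y) x *\<^sub>R QQ_integrand n g (set_last_zero n q) y x = weight_on n 1 0 y x *\<^sub>R
    (of_real (\<Prod>i=1..n. eta n 1 0 y (completed n 1 0 y x) i powr (g - 1)) * peval q (completed n 1 0 y x))"
proof -
  have iff: "x \<in> Omega' n y \<longleftrightarrow> interlacing n 1 0 y x"
  proof -
    have "{1..n - 1} = {1..<n}" using n by auto
    moreover have "0 < y n" using pos_increasingD(2)[OF y] n by auto
    ultimately show ?thesis by (simp add: Omega'_def interlacing_def last_coord_def)
  qed
  define X where "X = completed n 1 0 y x"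
  have X: "X = x(n := 0)" by (simp add: X_def completed_def last_coord_def)
  have idx: "{1..n} = insert n {1..n - 1}" "n \<notin> {1..n - 1}" "{1..<n} = {1..n - 1}" using n by auto
  show ?thesis
  proof (cases "interlacing n 1 0 y x")
    case True
    have x0: "x k \<noteq> 0" if "k \<in> {1..n - 1}" for k
    proof -
      have "k \<in> {1..<n}" "k \<in> {1..n}" using that by auto
      then show ?thesis using interlacingD(1)[OF True] pos_increasingD(2)[OF y] by (metis less_trans less_irrefl)
    qed
    have xi: "xi_hat n y x i = eta n 1 0 y X i" if "i \<in> {1..n}" for i
    proof -
      have "y i \<noteq> 0" using pos_increasingD(4)[OF y] that by blast
      \<comment> \<open>The factor of index \<open>n\<close> is \<open>- y i\<close> and cancels the
        normalisation \<open>y i * (0 - 1)\<close> in \<open>eta\<close>.\<close>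
      have "(\<Prod>k=1..n. X k - y i) = (0 - y i) * (\<Prod>k=1..n - 1. x k - y i)"
        unfolding idx(1) prod.insert[OF finite_atLeastAtMost idx(2)]
        by (intro arg_cong2[of _ _ _ _ "(*)"] prod.cong) (use idx(2) in \<open>auto simp: X\<close>)
      then show ?thesis using \<open>y i \<noteq> 0\<close> by (simp add: xi_hat_def eta_def)
    qed
    have W: "Vandermonde (n - 1) x / Vandermonde n y = weight n 1 0 y X"
    proof -
      let ?P = "\<lambda>n. {(i,j). 1 \<le> i \<and> i < j \<and> j \<le> n}"
      have fin: "finite (?P m)" for m :: nat by (rule finite_subset[of _ "{..m} \<times> {..m}"]) auto
      have split: "?P n = ?P (n - 1) \<union> (\<lambda>i. (i, n)) ` {1..n - 1}"
        using n by (auto simp: image_iff)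
      have "(\<Prod>(i,j)\<in>?P n. X j - X i) = (\<Prod>(i,j)\<in>?P (n - 1). X j - X i) * (\<Prod>(i,j)\<in>(\<lambda>i. (i, n)) ` {1..n - 1}. X j - X i)"
        unfolding split by (rule prod.union_disjoint) (use fin n in auto)
      also have "(\<Prod>(i,j)\<in>(\<lambda>i. (i, n)) ` {1..n - 1}. X j - X i) = (\<Prod>i=1..n - 1. X n - X i)"
        by (subst prod.reindex) (auto simp: inj_on_def)
      also have "\<dots> = (\<Prod>i=1..n - 1. X i * (0 - 1))"
        by (intro prod.cong) (auto simp: X)
      also have "(\<Prod>(i,j)\<in>?P (n - 1). X j - X i) = Vandermonde (n - 1) x"
        unfolding Vandermonde_def using n by (intro prod.cong) (auto simp: X)
      finally have "Vandermonde n X = Vandermonde (n - 1) x * (\<Prod>i=1..n - 1. X i * (0 - 1))"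
        unfolding Vandermonde_def[of n] .
      then have "weight n 1 0 y X = Vandermonde (n - 1) x * (\<Prod>i=1..n - 1. X i * (0 - 1)) /
          Vandermonde n y / (\<Prod>i=1..n - 1. X i * (0 - 1))"
        unfolding weight_Vandermonde idx(3) by (simp only:)
      moreover have "(\<Prod>i=1..n - 1. X i * (0 - 1)) \<noteq> 0"
      proof -
        have "X i * (0 - 1) \<noteq> 0" if "i \<in> {1..n - 1}" for i using x0[OF that] that idx(2) by (auto simp: X)
        then show ?thesis by (simp add: prod_zero_iff)
      qed
      ultimately show ?thesis by simp
    qed
    have "(\<Prod>i=1..n. xi_hat n y x i powr (g - 1)) = (\<Prod>i=1..n. eta n 1 0 y X i powr (g - 1))"
      by (intro prod.cong refl) (simp only: xi)
    then show ?thesis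
      using True iff unfolding QQ_integrand_def peval_set_last_zero X_def[symmetric] X[symmetric] W weight_on_def
      by (simp add: scaleR_conv_of_real)
  next
    case False
    then show ?thesis using iff by (simp add: weight_on_def)
  qed
qed

lemma QQ_dirichlet:
  assumes n: "2 \<le> n" and g: "0 < g" and y: "pos_increasing n y"
    and F: "poly_fun n F" "represents n q F"
  shows "set_integrable (leb (n - 1)) (Omega' n y) (QQ_integrand n g (set_last_zero n q) y)"
    and "QQ n g (set_last_zero n q) y = of_real (Gamma (n * g) / Gamma g ^ n) * dirichlet_integral n g (\<lambda>\<eta>. F \<eta> 0 y)"
proof -
  have idx: "{1..n - 1} = {1..<n}" using n by auto
  have "1 \<le> n" using n by simp
  note main = weight_integral[OF \<open>1 \<le> n\<close> g disjI1[OF refl] y F]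
  show "set_integrable (leb (n - 1)) (Omega' n y) (QQ_integrand n g (set_last_zero n q) y)"
    unfolding set_integrable_def QQ_integrand_weight[OF n y] idx by (rule main(1))
  show "QQ n g (set_last_zero n q) y = of_real (Gamma (n * g) / Gamma g ^ n) * dirichlet_integral n g (\<lambda>\<eta>. F \<eta> 0 y)"
    unfolding QQ_def set_lebesgue_integral_def QQ_integrand_weight[OF n y] idx main(2) by simp
qed

text \<open>Let \<open>R\<close> be the product of the first \<open>n - 1\<close> coordinates. The
  partial derivatives of the graph function are \<open>- x n / x k\<close>, those of
  \<open>h\<close> are \<open>R * (x n / x k)\<close> and, for \<open>k = n\<close>, just
  \<open>R\<close>. So the area element and the norm of the gradient share the same square root, and
  \<open>1 / R\<close> is left.\<close>

lemma delta_integral_interlacing: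
  assumes n: "2 \<le> n" and z: "1 < z" and y: "pos_increasing n y"
  shows "delta_integral n (Omega n y) (\<lambda>x. (\<Prod>i=1..n. x i) - z * (\<Prod>i=1..n. y i)) F =
    (LINT x|leb_on {1..<n}. indicator {x. interlacing n 1 z y x} x *\<^sub>R
      (F (completed n 1 z y x) / of_real (\<Prod>k=1..<n. x k)))"
proof -
  define h where "h x = (\<Prod>i=1..n. x i) - z * (\<Prod>i=1..n. y i)" for x :: "nat \<Rightarrow> real"
  define S where "S = {x \<in> Omega n y. h x = 0}"
  define \<phi> where "\<phi> x = (THE t. x(n := t) \<in> S)" for x
  let ?L = "last_coord n 1 z y"
  have idx: "{1..n} = insert n {1..<n}" "n \<notin> {1..<n}" "{1..n - 1} = {1..<n}" using n by auto
  have y0: "0 < y i" if "i \<in> {1..n}" for i using pos_increasingD(2)[OF y] that by blast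
  have pos: "0 < x i" if "\<forall>i\<in>{1..<n}. y i < x i" "i \<in> {1..<n}" for x i
    using that y0[of i] by force
  \<comment> \<open>The product condition determines \<open>t\<close>, so the surface is a graph
    over the interlacing region and the definite description in \<open>\<phi>\<close> is meaningful
    there.\<close>
  have S_iff: "x(n := t) \<in> S \<longleftrightarrow> interlacing n 1 z y x \<and> t = ?L x" for x t
  proof -
    have prod: "(\<Prod>i=1..n. (x(n := t)) i) = t * (\<Prod>i=1..<n. x i)"
      unfolding idx(1) by simp
    have Om: "x(n := t) \<in> Omega n y \<longleftrightarrow> (\<forall>i\<in>{1..<n}. y i < x i \<and> x i < y (Suc i)) \<and> y n < t"
      unfolding Omega_def idx by auto
    show ?thesis
    proof (cases "\<forall>i\<in>{1..<n}. y i < x i")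
      case True
      then have "0 < (\<Prod>i=1..<n. x i)" using pos by (intro prod_pos) auto
      then have "(\<Prod>i=1..<n. x i) \<noteq> 0" by (rule less_imp_neq[symmetric])
      then have "h (x(n := t)) = 0 \<longleftrightarrow> t = ?L x"
        unfolding h_def prod last_coord_def nonzero_eq_divide_eq[OF \<open>(\<Prod>i=1..<n. x i) \<noteq> 0\<close>]
        by (simp only: right_minus_eq)
      then show ?thesis using Om z by (auto simp: S_def interlacing_def zero_less_divide_iff)
    qed (use Om in \<open>auto simp: S_def interlacing_def\<close>)
  qed
  have D: "{x. \<exists>t. x(n := t) \<in> S} = {x. interlacing n 1 z y x}" by (simp add: S_iff)
  have \<phi>: "\<phi> x = ?L x" if "interlacing n 1 z y x" for x
    unfolding \<phi>_def using that by (simp add: S_iff)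
  have ratio: "of_real (sqrt (1 + (grad_norm (n - 1) \<phi> x)\<^sup>2)) * (G / of_real (grad_norm n h (x(n := \<phi> x)))) =
      G / of_real (\<Prod>k=1..<n. x k)" if int: "interlacing n 1 z y x" for x and G :: complex
  proof -
    define R where "R = (\<Prod>k=1..<n. x k)"
    have "\<forall>i\<in>{1..<n}. y i < x i" using interlacingD(1)[OF int] by blast
    from pos[OF this] have x0: "0 < x k" if "k \<in> {1..<n}" for k using that .
    have R: "0 < R" unfolding R_def by (intro prod_pos x0)
    have deriv_\<phi>: "deriv (\<lambda>t. \<phi> (x(k := t))) (x k) = - (?L x / x k)" if k: "k \<in> {1..<n}" for k
    proof -
      define c where "c = ?L x * x k"
      have L: "?L (x(k := t)) = c / t" for t
      proof -
        have "(\<Prod>i=1..<n. (x(k := t)) i) = t * (\<Prod>i\<in>{1..<n} - {k}. x i)"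
          using k by (subst prod.remove[of _ k]) (auto intro!: prod.cong)
        moreover have "(\<Prod>i=1..<n. x i) = x k * (\<Prod>i\<in>{1..<n} - {k}. x i)"
          using k by (subst prod.remove[of _ k]) auto
        ultimately show ?thesis using x0[OF k] by (simp add: c_def last_coord_def)
      qed
      \<comment> \<open>\<open>\<phi>\<close> is known to equal \<open>c / t\<close> only inside the
        interlacing region. All its inequalities are strict, so they persist for \<open>t\<close>
        near \<open>x k\<close>, which is what \<open>deriv\<close> needs.\<close>
      have "0 < c / x k - y n"
        using int z x0[OF k] by (simp add: c_def interlacing_def zero_less_divide_iff)
      moreover have "((\<lambda>t. c / t - y n) \<longlongrightarrow> c / x k - y n) (nhds (x k))"
      proof -
        have "isCont (\<lambda>t. c / t - y n) (x k)" using x0[OF k] by (intro continuous_intros) auto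
        then show ?thesis
          using tendsto_at_iff_tendsto_nhds[of "\<lambda>t. c / t - y n" "x k"] by (simp only: isCont_def)
      qed
      ultimately have "\<forall>\<^sub>F t in nhds (x k). 0 < c / t - y n"
        by (rule order_tendstoD(1)[rotated])
      moreover have "\<forall>\<^sub>F t in nhds (x k). y k < t \<and> t < y (Suc k)"
        using interlacingD[OF int k] by (intro eventually_conj eventually_nhds_in_open[of "{y k<..}", simplified]
            eventually_nhds_in_open[of "{..<y (Suc k)}", simplified])
      ultimately have "\<forall>\<^sub>F t in nhds (x k). \<phi> (x(k := t)) = c / t"
      proof eventually_elim
        case (elim t)
        then have "interlacing n 1 z y (x(k := t))"
          unfolding interlacing_def L using interlacingD[OF int] z k by auto
        then show ?case using \<phi> L by simp
      qed
      then have "deriv (\<lambda>t. \<phi> (x(k := t))) (x k) = deriv (\<lambda>t. c / t) (x k)"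
        by (rule deriv_cong_ev) simp
      also have "\<dots> = - (c / (x k * x k))"
        using x0[OF k] by (intro DERIV_imp_deriv) (auto intro!: derivative_eq_intros)
      finally show ?thesis using x0[OF k] by (simp add: c_def)
    qed
    have deriv_h: "deriv (\<lambda>t. h ((x(n := ?L x))(k := t))) ((x(n := ?L x)) k) =
        (\<Prod>i\<in>{1..n} - {k}. (x(n := ?L x)) i)" if k: "k \<in> {1..n}" for k
    proof -
      let ?X = "x(n := ?L x)"
      have "h (?X(k := t)) = t * (\<Prod>i\<in>{1..n} - {k}. ?X i) - z * (\<Prod>i=1..n. y i)" for t
      proof -
        have "(\<Prod>i=1..n. (?X(k := t)) i) = t * (\<Prod>i\<in>{1..n} - {k}. ?X i)"
          using k by (subst prod.remove[of _ k]) (auto intro!: prod.cong)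
        then show ?thesis by (simp add: h_def)
      qed
      then show ?thesis
        by (simp only:) (intro DERIV_imp_deriv, auto intro!: derivative_eq_intros)
    qed
    define G2 where "G2 = (\<Sum>k=1..<n. (?L x / x k)\<^sup>2)"
    have "0 \<le> G2" unfolding G2_def by (intro sum_nonneg) auto
    have "(grad_norm (n - 1) \<phi> x)\<^sup>2 = G2"
    proof -
      have "(\<Sum>k=1..n - 1. (deriv (\<lambda>t. \<phi> (x(k := t))) (x k))\<^sup>2) = G2"
        unfolding G2_def idx(3) by (intro sum.cong refl) (simp add: deriv_\<phi>)
      then show ?thesis using \<open>0 \<le> G2\<close> by (simp add: grad_norm_def)
    qed
    moreover have "grad_norm n h (x(n := \<phi> x)) = R * sqrt (1 + G2)"
    proof -
      have 1: "(\<Prod>i\<in>{1..n} - {n}. (x(n := ?L x)) i) = R"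
      proof -
        have "{1..n} - {n} = {1..<n}" by auto
        then show ?thesis unfolding R_def by (auto intro!: prod.cong)
      qed
      have 2: "(\<Prod>i\<in>{1..n} - {k}. (x(n := ?L x)) i) = R * (?L x / x k)" if k: "k \<in> {1..<n}" for k
      proof -
        have "{1..n} - {k} = insert n ({1..<n} - {k})" using k n by auto
        then have "(\<Prod>i\<in>{1..n} - {k}. (x(n := ?L x)) i) = ?L x * (\<Prod>i\<in>{1..<n} - {k}. x i)"
          by (auto intro!: prod.cong)
        moreover have "R = x k * (\<Prod>i\<in>{1..<n} - {k}. x i)"
          unfolding R_def using k by (subst prod.remove[of _ k]) auto
        ultimately show ?thesis using x0[OF k] by simp
      qed
      have "(\<Sum>k=1..n. (deriv (\<lambda>t. h ((x(n := ?L x))(k := t))) ((x(n := ?L x)) k))\<^sup>2) =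
        (\<Sum>k=1..n. (\<Prod>i\<in>{1..n} - {k}. (x(n := ?L x)) i)\<^sup>2)"
        by (intro sum.cong refl) (simp only: deriv_h)
      also have "\<dots> = R\<^sup>2 + (\<Sum>k=1..<n. (\<Prod>i\<in>{1..n} - {k}. (x(n := ?L x)) i)\<^sup>2)"
        unfolding 1[symmetric] by (subst idx(1), subst sum.insert) (use idx(2) in auto)
      also have "(\<Sum>k=1..<n. (\<Prod>i\<in>{1..n} - {k}. (x(n := ?L x)) i)\<^sup>2) = R\<^sup>2 * G2"
        unfolding G2_def sum_distrib_left by (intro sum.cong refl) (simp only: 2 power_mult_distrib)
      also have "R\<^sup>2 + R\<^sup>2 * G2 = R\<^sup>2 * (1 + G2)" by (simp only: distrib_left mult_1_right)
      finally have "grad_norm n h (x(n := ?L x)) = sqrt (R\<^sup>2 * (1 + G2))"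
        by (simp only: grad_norm_def)
      then show ?thesis using R \<phi>[OF int] by (simp add: real_sqrt_mult)
    qed
    ultimately have "of_real (sqrt (1 + (grad_norm (n - 1) \<phi> x)\<^sup>2)) * (G / of_real (grad_norm n h (x(n := \<phi> x)))) =
       of_real (sqrt (1 + G2)) * (G / of_real (R * sqrt (1 + G2)))" by (simp only:)
    also have "\<dots> = G / of_real R" using \<open>0 \<le> G2\<close> by simp
    finally show ?thesis by (simp only: R_def)
  qed
  have "delta_integral n (Omega n y) h F = (LINT x:{x. interlacing n 1 z y x}|leb (n - 1).
      of_real (sqrt (1 + (grad_norm (n - 1) \<phi> x)\<^sup>2)) * (F (x(n := \<phi> x)) / of_real (grad_norm n h (x(n := \<phi> x)))))"
    unfolding delta_integral_def surface_integral_def Let_def S_def[symmetric] D \<phi>_def ..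
  also have "\<dots> = (LINT x|leb_on {1..<n}. indicator {x. interlacing n 1 z y x} x *\<^sub>R
      (F (completed n 1 z y x) / of_real (\<Prod>k=1..<n. x k)))"
    unfolding set_lebesgue_integral_def idx(3)
  proof (rule Bochner_Integration.integral_cong[OF refl])
    fix x
    show "indicator {x. interlacing n 1 z y x} x *\<^sub>R (of_real (sqrt (1 + (grad_norm (n - 1) \<phi> x)\<^sup>2)) *
        (F (x(n := \<phi> x)) / of_real (grad_norm n h (x(n := \<phi> x))))) =
      indicator {x. interlacing n 1 z y x} x *\<^sub>R (F (completed n 1 z y x) / of_real (\<Prod>k=1..<n. x k))"
    proof (cases "interlacing n 1 z y x")
      case True
      show ?thesis unfolding ratio[OF True] unfolding \<phi>[OF True] completed_def by (rule refl)
    qed simp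
  qed
  finally show ?thesis unfolding h_def [abs_def] .
qed

lemma Vandermonde_pos: "pos_increasing n y \<Longrightarrow> 0 < Vandermonde n y"
  unfolding Vandermonde_def by (intro prod_pos) (auto simp: pos_increasingD(5))

text \<open>A balance of factors. The denominator of the weight supplies
  \<open>(z - 1) ^ (n - 1)\<close> and the product of the \<open>x k\<close>, which the delta
  integral divides out; \<open>xi\<close>, being \<open>eta * y * (z - 1)\<close>, supplies
  \<open>(z - 1) powr (n * (g - 1))\<close> and the powers of the \<open>y i\<close>. The total
  exponent \<open>n * g - 1\<close> of \<open>z - 1\<close> is cancelled by the prefactor.\<close>

lemma Q_dirichlet:
  assumes n: "2 \<le> n" and g: "0 < g" and z: "1 < z" and y: "pos_increasing n y"
    and F: "poly_fun n F" "represents n p F"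
  shows "Q_integral n g z p y = of_real (Gamma (n * g) / Gamma g ^ n) * dirichlet_integral n g (\<lambda>\<eta>. F \<eta> (of_real z) y)"
proof -
  have "1 \<le> n" using n by simp
  have z': "z = 0 \<or> 1 < z" using z by simp
  define V where "V = Vandermonde n y"
  define Y where "Y = (\<Prod>i=1..n. y i powr (g - 1))"
  \<comment> \<open>The ratio of the integrand of the delta integral to that of
    \<open>weight_integral\<close>, and the reciprocal of the part of the prefactor that depends on
    \<open>y\<close> and \<open>z\<close>.\<close>
  define K where "K = V * Y * (z - 1) powr (n * g - 1)"
  have y0: "0 < y i" if "i \<in> {1..n}" for i using pos_increasingD(2)[OF y] that by blast
  have V0: "0 < V" unfolding V_def by (rule Vandermonde_pos[OF y])
  have Y0: "0 < Y" unfolding Y_def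
  proof (rule prod_pos)
    fix i assume "i \<in> {1..n}"
    from y0[OF this] show "0 < y i powr (g - 1)" by simp
  qed
  let ?X = "completed n 1 z y"
  let ?\<Phi> = "\<lambda>x. weight_on n 1 z y x *\<^sub>R (of_real (\<Prod>i=1..n. eta n 1 z y (?X x) i powr (g - 1)) * peval p (?X x))"
  have "indicator {x. interlacing n 1 z y x} x *\<^sub>R
      (of_real (Vandermonde n (?X x) * (\<Prod>i=1..n. xi n y (?X x) i powr (g - 1))) * peval p (?X x) /
        of_real (\<Prod>k=1..<n. x k)) = of_real K * ?\<Phi> x" for x
  proof (cases "interlacing n 1 z y x")
    case True
    define R where "R = (\<Prod>k=1..<n. x k)"
    define E where "E = (\<Prod>i=1..n. eta n 1 z y (?X x) i powr (g - 1))"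
    define w where "w = weight n 1 z y (?X x)"
    have R0: "0 < R" unfolding R_def
    proof (rule prod_pos)
      fix k assume k: "k \<in> {1..<n}"
      then have "0 < y k" by (intro y0) auto
      then show "0 < x k" using interlacingD(1)[OF True k] by simp
    qed
    have prodX: "(\<Prod>k=1..<n. ?X x k * (z - 1)) = R * (z - 1) ^ (n - 1)"
    proof -
      have "(\<Prod>k=1..<n. ?X x k) = R" unfolding R_def by (intro prod.cong) (auto simp: completed_def)
      then show ?thesis by (simp add: prod.distrib)
    qed
    have "R * (z - 1) ^ (n - 1) \<noteq> 0" using R0 z by simp
    then have VX: "Vandermonde n (?X x) = w * V * (R * (z - 1) ^ (n - 1))"
      unfolding w_def weight_Vandermonde prodX V_def[symmetric] using V0 by simp
    have xi: "xi n y (?X x) i powr (g - 1) =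
        eta n 1 z y (?X x) i powr (g - 1) * y i powr (g - 1) * (z - 1) powr (g - 1)" if i: "i \<in> {1..n}" for i
    proof -
      have "xi n y (?X x) i = eta n 1 z y (?X x) i * y i * (z - 1)"
        using y0[OF i] z by (simp add: xi_def eta_def)
      moreover have "0 < eta n 1 z y (?X x) i" by (rule eta_pos[OF \<open>1 \<le> n\<close> z' y True i])
      ultimately show ?thesis using y0[OF i] z by (simp add: powr_mult)
    qed
    have "(\<Prod>i=1..n. xi n y (?X x) i powr (g - 1)) = (\<Prod>i=1..n. eta n 1 z y (?X x) i powr (g - 1) * y i powr (g - 1) * (z - 1) powr (g - 1))"
      by (intro prod.cong refl xi)
    also have "\<dots> = E * Y * ((z - 1) powr (g - 1)) ^ n"
      by (simp add: prod.distrib E_def Y_def)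
    also have "((z - 1) powr (g - 1)) ^ n = (z - 1) powr (n * (g - 1))"
      using z by (simp add: powr_power mult.commute)
    finally have XI: "(\<Prod>i=1..n. xi n y (?X x) i powr (g - 1)) = E * Y * (z - 1) powr (n * (g - 1))" .
    have pow: "(z - 1) ^ (n - 1) * (z - 1) powr (n * (g - 1)) = (z - 1) powr (n * g - 1)"
      using z n by (simp add: powr_realpow[symmetric] powr_add[symmetric] of_nat_diff algebra_simps)
    have "Vandermonde n (?X x) * (\<Prod>i=1..n. xi n y (?X x) i powr (g - 1)) =
      w * V * R * E * Y * ((z - 1) ^ (n - 1) * (z - 1) powr (n * (g - 1)))"
      unfolding VX XI by (simp only: mult_ac)
    also have "\<dots> = R * (K * (w * E))" unfolding pow K_def by (simp only: mult_ac)
    finally have "of_real (Vandermonde n (?X x) * (\<Prod>i=1..n. xi n y (?X x) i powr (g - 1))) * peval p (?X x) /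
        of_real R = of_real (K * (w * E)) * peval p (?X x)" using R0 by simp
    then show ?thesis using True
      unfolding R_def[symmetric] E_def[symmetric] weight_on_def w_def[symmetric]
      by (simp add: scaleR_conv_of_real mult_ac)
  qed (simp add: weight_on_def)
  then have "delta_integral n (Omega n y) (\<lambda>x. (\<Prod>i=1..n. x i) - z * (\<Prod>i=1..n. y i))
       (\<lambda>x. of_real (Vandermonde n x * (\<Prod>i=1..n. xi n y x i powr (g - 1))) * peval p x) =
     of_real K * dirichlet_integral n g (\<lambda>\<eta>. F \<eta> (of_real z) y)"
    unfolding delta_integral_interlacing[OF n z y]
    by (simp only: integral_mult_right_zero weight_integral(2)[OF \<open>1 \<le> n\<close> g z' y F])
  then have "Q_integral n g z p y = of_real (Gamma (n * g) / Gamma g ^ n * ((z - 1) powr (1 - n * g) / (V * Y))) *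
     (of_real K * dirichlet_integral n g (\<lambda>\<eta>. F \<eta> (of_real z) y))"
    unfolding Q_integral_def V_def Y_def by (simp only:)
  also have "\<dots> = of_real (Gamma (n * g) / Gamma g ^ n * ((z - 1) powr (1 - n * g) / (V * Y)) * K) *
      dirichlet_integral n g (\<lambda>\<eta>. F \<eta> (of_real z) y)"
    by (simp only: of_real_mult mult.assoc)
  also have "Gamma (n * g) / Gamma g ^ n * ((z - 1) powr (1 - n * g) / (V * Y)) * K = Gamma (n * g) / Gamma g ^ n"
  proof -
    have "(z - 1) powr (1 - n * g) * (z - 1) powr (n * g - 1) = 1"
      using z by (simp add: powr_add[symmetric])
    then have "(z - 1) powr (1 - n * g) / (V * Y) * K = 1"
      unfolding K_def using V0 Y0 by (simp add: mult_ac)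
    then show ?thesis by (simp only: mult.assoc mult_1_right)
  qed
  finally show ?thesis .
qed

section \<open>Polynomial continuation in \<open>z\<close>\<close>

lemma peval_poly: "peval (poly H (Const z)) y = (\<Sum>k\<le>degree H. peval (coeff H k) y * z ^ k)"
  by (simp only: poly_altdef peval_hom)

text \<open>For fixed \<open>y\<close> both sides are complex polynomials in \<open>z\<close> that
  agree on the infinite set \<open>z > 1\<close>; the values at increasing positive \<open>y\<close>
  then determine the polynomial in \<open>y\<close>.\<close>

lemma poly_Const_eqI:
  assumes A: "\<And>z. vars_in n (poly A (Const z))" and B: "\<And>z. vars_in n (poly B (Const z))"
    and eq: "\<And>z y. 1 < z \<Longrightarrow> pos_increasing n y \<Longrightarrow>
      peval (poly A (Const (of_real z))) y = peval (poly B (Const (of_real z))) y"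
  shows "poly A (Const z) = poly B (Const z)"
proof (rule peval_eqI[OF A B])
  fix y assume y: "pos_increasing n y"
  define a where "a H = (\<Sum>k\<le>degree H. Polynomial.monom (peval (coeff H k) y) k)" for H
  have a: "poly (a H) w = peval (poly H (Const w)) y" for H w
    unfolding a_def peval_poly by (simp add: poly_sum poly_monom)
  have "of_real ` {1<..} \<subseteq> {w. poly (a A - a B) w = 0}"
    using eq[OF _ y] by (auto simp: a)
  moreover have "infinite (complex_of_real ` {1<..})"
    using infinite_Ioi[of "1::real"] by (simp add: finite_image_iff inj_on_def)
  ultimately have "a A - a B = 0" using poly_roots_finite finite_subset by blast
  then have "poly (a A) z = poly (a B) z" by simp
  then show "peval (poly A (Const z)) y = peval (poly B (Const z)) y" by (simp only: a)
qed

text \<open>One \<open>H\<close> describes the action of all operators of the family on a single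
  \<open>p\<close>. Linearity in \<open>p\<close> is not part of it and is recovered from
  uniqueness.\<close>

definition Q_poly :: "nat \<Rightarrow> real \<Rightarrow> cpoly \<Rightarrow> cpoly poly \<Rightarrow> bool" where
  "Q_poly n g p H \<longleftrightarrow> (\<forall>z. poly H (Const z) \<in> sym_polys n) \<and>
     (\<forall>z>1. \<forall>y. pos_increasing n y \<longrightarrow> peval (poly H (Const (of_real z))) y = Q_integral n g z p y) \<and>
     (\<forall>y. pos_increasing n y \<longrightarrow> peval (poly H 0) y = QQ n g (set_last_zero n p) y)"

lemma Q_poly_exists:
  assumes n: "2 \<le> n" and g: "0 < g" and p: "p \<in> sym_polys n"
  shows "\<exists>H. Q_poly n g p H"
proof -
  have "1 \<le> n" using n by simp
  obtain F where F: "poly_fun n F" "jointly_symmetric n F" "represents n p F"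
    using sym_poly_represents[OF p] by blast
  obtain H where H: "\<And>k. vars_in n (coeff H k)"
    "\<And>z y. dirichlet_integral n g (\<lambda>\<eta>. F \<eta> z y) = peval (poly H (Const z)) y"
    using dirichlet_integral_poly[OF \<open>1 \<le> n\<close> g F(1)] by blast
  define C where "C = complex_of_real (Gamma (n * g) / Gamma g ^ n)"
  have val: "peval (poly (smult (Const C) H) (Const z)) y = C * dirichlet_integral n g (\<lambda>\<eta>. F \<eta> z y)" for z y
    by (simp add: peval_hom H(2))
  have vars: "vars_in n (poly (smult (Const C) H) (Const z))" for z
    unfolding poly_smult unfolding poly_altdef by (intro vars_in_mult vars_in_sum vars_in_power vars_in_Const H(1))
  have "psubst (\<lambda>i. Var (\<pi> i)) (poly (smult (Const C) H) (Const z)) = poly (smult (Const C) H) (Const z)"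
    (is "?l = ?r") if \<pi>: "\<pi> permutes {1..n}" for \<pi> z
  proof -
    show ?thesis
    proof (rule peval_eqI[OF _ vars])
      show "vars_in n ?l"
        using permutes_in_image[OF \<pi>] by (intro vars_in_psubst[OF _ vars] vars_in_Var) auto
      \<comment> \<open>In general \<open>y \<circ> \<pi>\<close> is not increasing, so the original
        integrals say nothing about it; the Dirichlet integral makes sense for every
        \<open>y\<close>, and joint symmetry shifts the permutation from \<open>y\<close> to
        \<open>\<eta>\<close>.\<close>
      fix y
      have "F \<eta> z (y \<circ> \<pi>) = F (\<eta> \<circ> inv \<pi>) z y" for \<eta>
      proof -
        have "F ((\<eta> \<circ> inv \<pi>) \<circ> \<pi>) z (y \<circ> \<pi>) = F (\<eta> \<circ> inv \<pi>) z y"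
          using F(2) \<pi> unfolding jointly_symmetric_def by blast
        then show ?thesis by (simp add: comp_assoc permutes_inv_o(2)[OF \<pi>])
      qed
      then have "dirichlet_integral n g (\<lambda>\<eta>. F \<eta> z (y \<circ> \<pi>)) = dirichlet_integral n g (\<lambda>\<eta>. F \<eta> z y)"
        by (simp only: dirichlet_integral_permute[OF \<open>1 \<le> n\<close> g permutes_inv[OF \<pi>] F(1)])
      moreover have "peval ?l y = peval ?r (y \<circ> \<pi>)"
        unfolding peval_psubst_Var by (simp only: comp_def)
      ultimately show "peval ?l y = peval ?r y" unfolding val by (simp only:)
    qed
  qed
  then have "poly (smult (Const C) H) (Const z) \<in> sym_polys n" for z
    using vars by (simp only: sym_polys_iff) blast
  moreover have "peval (poly (smult (Const C) H) 0) y = QQ n g (set_last_zero n p) y" if "pos_increasing n y" for y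
    using val[of 0 y] QQ_dirichlet(2)[OF n g that F(1,3)] by (simp only: Const_0 C_def)
  moreover have "peval (poly (smult (Const C) H) (Const (of_real z))) y = Q_integral n g z p y"
    if "1 < z" "pos_increasing n y" for z y
    unfolding val Q_dirichlet[OF n g that F(1,3)] unfolding C_def ..
  ultimately show ?thesis unfolding Q_poly_def by blast
qed

text \<open>Read off from the Dirichlet form: sums and multiples of representing families represent
  sums and multiples, and such families are integrable.\<close>

lemma Q_integral_linear:
  assumes n: "2 \<le> n" and g: "0 < g" and z: "1 < z" and y: "pos_increasing n y"
    and pq: "p \<in> sym_polys n" "q \<in> sym_polys n"
  shows "Q_integral n g z (p + q) y = Q_integral n g z p y + Q_integral n g z q y"
    and "Q_integral n g z (Const c * p) y = c * Q_integral n g z p y"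
proof -
  have "1 \<le> n" using n by simp
  obtain F G where F: "poly_fun n F" "represents n p F" and G: "poly_fun n G" "represents n q G"
    using sym_poly_represents[OF pq(1)] sym_poly_represents[OF pq(2)] by blast
  have "represents n (p + q) (\<lambda>\<eta> z y. F \<eta> z y + G \<eta> z y)"
    using F(2) G(2) by (simp add: represents_def peval_hom)
  from Q_dirichlet[OF n g z y poly_fun.add[OF F(1) G(1)] this]
  show "Q_integral n g z (p + q) y = Q_integral n g z p y + Q_integral n g z q y"
    unfolding Q_dirichlet[OF n g z y F] Q_dirichlet[OF n g z y G] dirichlet_integral_add[OF \<open>1 \<le> n\<close> g F(1) G(1)]
    by (simp only: distrib_left)
  have "represents n (Const c * p) (\<lambda>\<eta> z y. c * F \<eta> z y)"
    using F(2) by (simp add: represents_def peval_hom)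
  note Q_dirichlet[OF n g z y poly_fun_mult[OF poly_fun_const F(1)] this]
  moreover have "dirichlet_integral n g (\<lambda>\<eta>. c * F \<eta> w y) = c * dirichlet_integral n g (\<lambda>\<eta>. F \<eta> w y)" for w
  proof -
    have "expectation_integrand n g (\<lambda>\<eta>. c * F \<eta> w y) = (\<lambda>\<eta>. c * expectation_integrand n g (\<lambda>\<eta>. F \<eta> w y) \<eta>)"
      by (auto simp: expectation_integrand_def fun_eq_iff)
    then show ?thesis unfolding dirichlet_integral_def by (simp only: integral_mult_right_zero)
  qed
  ultimately show "Q_integral n g z (Const c * p) y = c * Q_integral n g z p y"
    unfolding Q_dirichlet[OF n g z y F] by (simp only: mult_ac)
qed

text \<open>The polynomials \<open>H p\<close> are chosen separately for each \<open>p\<close>;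
  linearity is forced afterwards, because \<open>Q_integral\<close> is linear for
  \<open>z > 1\<close> and the values there determine a polynomial in \<open>z\<close>. The value
  \<open>undefined\<close> off the symmetric polynomials makes \<open>Q\<close> extensional.\<close>

lemma is_Q_family_exists:
  assumes n: "2 \<le> n" and g: "0 < g"
  shows "\<exists>Q. is_Q_family n g Q \<and> (\<forall>p\<in>sym_polys n. \<forall>y. pos_increasing n y \<longrightarrow>
    peval (Q 0 p) y = QQ n g (set_last_zero n p) y)"
proof -
  obtain H where H: "\<And>p. p \<in> sym_polys n \<Longrightarrow> Q_poly n g p (H p)"
    using Q_poly_exists[OF n g] by metis
  define Q where "Q z p = (if p \<in> sym_polys n then poly (H p) (Const z) else undefined)" for z p
  have Q: "Q z p = poly (H p) (Const z)" if "p \<in> sym_polys n" for z p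
    using that by (simp add: Q_def)
  have sym: "poly (H p) (Const z) \<in> sym_polys n"
    and val: "1 < r \<Longrightarrow> pos_increasing n y \<Longrightarrow> peval (poly (H p) (Const (of_real r))) y = Q_integral n g r p y"
    and zero: "pos_increasing n y \<Longrightarrow> peval (poly (H p) 0) y = QQ n g (set_last_zero n p) y"
    if "p \<in> sym_polys n" for p z r y
    using H[OF that] unfolding Q_poly_def by blast+
  have vars: "vars_in n (poly (H p) (Const z))" if "p \<in> sym_polys n" for p z
    using sym[OF that] by (simp add: sym_polys_iff)
  have "Q z \<in> linear_operators (sym_polys n) (sym_polys n)" for z
    unfolding linear_operators_def
  proof (intro CollectI conjI ballI allI)
    show "Q z \<in> sym_polys n \<rightarrow>\<^sub>E sym_polys n"
      by (auto simp: Q_def sym)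
    fix p q assume p: "p \<in> sym_polys n" and q: "q \<in> sym_polys n"
    note pq = sym_polys_add[OF p q]
    have "poly (H (p + q)) (Const z) = poly (H p + H q) (Const z)"
    proof (rule poly_Const_eqI[where n=n])
      show "vars_in n (poly (H (p + q)) (Const z))" "vars_in n (poly (H p + H q) (Const z))" for z
        using vars[OF pq] vars[OF p] vars[OF q] by (auto intro: vars_in_add)
      show "peval (poly (H (p + q)) (Const (of_real r))) y = peval (poly (H p + H q) (Const (of_real r))) y"
        if "1 < r" "pos_increasing n y" for r y
        by (simp only: poly_add peval_hom val[OF pq that] val[OF p that] val[OF q that]
            Q_integral_linear(1)[OF n g that p q])
    qed
    then show "Q z (p + q) = Q z p + Q z q" by (simp only: Q[OF pq] Q[OF p] Q[OF q] poly_add)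
  next
    fix c p assume p: "p \<in> sym_polys n"
    note cp = sym_polys_mult[OF sym_polys_Const p, of c]
    have "poly (H (Const c * p)) (Const z) = poly (smult (Const c) (H p)) (Const z)"
    proof (rule poly_Const_eqI[where n=n])
      show "vars_in n (poly (H (Const c * p)) (Const z))" "vars_in n (poly (smult (Const c) (H p)) (Const z))" for z
        using vars[OF cp] vars[OF p] by (auto intro: vars_in_mult vars_in_Const)
      show "peval (poly (H (Const c * p)) (Const (of_real r))) y = peval (poly (smult (Const c) (H p)) (Const (of_real r))) y"
        if "1 < r" "pos_increasing n y" for r y
        by (simp only: poly_smult peval_hom val[OF cp that] val[OF p that] Q_integral_linear(2)[OF n g that p p])
    qed
    then show "Q z (Const c * p) = Const c * Q z p" by (simp only: Q[OF cp] Q[OF p] poly_smult)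
  qed
  moreover have "\<exists>N c. \<forall>z. Q z p = (\<Sum>k\<le>N. Const (z ^ k) * c k)" if "p \<in> sym_polys n" for p
    unfolding Q[OF that] poly_altdef
    by (intro exI[of _ "degree (H p)"] exI[of _ "coeff (H p)"]) (simp add: Const_power mult.commute)
  ultimately have "is_Q_family n g Q"
    unfolding is_Q_family_def using val by (simp add: Q)
  moreover have "peval (Q 0 p) y = QQ n g (set_last_zero n p) y" if "p \<in> sym_polys n" "pos_increasing n y" for p y
    using zero[OF that] by (simp add: Q[OF that(1)])
  ultimately show ?thesis by blast
qed

lemma is_Q_family_unique:
  assumes Q: "is_Q_family n g Q" and Q': "is_Q_family n g Q'"
  shows "Q = Q'"
proof (intro ext)
  fix z p
  show "Q z p = Q' z p"
  proof (cases "p \<in> sym_polys n")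
    case False
    then show ?thesis using Q Q' unfolding is_Q_family_def linear_operators_def
      by (auto simp: PiE_def extensional_def)
  next
    case True
    have family: "\<exists>H. \<forall>z. R z p = poly H (Const z)" if R: "is_Q_family n g R" for R
    proof -
      obtain N c where "\<And>z. R z p = (\<Sum>k\<le>N. Const (z ^ k) * c k)"
        using R True unfolding is_Q_family_def by blast
      then show ?thesis
        by (intro exI[of _ "\<Sum>k\<le>N. Polynomial.monom (c k) k"])
          (simp add: poly_sum poly_monom Const_power mult.commute)
    qed
    obtain H H' where H: "\<And>z. Q z p = poly H (Const z)" and H': "\<And>z. Q' z p = poly H' (Const z)"
      using family[OF Q] family[OF Q'] by blast
    have vars: "vars_in n (R z p)" if "is_Q_family n g R" for R z
    proof -
      have "R z \<in> sym_polys n \<rightarrow>\<^sub>E sym_polys n"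
        using that unfolding is_Q_family_def linear_operators_def by blast
      then have "R z p \<in> sym_polys n" using True by (rule PiE_mem)
      then show ?thesis by (simp only: sym_polys_iff)
    qed
    show ?thesis
      unfolding H H'
    proof (rule poly_Const_eqI[where n=n])
      show "vars_in n (poly H (Const z))" "vars_in n (poly H' (Const z))" for z
        using vars[OF Q] vars[OF Q'] by (simp_all only: H[symmetric] H'[symmetric])
      show "peval (poly H (Const (of_real z))) y = peval (poly H' (Const (of_real z))) y"
        if "1 < z" "pos_increasing n y" for z y
        unfolding H[symmetric] H'[symmetric] using Q Q' True that unfolding is_Q_family_def by simp
    qed
  qed
qed

section \<open>The operator at \<open>z = 0\<close> and its factorisation\<close>

lemma Q_op_props:
  assumes n: "2 \<le> n" and g: "0 < g"
  shows "is_Q_family n g (Q_op n g)"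
    and "\<And>p y. p \<in> sym_polys n \<Longrightarrow> pos_increasing n y \<Longrightarrow> peval (Q_op n g 0 p) y = QQ n g (set_last_zero n p) y"
proof -
  obtain Q where Q: "is_Q_family n g Q" "\<And>p y. p \<in> sym_polys n \<Longrightarrow> pos_increasing n y \<Longrightarrow>
      peval (Q 0 p) y = QQ n g (set_last_zero n p) y"
    using is_Q_family_exists[OF n g] by blast
  have "Q_op n g = Q"
    unfolding Q_op_def using Q(1) is_Q_family_unique by blast
  then show "is_Q_family n g (Q_op n g)"
    and "\<And>p y. p \<in> sym_polys n \<Longrightarrow> pos_increasing n y \<Longrightarrow> peval (Q_op n g 0 p) y = QQ n g (set_last_zero n p) y"
    using Q by auto
qed

text \<open>By \<open>Q_op_props\<close> the values of \<open>Q_op n g 0 p\<close> depend only on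
  \<open>set_last_zero n p\<close>, so the operator factors; surjectivity of
  \<open>set_last_zero\<close> leaves no freedom in the factor.\<close>

lemma Q0'_exists_unique:
  assumes n: "2 \<le> n" and g: "0 < g"
  shows "\<exists>!T. T \<in> linear_operators (sym_polys (n - 1)) (sym_polys n) \<and>
    (\<forall>p\<in>sym_polys n. Q_op n g 0 p = T (set_last_zero n p))"
proof (rule ex_ex1I)
  let ?A = "sym_polys (n - 1)" and ?B = "sym_polys n"
  have lin: "Q_op n g 0 \<in> linear_operators ?B ?B"
    using Q_op_props(1)[OF n g] by (simp add: is_Q_family_def)
  then have Q0: "Q_op n g 0 p \<in> ?B" if "p \<in> ?B" for p
    using that by (auto simp: linear_operators_def)
  have factor: "Q_op n g 0 p = Q_op n g 0 q"
    if "p \<in> ?B" "q \<in> ?B" "set_last_zero n p = set_last_zero n q" for p q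
  proof (rule peval_eqI)
    show "vars_in n (Q_op n g 0 p)" "vars_in n (Q_op n g 0 q)"
      using Q0[OF that(1)] Q0[OF that(2)] by (simp_all only: sym_polys_iff)
    fix y assume y: "pos_increasing n y"
    show "peval (Q_op n g 0 p) y = peval (Q_op n g 0 q) y"
      unfolding Q_op_props(2)[OF n g that(1) y] Q_op_props(2)[OF n g that(2) y] that(3) ..
  qed
  have "\<forall>p\<in>?A. \<exists>q. q \<in> ?B \<and> set_last_zero n q = p"
    using set_last_zero_surj by blast
  \<comment> \<open>\<open>s\<close> is an arbitrary choice of lifts and need not be linear;
    \<open>factor\<close> makes the result independent of it, and linearity of \<open>T\<close>
    follows.\<close>
  from bchoice[OF this] obtain s where "\<forall>p\<in>?A. s p \<in> ?B \<and> set_last_zero n (s p) = p" ..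
  then have s: "s p \<in> ?B \<and> set_last_zero n (s p) = p" if "p \<in> ?A" for p
    using that by (rule bspec)
  define T where "T p = (if p \<in> ?A then Q_op n g 0 (s p) else undefined)" for p
  have T: "T (set_last_zero n p) = Q_op n g 0 p" if "p \<in> ?B" for p
  proof -
    note q = set_last_zero_sym_polys[OF that]
    have "T (set_last_zero n p) = Q_op n g 0 (s (set_last_zero n p))"
      using q by (simp only: T_def if_True)
    also have "\<dots> = Q_op n g 0 p"
      using s[OF q] that by (intro factor) blast+
    finally show ?thesis .
  qed
  have "T \<in> linear_operators ?A ?B"
    unfolding linear_operators_def
  proof (intro CollectI conjI ballI allI)
    show "T \<in> ?A \<rightarrow>\<^sub>E ?B" using s Q0 by (auto simp: T_def)
    fix p q assume p: "p \<in> ?A" and q: "q \<in> ?A"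
    have "T (p + q) = T (set_last_zero n (s p + s q))"
      using s[OF p] s[OF q] by (simp add: set_last_zero_def psubst_hom)
    also have "\<dots> = Q_op n g 0 (s p) + Q_op n g 0 (s q)"
      using s[OF p] s[OF q] lin by (simp add: T sym_polys_add linear_operators_def)
    finally show "T (p + q) = T p + T q" using p q by (simp add: T_def)
  next
    fix c p assume p: "p \<in> ?A"
    have "T (Const c * p) = T (set_last_zero n (Const c * s p))"
      using s[OF p] by (simp add: set_last_zero_def psubst_hom)
    also have "\<dots> = Const c * Q_op n g 0 (s p)"
      using s[OF p] lin by (simp add: T sym_polys_mult sym_polys_Const linear_operators_def)
    finally show "T (Const c * p) = Const c * T p" using p by (simp add: T_def)
  qed
  then show "\<exists>T. T \<in> linear_operators ?A ?B \<and> (\<forall>p\<in>?B. Q_op n g 0 p = T (set_last_zero n p))"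
    by (intro exI[of _ T] conjI ballI) (simp_all only: T)
next
  fix T T'
  assume T: "T \<in> linear_operators (sym_polys (n - 1)) (sym_polys n) \<and> (\<forall>p\<in>sym_polys n. Q_op n g 0 p = T (set_last_zero n p))"
    and T': "T' \<in> linear_operators (sym_polys (n - 1)) (sym_polys n) \<and> (\<forall>p\<in>sym_polys n. Q_op n g 0 p = T' (set_last_zero n p))"
  show "T = T'"
  proof
    fix p
    show "T p = T' p"
    proof (cases "p \<in> sym_polys (n - 1)")
      case True
      then obtain q where q: "q \<in> sym_polys n" "set_last_zero n q = p" using set_last_zero_surj by blast
      have "Q_op n g 0 q = T p" "Q_op n g 0 q = T' p" using T T' q by blast+
      then show ?thesis by simp
    next
      case False
      then show ?thesis using T T' unfolding linear_operators_def by (auto simp: PiE_def extensional_def)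
    qed
  qed
qed

text \<open>The integrability claim is there because a Bochner integral of a non-integrable function
  is \<open>0\<close> by convention; it certifies that \<open>QQ\<close> is an honest integral. Each
  \<open>p\<close> is treated through a lift \<open>q\<close> to \<open>n\<close> variables, since
  the results on \<open>QQ\<close> concern \<open>set_last_zero n q\<close>.\<close>

theorem theorem7p1:
  fixes n :: nat and g :: real
  assumes "n \<ge> 2" and "g > 0"
  shows "(\<forall>p\<in>sym_polys (n - 1). \<forall>y. pos_increasing n y \<longrightarrow>
            set_integrable (leb (n - 1)) (Omega' n y) (QQ_integrand n g p y)) \<and>
         (\<forall>p\<in>sym_polys (n - 1). \<exists>q\<in>sym_polys n. \<forall>y. pos_increasing n y \<longrightarrow>
            QQ n g p y = peval q y) \<and>
         (\<exists>!T. T \<in> linear_operators (sym_polys (n - 1)) (sym_polys n) \<and>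
            (\<forall>p\<in>sym_polys n. Q_op n g 0 p = T (set_last_zero n p))) \<and>
         (\<forall>p\<in>sym_polys (n - 1). \<forall>y. pos_increasing n y \<longrightarrow>
            QQ n g p y = peval (Q0' n g p) y)"
proof -
  note ex1 = Q0'_exists_unique[OF assms]
  have Q0': "Q0' n g \<in> linear_operators (sym_polys (n - 1)) (sym_polys n)"
    "\<And>p. p \<in> sym_polys n \<Longrightarrow> Q_op n g 0 p = Q0' n g (set_last_zero n p)"
    using theI'[OF ex1] unfolding Q0'_def[symmetric] by auto
  have "set_integrable (leb (n - 1)) (Omega' n y) (QQ_integrand n g p y)"
    if p: "p \<in> sym_polys (n - 1)" and y: "pos_increasing n y" for p y
  proof -
    obtain q where q: "q \<in> sym_polys n" "set_last_zero n q = p" using set_last_zero_surj[OF p] by blast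
    obtain F where "poly_fun n F" "represents n q F" using sym_poly_represents[OF q(1)] by blast
    then show ?thesis using QQ_dirichlet(1)[OF assms y] q(2) by blast
  qed
  moreover have val: "QQ n g p y = peval (Q0' n g p) y" if p: "p \<in> sym_polys (n - 1)" and y: "pos_increasing n y" for p y
  proof -
    obtain q where q: "q \<in> sym_polys n" "set_last_zero n q = p" using set_last_zero_surj[OF p] by blast
    then show ?thesis using Q_op_props(2)[OF assms q(1) y] Q0'(2)[OF q(1)] by simp
  qed
  moreover have "Q0' n g p \<in> sym_polys n" if "p \<in> sym_polys (n - 1)" for p
    using Q0'(1) that by (auto simp: linear_operators_def)
  ultimately show ?thesis using ex1 by blast
qed

end
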